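(* Let $\mu\in\mathcal{P}^1(\mathbb{P})$ and let $(Y_i)_{i\ge 1}$ be an i.i.d. sequence of $\mathbb{P}$-valued random variables with law $\mu$. Let $S_1:=Y_1$ and $S_{n+1}:=S_n\#_{\frac{1}{n+1}}Y_{n+1}$ for $n\ge 1$. Then, almost surely, $S_n\to\Lambda(\mu)$ in $d_\infty$ as $n\to\infty$.
   Context: $\mathcal{H}$ is a Hilbert space (possibly infinite dimensional, possibly non-separable), and $\mathbb{P}$ is the cone of bounded self-adjoint positive definite invertible operators on $\mathcal{H}$; $\|\cdot\|$ is the operator norm. The Thompson metric on $\mathbb{P}$ is $d_\infty(A,B):=\|\log(A^{-1/2}BA^{-1/2})\|$; it is complete and its topology is the relative operator norm topology. For $A,B\in\mathbb{P}$, $t\in[0,1]$, the weighted geometric mean is $A\#_tB:=A^{1/2}(A^{-1/2}BA^{-1/2})^tA^{1/2}$. For $X,A\in\mathbb{P}$, $\log_XA:=X^{1/2}\log(X^{-1/2}AX^{-1/2})X^{1/2}$. $\mathcal{P}^1(\mathbb{P})$ is the set of $\tau$-additive (equivalently, fully supported: $\mu(\mathrm{supp}(\mu))=1$) Borel probability measures $\mu$ on $(\mathbb{P},d_\infty)$ with $\int_{\mathbb{P}}d_\infty(X,A)\,d\mu(A)<\infty$ for all $X\in\mathbb{P}$. For $\mu\in\mathcal{P}^1(\mathbb{P})$, the Karcher mean $\Lambda(\mu)\in\mathbb{P}$ is the unique solution $X\in\mathbb{P}$ of the Karcher equation $\int_{\mathbb{P}}\log_XA\,d\mu(A)=0$ (Bochner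 integral); existence and uniqueness hold for every $\mu\in\mathcal{P}^1(\mathbb{P})$. *)

theory Defs
  imports "HOL-Probability.Probability" "HOL-Computational_Algebra.Polynomial"
begin

section \<open>Hilbert spaces over the reals or the complex numbers\<close>

text \<open>
  A Hilbert space over a scalar field \<open>K\<close>, which is the field of real or of complex numbers, both
  seen as subsets of \<open>complex\<close>. The carrier type is a complete real inner product space; its
  type-class inner product is the real part of the (possibly complex) inner product \<open>ip\<close>, so the
  norm and topology are the ones induced by \<open>ip\<close>. The map \<open>ip\<close> is linear in its first argument.
  For \<open>K = \<real>\<close> the values of \<open>scal\<close> at non-real arguments are irrelevant. No separability or
  dimension restriction is made.
\<close>

locale hilbert_space =
  fixes K :: "complex set"
    and scal :: "complex \<Rightarrow> 'h \<Rightarrow> 'h :: {real_inner, complete_space}"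
    and ip :: "'h \<Rightarrow> 'h \<Rightarrow> complex"
  assumes scalars: "K = \<real> \<or> K = UNIV"
    and scale_of_real: "scal (complex_of_real r) x = r *\<^sub>R x"
    and scale_add_right: "a \<in> K \<Longrightarrow> scal a (x + y) = scal a x + scal a y"
    and scale_add_left: "a \<in> K \<Longrightarrow> b \<in> K \<Longrightarrow> scal (a + b) x = scal a x + scal b x"
    and scale_scale: "a \<in> K \<Longrightarrow> b \<in> K \<Longrightarrow> scal a (scal b x) = scal (a * b) x"
    and ip_scalar: "ip x y \<in> K"
    and ip_add: "ip (x + y) z = ip x z + ip y z"
    and ip_scale: "a \<in> K \<Longrightarrow> ip (scal a x) y = a * ip x y"
    and ip_commute: "ip y x = cnj (ip x y)"
    and Re_ip: "Re (ip x y) = x \<bullet> y"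

section \<open>Bounded operators and the continuous functional calculus\<close>

definition op_invertible :: "('h::real_normed_vector \<Rightarrow>\<^sub>L 'h) \<Rightarrow> bool" where
  "op_invertible A \<longleftrightarrow> (\<exists>B. A o\<^sub>L B = id_blinfun \<and> B o\<^sub>L A = id_blinfun)"

text \<open>
  The cone of bounded \<open>K\<close>-linear self-adjoint positive definite invertible operators. For
  self-adjoint \<open>A\<close> the number \<open>ip (A x) x\<close> is real, so positivity is stated for its real part.
  The inverse of an invertible \<open>K\<close>-linear operator is automatically \<open>K\<close>-linear.
\<close>

definition pos_cone ::
  "complex set \<Rightarrow> (complex \<Rightarrow> 'h \<Rightarrow> 'h) \<Rightarrow> ('h \<Rightarrow> 'h \<Rightarrow> complex) \<Rightarrow> ('h::real_normed_vector \<Rightarrow>\<^sub>L 'h) set"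
where
  "pos_cone K scal ip = {A.
     (\<forall>a\<in>K. \<forall>x. blinfun_apply A (scal a x) = scal a (blinfun_apply A x)) \<and>
     (\<forall>x y. ip (blinfun_apply A x) y = ip x (blinfun_apply A y)) \<and>
     (\<forall>x. x \<noteq> 0 \<longrightarrow> 0 < Re (ip (blinfun_apply A x) x)) \<and>
     op_invertible A}"

text \<open>
  Only the real part of the spectrum is recorded; the functional calculus below is used for
  self-adjoint operators only, whose spectrum is real.
\<close>

definition op_spectrum :: "('h::real_normed_vector \<Rightarrow>\<^sub>L 'h) \<Rightarrow> real set" where
  "op_spectrum A = {r. \<not> op_invertible (A - r *\<^sub>R id_blinfun)}"

definition op_poly :: "real poly \<Rightarrow> ('h::real_normed_vector \<Rightarrow>\<^sub>L 'h) \<Rightarrow> ('h \<Rightarrow>\<^sub>L 'h)" where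
  "op_poly p A = (\<Sum>i\<le>degree p. coeff p i *\<^sub>R (((o\<^sub>L) A ^^ i) id_blinfun))"

text \<open>
  Continuous functional calculus for a self-adjoint operator: \<open>f(A)\<close> is the norm limit of
  \<open>p\<^sub>n(A)\<close> for any polynomials \<open>p\<^sub>n\<close> converging to \<open>f\<close> uniformly on the spectrum of \<open>A\<close>.
\<close>

definition cfc :: "(real \<Rightarrow> real) \<Rightarrow> ('h::real_normed_vector \<Rightarrow>\<^sub>L 'h) \<Rightarrow> ('h \<Rightarrow>\<^sub>L 'h)" where
  "cfc f A = (THE T. \<exists>p :: nat \<Rightarrow> real poly.
     uniform_limit (op_spectrum A) (\<lambda>n. poly (p n)) f sequentially \<and>
     (\<lambda>n. op_poly (p n) A) \<longlonglongrightarrow> T)"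

definition op_powr :: "('h::real_normed_vector \<Rightarrow>\<^sub>L 'h) \<Rightarrow> real \<Rightarrow> ('h \<Rightarrow>\<^sub>L 'h)" where
  "op_powr A t = cfc (\<lambda>x. x powr t) A"

definition op_log :: "('h::real_normed_vector \<Rightarrow>\<^sub>L 'h) \<Rightarrow> ('h \<Rightarrow>\<^sub>L 'h)" where
  "op_log A = cfc ln A"

section \<open>Thompson metric, geometric mean, logarithm at a point\<close>

definition thompson_dist ::
  "('h::real_normed_vector \<Rightarrow>\<^sub>L 'h) \<Rightarrow> ('h \<Rightarrow>\<^sub>L 'h) \<Rightarrow> real" where
  "thompson_dist A B = norm (op_log (op_powr A (-1/2) o\<^sub>L B o\<^sub>L op_powr A (-1/2)))"

definition geom_mean ::
  "('h::real_normed_vector \<Rightarrow>\<^sub>L 'h) \<Rightarrow> real \<Rightarrow> ('h \<Rightarrow>\<^sub>L 'h) \<Rightarrow> ('h \<Rightarrow>\<^sub>L 'h)" where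
  "geom_mean A t B =
     op_powr A (1/2) o\<^sub>L op_powr (op_powr A (-1/2) o\<^sub>L B o\<^sub>L op_powr A (-1/2)) t o\<^sub>L op_powr A (1/2)"

definition log_at ::
  "('h::real_normed_vector \<Rightarrow>\<^sub>L 'h) \<Rightarrow> ('h \<Rightarrow>\<^sub>L 'h) \<Rightarrow> ('h \<Rightarrow>\<^sub>L 'h)" where
  "log_at X A =
     op_powr X (1/2) o\<^sub>L op_log (op_powr X (-1/2) o\<^sub>L A o\<^sub>L op_powr X (-1/2)) o\<^sub>L op_powr X (1/2)"

text \<open>
  The locale \<open>Metric_space\<close> requires symmetry of the distance on the whole type, hence the
  (otherwise irrelevant) value \<open>0\<close> outside the carrier \<open>P\<close>.
\<close>

definition thompson_topology ::
  "('h::real_normed_vector \<Rightarrow>\<^sub>L 'h) set \<Rightarrow> ('h \<Rightarrow>\<^sub>L 'h) topology" where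
  "thompson_topology P =
     Metric_space.mtopology P (\<lambda>A B. if A \<in> P \<and> B \<in> P then thompson_dist A B else 0)"

section \<open>Integrable probability measures and the Karcher mean\<close>

definition tau_additive :: "'a topology \<Rightarrow> 'a measure \<Rightarrow> bool" where
  "tau_additive T \<mu> \<longleftrightarrow>
     (\<forall>\<U>. \<U> \<noteq> {} \<and> (\<forall>U\<in>\<U>. openin T U) \<and> (\<forall>U\<in>\<U>. \<forall>V\<in>\<U>. \<exists>W\<in>\<U>. U \<union> V \<subseteq> W) \<longrightarrow>
        emeasure \<mu> (\<Union>\<U>) = (SUP U\<in>\<U>. emeasure \<mu> U))"

definition prob_measures_L1 :: "('h::real_normed_vector \<Rightarrow>\<^sub>L 'h) set \<Rightarrow> ('h \<Rightarrow>\<^sub>L 'h) measure set" where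
  "prob_measures_L1 P = {\<mu>.
     prob_space \<mu> \<and>
     space \<mu> = P \<and>
     sets \<mu> = sigma_sets P {U. openin (thompson_topology P) U} \<and>
     tau_additive (thompson_topology P) \<mu> \<and>
     (\<forall>X\<in>P. (\<integral>\<^sup>+ A. ennreal (thompson_dist X A) \<partial>\<mu>) < \<infinity>)}"

text \<open>
  The library's \<open>has_bochner_integral\<close> is restricted to second countable target spaces, whereas the
  space of bounded operators is not separable in infinite dimension. The following is the same
  definition without that restriction. The approximation by simple functions makes \<open>f\<close> strongly
  measurable, that is, almost everywhere a limit of simple functions.
\<close>

definition has_bochner_integral_general ::
  "'a measure \<Rightarrow> ('a \<Rightarrow> 'b::real_normed_vector) \<Rightarrow> 'b \<Rightarrow> bool" where
  "has_bochner_integral_general M f x \<longleftrightarrow>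
     f \<in> borel_measurable M \<and>
     (\<exists>s. (\<forall>i. Bochner_Integration.simple_bochner_integrable M (s i)) \<and>
          ((\<lambda>i. \<integral>\<^sup>+ y. ennreal (norm (f y - s i y)) \<partial>M) \<longlonglongrightarrow> 0) \<and>
          ((\<lambda>i. Bochner_Integration.simple_bochner_integral M (s i)) \<longlonglongrightarrow> x))"

definition karcher_mean ::
  "('h::real_normed_vector \<Rightarrow>\<^sub>L 'h) set \<Rightarrow> ('h \<Rightarrow>\<^sub>L 'h) measure \<Rightarrow> ('h \<Rightarrow>\<^sub>L 'h)" where
  "karcher_mean P \<mu> = (THE X. X \<in> P \<and> has_bochner_integral_general \<mu> (log_at X) 0)"

end

theory Submission
  imports Defs "HOL-Computational_Algebra.Fundamental_Theorem_Algebra"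
begin

text \<open>
  In terms of the order of self-adjoint operators, the Thompson distance of \<open>A\<close> and \<open>B\<close> is at most \<open>r\<close>
  iff \<open>e\<^sup>-\<^sup>r A \<preceq> B \<preceq> e\<^sup>r A\<close> (\<open>thompson_le_iff\<close>). The weighted geometric mean is homogeneous, and it is
  monotone by the Loewner--Heinz inequality. Hence it is convex in the sense of Busemann: the distance of
  two means of weight \<open>t\<close> is at most \<open>(1 - t)\<close> times the distance of the first arguments plus \<open>t\<close>
  times that of the second arguments (\<open>geom_mean_contract\<close>). Moreover a short step from \<open>A\<close> towards
  \<open>B\<close> is a straight one to first order, \<open>geom_mean A t B = A + t log\<^sub>A B + o(t)\<close>, uniformly on bounded
  sets (\<open>geom_mean_first_order_seq\<close>).

  Let \<open>X\<close> solve the Karcher equation and let \<open>V\<^sub>n\<close> be the average of \<open>log\<^sub>X Y\<^sub>1, \<dots>, log\<^sub>X Y\<^sub>n\<close>. By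
  the strong law of large numbers for Bochner integrable functions, \<open>V\<^sub>n \<rightarrow> 0\<close> almost surely
  (\<open>bochner_averages_tendsto\<close>). By the first-order expansion, the sequence \<open>X + V\<^sub>n\<close> satisfies the
  recursion of \<open>S\<^sub>n\<close> up to errors that are small relative to the step size \<open>1/(n+1)\<close>, on average.
  The step contracts distances by the factor \<open>n/(n+1)\<close>, so that the distance of \<open>S\<^sub>n\<close> and \<open>X + V\<^sub>n\<close>
  is at most the average of the errors and tends to \<open>0\<close> (\<open>ind_mean_tendsto\<close>). Therefore
  \<open>S\<^sub>n \<rightarrow> X\<close> almost surely. As this holds for every solution, there is at most one.

  A solution exists for finitely supported measures, as a limit of approximate fixed points of the power
  mean maps, which are strict contractions (\<open>finite_karcher_exists\<close>). In general, \<open>\<tau>\<close>-additivity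
  provides functions \<open>f\<^sub>k\<close> with finitely many values that converge almost everywhere to the identity. Let
  \<open>X\<^sub>k\<close> be the Karcher mean of the law of \<open>f\<^sub>k(Y\<^sub>1)\<close>. It is the limit of the inductive means of the
  \<open>f\<^sub>k(Y\<^sub>i)\<close>, whose distance from \<open>S\<^sub>n\<close> is at most the average of the distances of \<open>f\<^sub>k(Y\<^sub>i)\<close> and
  \<open>Y\<^sub>i\<close>. So the \<open>X\<^sub>k\<close> form a Cauchy sequence, and by dominated convergence their limit is a solution
  (\<open>solution_exists\<close>).

  Two tools are developed on the way. The functional calculus for self-adjoint operators over the real
  scalars rests on the bound of \<open>\<parallel>p(A)\<parallel>\<close> by the supremum of \<open>\<bar>p\<bar>\<close> on the spectrum
  (\<open>norm_op_poly_le\<close>). For integrable nonnegative i.i.d. variables it suffices to know that the averages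
  are eventually at most twice the expectation (\<open>averages_bounded\<close>): every use concerns an approximation
  error whose expectation can be made small.
\<close>

section \<open>Bounded operators on a real Hilbert space\<close>

text \<open>A notation for the composition of operators that binds like a product, so that sums of compositions
  need no parentheses.\<close>

notation blinfun_compose (infixl "\<cdot>\<^sub>L" 70)

lemma oL_assoc: "(A \<cdot>\<^sub>L B) \<cdot>\<^sub>L C = A \<cdot>\<^sub>L (B \<cdot>\<^sub>L C)"
  by (rule blinfun_eqI) simp

lemma oL_id [simp]: "id_blinfun \<cdot>\<^sub>L A = A" "A \<cdot>\<^sub>L id_blinfun = A"
  by (rule blinfun_eqI, simp)+

lemmas oL_simps = bounded_bilinear.add_left[OF bounded_bilinear_blinfun_compose]
  bounded_bilinear.add_right[OF bounded_bilinear_blinfun_compose]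
  bounded_bilinear.diff_left[OF bounded_bilinear_blinfun_compose]
  bounded_bilinear.diff_right[OF bounded_bilinear_blinfun_compose]
  bounded_bilinear.minus_left[OF bounded_bilinear_blinfun_compose]
  bounded_bilinear.minus_right[OF bounded_bilinear_blinfun_compose]
  bounded_bilinear.scaleR_left[OF bounded_bilinear_blinfun_compose]
  bounded_bilinear.scaleR_right[OF bounded_bilinear_blinfun_compose]

lemmas ap_simps = blinfun.add_left blinfun.diff_left blinfun.scaleR_left blinfun.minus_left
  blinfun.add_right blinfun.diff_right blinfun.scaleR_right blinfun.minus_right

lemmas tendsto_oL = bounded_bilinear.tendsto[OF bounded_bilinear_blinfun_compose]

text \<open>Completeness of the operator norm: a Cauchy sequence converges pointwise, and the convergence is
  uniform on the unit ball.\<close>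

lemma Cauchy_blinfun_convergent:
  fixes X :: "nat \<Rightarrow> 'a::real_normed_vector \<Rightarrow>\<^sub>L 'b::{real_normed_vector,complete_space}"
  assumes "Cauchy X"
  shows "convergent X"
proof -
  have bd: "norm (X m x - X n x) \<le> norm (X m - X n) * norm x" for m n x
    using norm_blinfun[of "X m - X n" x] by (simp add: ap_simps)
  have "Cauchy (\<lambda>n. X n x)" for x
  proof (rule CauchyI)
    fix e :: real assume "0 < e"
    then have "e / (norm x + 1) > 0" by (simp add: add_nonneg_pos)
    from CauchyD[OF assms this] obtain M
      where M: "\<And>m n. m \<ge> M \<Longrightarrow> n \<ge> M \<Longrightarrow> norm (X m - X n) < e / (norm x + 1)" by auto
    have "norm (X m x - X n x) < e" if "m \<ge> M" "n \<ge> M" for m n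
    proof -
      have "norm (X m - X n) * (norm x + 1) < e"
        using M[OF that] pos_less_divide_eq[of "norm x + 1"] by (simp add: add_nonneg_pos)
      moreover have "norm (X m - X n) * norm x \<le> norm (X m - X n) * (norm x + 1)"
        by (simp add: mult_left_mono)
      ultimately show ?thesis using bd[of m x n] by linarith
    qed
    then show "\<exists>M. \<forall>m\<ge>M. \<forall>n\<ge>M. norm (X m x - X n x) < e" by blast
  qed
  then have "convergent (\<lambda>n. X n x)" for x
    by (rule Cauchy_convergent)
  then obtain v where v: "\<And>x. (\<lambda>n. X n x) \<longlonglongrightarrow> v x"
    unfolding convergent_def by metis
  have est: "\<exists>M. \<forall>n\<ge>M. \<forall>x. norm (X n x - v x) \<le> e * norm x" if "e > 0" for e
  proof -
    from CauchyD[OF assms that] obtain M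
      where M: "\<And>m n. m \<ge> M \<Longrightarrow> n \<ge> M \<Longrightarrow> norm (X m - X n) < e" by auto
    have "norm (X n x - v x) \<le> e * norm x" if "n \<ge> M" for n x
    proof (rule Lim_bounded)
      show "(\<lambda>m. norm (X n x - X m x)) \<longlonglongrightarrow> norm (X n x - v x)"
        by (intro tendsto_intros v)
      have "norm (X n x - X m x) \<le> e * norm x" if "m \<ge> M" for m
      proof -
        have "norm (X n - X m) * norm x \<le> e * norm x"
          using M[OF \<open>n \<ge> M\<close> that] by (simp add: mult_right_mono)
        then show ?thesis using bd[of n x m] by linarith
      qed
      then show "\<forall>m\<ge>M. norm (X n x - X m x) \<le> e * norm x" by blast
    qed
    then show ?thesis by blast
  qed
  have lin: "v (x + y) = v x + v y" "v (r *\<^sub>R x) = r *\<^sub>R v x" for x y r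
  proof -
    have "(\<lambda>n. X n (x + y)) \<longlonglongrightarrow> v x + v y"
      by (simp add: ap_simps) (intro tendsto_intros v)
    then show "v (x + y) = v x + v y" using v LIMSEQ_unique by blast
    have "(\<lambda>n. X n (r *\<^sub>R x)) \<longlonglongrightarrow> r *\<^sub>R v x"
      by (simp add: ap_simps) (intro tendsto_intros v)
    then show "v (r *\<^sub>R x) = r *\<^sub>R v x" using v LIMSEQ_unique by blast
  qed
  obtain M1 where M1: "\<And>x. norm (X M1 x - v x) \<le> 1 * norm x" using est[of 1] by auto
  have "bounded_linear v"
  proof (rule bounded_linear_intro[where K = "norm (X M1) + 1"])
    show "norm (v x) \<le> norm x * (norm (X M1) + 1)" for x
      using M1[of x] norm_blinfun[of "X M1" x] norm_triangle_ineq4[of "X M1 x" "X M1 x - v x"]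
      by (simp add: algebra_simps)
  qed (use lin in auto)
  then have V: "blinfun_apply (Blinfun v) x = v x" for x by (simp add: bounded_linear_Blinfun_apply)
  have "X \<longlonglongrightarrow> Blinfun v"
  proof (rule LIMSEQ_I)
    fix r :: real assume "r > 0"
    then obtain M where M: "\<forall>n\<ge>M. \<forall>x. norm (X n x - v x) \<le> r/2 * norm x"
      using est[of "r/2"] by auto
    have "norm (X n - Blinfun v) \<le> r/2" if "n \<ge> M" for n
      by (rule norm_blinfun_bound) (use M that \<open>r > 0\<close> in \<open>auto simp: ap_simps V\<close>)
    then show "\<exists>M. \<forall>n\<ge>M. norm (X n - Blinfun v) < r" using \<open>r > 0\<close>
      by (intro exI[of _ M]) (force intro: le_less_trans)
  qed
  then show ?thesis by (auto simp: convergent_def)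
qed

definition sadj :: "('h::real_inner \<Rightarrow>\<^sub>L 'h) \<Rightarrow> bool" where
  "sadj A \<longleftrightarrow> (\<forall>x y. A x \<bullet> y = x \<bullet> A y)"

definition op_le :: "('h::real_inner \<Rightarrow>\<^sub>L 'h) \<Rightarrow> ('h \<Rightarrow>\<^sub>L 'h) \<Rightarrow> bool" (infix "\<preceq>" 50) where
  "A \<preceq> B \<longleftrightarrow> (\<forall>x. A x \<bullet> x \<le> B x \<bullet> x)"

text \<open>Quadratic form bounds take the place of the spectrum. Unlike the spectrum, an interval
  \<open>[m, M]\<close> can be shared by many operators, which is what uniform estimates need.\<close>

definition spec_in :: "real \<Rightarrow> real \<Rightarrow> ('h::real_inner \<Rightarrow>\<^sub>L 'h) \<Rightarrow> bool" where
  "spec_in m M A \<longleftrightarrow> sadj A \<and> m *\<^sub>R id_blinfun \<preceq> A \<and> A \<preceq> M *\<^sub>R id_blinfun"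

lemma sadjD: "sadj A \<Longrightarrow> A x \<bullet> y = x \<bullet> A y"
  by (simp add: sadj_def)

lemma sadj_intros:
  "sadj id_blinfun" "sadj 0" "sadj A \<Longrightarrow> sadj B \<Longrightarrow> sadj (A + B)"
  "sadj A \<Longrightarrow> sadj B \<Longrightarrow> sadj (A - B)" "sadj A \<Longrightarrow> sadj (r *\<^sub>R A)"
  "sadj A \<Longrightarrow> sadj C \<Longrightarrow> sadj (C \<cdot>\<^sub>L A \<cdot>\<^sub>L C)"
  by (auto simp: sadj_def ap_simps inner_simps)

lemma sadj_commute: "sadj A \<Longrightarrow> sadj B \<Longrightarrow> A \<cdot>\<^sub>L B = B \<cdot>\<^sub>L A \<Longrightarrow> sadj (A \<cdot>\<^sub>L B)"
  unfolding sadj_def by (metis blinfun_apply_blinfun_compose)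

lemma op_le_refl [simp]: "A \<preceq> A" by (simp add: op_le_def)

lemma op_le_trans [trans]: "A \<preceq> B \<Longrightarrow> B \<preceq> C \<Longrightarrow> A \<preceq> C"
  unfolding op_le_def by (meson order_trans)

lemma op_le_add: "A \<preceq> B \<Longrightarrow> C \<preceq> D \<Longrightarrow> A + C \<preceq> B + D"
  unfolding op_le_def by (auto simp: ap_simps inner_simps add_mono)

lemma op_le_scaleR: "A \<preceq> B \<Longrightarrow> 0 \<le> r \<Longrightarrow> r *\<^sub>R A \<preceq> r *\<^sub>R B"
  unfolding op_le_def by (auto simp: ap_simps mult_left_mono)

lemma op_le_scalar: "r \<le> s \<Longrightarrow> r *\<^sub>R id_blinfun \<preceq> s *\<^sub>R id_blinfun"
  unfolding op_le_def by (auto simp: ap_simps mult_right_mono)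

lemma op_le_cong: "A \<preceq> B \<Longrightarrow> sadj C \<Longrightarrow> C \<cdot>\<^sub>L A \<cdot>\<^sub>L C \<preceq> C \<cdot>\<^sub>L B \<cdot>\<^sub>L C"
  unfolding op_le_def by (simp add: sadj_def)

lemma op_le_sum:
  assumes "\<And>i. i \<in> I \<Longrightarrow> A i \<preceq> B i"
  shows "(\<Sum>i\<in>I. A i) \<preceq> (\<Sum>i\<in>I. B i)"
  unfolding op_le_def using assms
  by (auto simp: blinfun.sum_left inner_sum_left op_le_def intro: sum_mono)

lemma op_le_lim:
  assumes "f \<longlonglongrightarrow> A" "g \<longlonglongrightarrow> B" "\<And>n. f n \<preceq> g n"
  shows "A \<preceq> B"
  unfolding op_le_def
proof
  fix x
  have "(\<lambda>n. f n x \<bullet> x) \<longlonglongrightarrow> A x \<bullet> x" "(\<lambda>n. g n x \<bullet> x) \<longlonglongrightarrow> B x \<bullet> x"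
    by (intro tendsto_intros assms)+
  then show "A x \<bullet> x \<le> B x \<bullet> x"
    by (rule LIMSEQ_le) (use assms(3) in \<open>auto simp: op_le_def\<close>)
qed

lemma sadj_lim:
  assumes "f \<longlonglongrightarrow> A" "\<And>n. sadj (f n)"
  shows "sadj A"
  unfolding sadj_def
proof (intro allI)
  fix x y
  have "(\<lambda>n. f n x \<bullet> y) \<longlonglongrightarrow> A x \<bullet> y" "(\<lambda>n. x \<bullet> f n y) \<longlonglongrightarrow> x \<bullet> A y"
    by (intro tendsto_intros assms)+
  moreover have "(\<lambda>n. f n x \<bullet> y) = (\<lambda>n. x \<bullet> f n y)" using assms(2) by (simp add: sadj_def)
  ultimately show "A x \<bullet> y = x \<bullet> A y" using LIMSEQ_unique by metis
qed

lemma norm_op_le: "A \<preceq> B + norm (A - B) *\<^sub>R id_blinfun"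
  unfolding op_le_def
proof
  fix x
  have "(A - B) x \<bullet> x \<le> norm ((A - B) x) * norm x" by (rule norm_cauchy_schwarz)
  also have "\<dots> \<le> norm (A - B) * norm x * norm x"
    by (intro mult_right_mono norm_blinfun) auto
  finally show "A x \<bullet> x \<le> (B + norm (A - B) *\<^sub>R id_blinfun) x \<bullet> x"
    by (simp add: ap_simps inner_simps power2_norm_eq_inner[symmetric] power2_eq_square)
qed

lemma op_le_norm: "A \<preceq> norm A *\<^sub>R id_blinfun"
  using norm_op_le[of A 0] by simp

lemma op_invertible_compose:
  assumes "op_invertible A" "op_invertible B"
  shows "op_invertible (A \<cdot>\<^sub>L B)"
proof -
  obtain A' B' where h: "A \<cdot>\<^sub>L A' = id_blinfun" "A' \<cdot>\<^sub>L A = id_blinfun"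
    "B \<cdot>\<^sub>L B' = id_blinfun" "B' \<cdot>\<^sub>L B = id_blinfun"
    using assms unfolding op_invertible_def by blast
  have "(A \<cdot>\<^sub>L B) \<cdot>\<^sub>L (B' \<cdot>\<^sub>L A') = A \<cdot>\<^sub>L (B \<cdot>\<^sub>L B') \<cdot>\<^sub>L A'" "(B' \<cdot>\<^sub>L A') \<cdot>\<^sub>L (A \<cdot>\<^sub>L B) = B' \<cdot>\<^sub>L (A' \<cdot>\<^sub>L A) \<cdot>\<^sub>L B"
    by (simp_all add: oL_assoc)
  then show ?thesis unfolding op_invertible_def using h by (metis oL_id)
qed

lemma op_invertible_scaleR:
  assumes "op_invertible A" "r \<noteq> 0"
  shows "op_invertible (r *\<^sub>R A)"
proof -
  obtain A' where "A \<cdot>\<^sub>L A' = id_blinfun" "A' \<cdot>\<^sub>L A = id_blinfun"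
    using assms unfolding op_invertible_def by blast
  then show ?thesis unfolding op_invertible_def using assms(2)
    by (intro exI[of _ "inverse r *\<^sub>R A'"]) (simp add: oL_simps)
qed

lemma op_invertible_bounded_below:
  assumes "op_invertible A"
  obtains c where "c > 0" "\<And>x. norm x \<le> c * norm (A x)"
proof -
  obtain B where B: "B \<cdot>\<^sub>L A = id_blinfun"
    using assms unfolding op_invertible_def by blast
  have "norm x \<le> (norm B + 1) * norm (A x)" for x
  proof -
    have "x = B (A x)" using B by (metis blinfun_apply_blinfun_compose blinfun_apply_id_blinfun)
    then have "norm x \<le> norm B * norm (A x)" using norm_blinfun[of B "A x"] by simp
    then show ?thesis using norm_ge_zero[of "A x"] by (simp only: distrib_right mult_1_left)
  qed
  then show ?thesis using that[of "norm B + 1"] by (simp add: add_nonneg_pos)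
qed

text \<open>A coercive operator is invertible: for small \<open>c\<close> the map \<open>x \<mapsto> x - c (A x - y)\<close> is a
  contraction, and its fixed point solves \<open>A x = y\<close>.\<close>

lemma op_invertible_coercive:
  fixes A :: "'h::{real_inner,complete_space} \<Rightarrow>\<^sub>L 'h"
  assumes "m > 0" "\<And>x. m * (norm x)\<^sup>2 \<le> A x \<bullet> x"
  shows "op_invertible A"
proof -
  define N where "N = max (norm A) m"
  have N: "N > 0" "norm A \<le> N" "m \<le> N" using assms(1) by (auto simp: N_def)
  \<comment> \<open>This \<open>c\<close> minimises \<open>1 - 2 c m + c\<^sup>2 N\<^sup>2\<close>.\<close>
  define c where "c = m / N\<^sup>2"
  have c: "c > 0" using N assms(1) by (simp add: c_def)
  define q where "q = sqrt (1 - m\<^sup>2 / N\<^sup>2)"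
  have "m\<^sup>2 \<le> N\<^sup>2" by (rule power_mono) (use N assms(1) in auto)
  then have mN: "m\<^sup>2 / N\<^sup>2 \<le> 1" "m\<^sup>2 / N\<^sup>2 > 0" using N(1) assms(1) by simp_all
  have q: "0 \<le> q" "q < 1" using mN by (auto simp: q_def)
  have contr: "norm (x - c *\<^sub>R A x) \<le> q * norm x" for x
  proof -
    have "(norm (x - c *\<^sub>R A x))\<^sup>2 = (norm x)\<^sup>2 - 2 * c * (A x \<bullet> x) + c\<^sup>2 * (norm (A x))\<^sup>2"
      using inner_commute[of x "A x"]
      by (simp only: power2_norm_eq_inner inner_simps) (simp add: algebra_simps power2_eq_square)
    also have "\<dots> \<le> (norm x)\<^sup>2 - 2 * c * (m * (norm x)\<^sup>2) + c\<^sup>2 * (N * norm x)\<^sup>2"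
    proof -
      have "norm (A x) \<le> N * norm x"
        using norm_blinfun[of A x] mult_right_mono[OF N(2) norm_ge_zero[of x]] by linarith
      then have "(norm (A x))\<^sup>2 \<le> (N * norm x)\<^sup>2" by (intro power_mono) auto
      then have "c\<^sup>2 * (norm (A x))\<^sup>2 \<le> c\<^sup>2 * (N * norm x)\<^sup>2" by (intro mult_left_mono) auto
      moreover have "2 * c * (m * (norm x)\<^sup>2) \<le> 2 * c * (A x \<bullet> x)"
        using assms(2)[of x] c by (intro mult_left_mono) auto
      ultimately show ?thesis by linarith
    qed
    also have "\<dots> = (1 - m\<^sup>2 / N\<^sup>2) * (norm x)\<^sup>2"
    proof -
      have "2 * c * m = 2 * (m\<^sup>2 / N\<^sup>2)" "c\<^sup>2 * N\<^sup>2 = m\<^sup>2 / N\<^sup>2"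
        using N(1) by (simp_all add: c_def power2_eq_square)
      then have "2 * c * (m * (norm x)\<^sup>2) = 2 * (m\<^sup>2 / N\<^sup>2) * (norm x)\<^sup>2"
        "c\<^sup>2 * (N * norm x)\<^sup>2 = m\<^sup>2 / N\<^sup>2 * (norm x)\<^sup>2"
        by (simp_all add: power_mult_distrib flip: mult.assoc)
      then show ?thesis by (simp add: algebra_simps)
    qed
    also have "\<dots> = (q * norm x)\<^sup>2" using mN by (simp add: q_def power_mult_distrib)
    finally show ?thesis by (rule power2_le_imp_le) (use q in simp)
  qed
  have ex: "\<exists>!x. A x = y" for y
  proof -
    have "\<exists>!x. x \<in> UNIV \<and> x - c *\<^sub>R (A x - y) = x"
    proof (rule Banach_fix[where c = q])
      show "dist (x - c *\<^sub>R (A x - y)) (z - c *\<^sub>R (A z - y)) \<le> q * dist x z" for x z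
      proof -
        have "x - c *\<^sub>R (A x - y) - (z - c *\<^sub>R (A z - y)) = (x - z) - c *\<^sub>R A (x - z)"
          by (simp add: ap_simps scaleR_diff_right)
        then show ?thesis using contr[of "x - z"] unfolding dist_norm by (simp only:)
      qed
    qed (use q in \<open>auto simp: complete_UNIV\<close>)
    moreover have "x \<in> UNIV \<and> x - c *\<^sub>R (A x - y) = x \<longleftrightarrow> A x = y" for x using c by simp
    ultimately show ?thesis by simp
  qed
  define g where "g y = (THE x. A x = y)" for y
  have g: "A (g y) = y" for y unfolding g_def by (rule theI'[OF ex])
  have g': "g (A x) = x" for x using ex[of "A x"] g[of "A x"] by blast
  have "bounded_linear g"
  proof (rule bounded_linear_intro[where K = "1 / m"])
    show "g (x + y) = g x + g y" for x y using g' [of "g x + g y"] by (simp add: ap_simps g)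
    show "g (r *\<^sub>R x) = r *\<^sub>R g x" for r x using g'[of "r *\<^sub>R g x"] by (simp add: ap_simps g)
    show "norm (g y) \<le> norm y * (1 / m)" for y
    proof -
      have "m * (norm (g y))\<^sup>2 \<le> y \<bullet> g y" using assms(2)[of "g y"] g by simp
      also have "\<dots> \<le> norm y * norm (g y)" by (rule norm_cauchy_schwarz)
      finally have "norm (g y) * (m * norm (g y)) \<le> norm (g y) * norm y"
        by (simp add: power2_eq_square algebra_simps)
      then have "norm (g y) = 0 \<or> m * norm (g y) \<le> norm y"
        by (metis mult_le_cancel_left_pos norm_ge_zero order_le_less)
      then have "m * norm (g y) \<le> norm y" by auto
      then show ?thesis using assms(1) by (simp add: pos_le_divide_eq mult.commute)
    qed
  qed
  then have "blinfun_apply (Blinfun g) = g" by (simp add: bounded_linear_Blinfun_apply)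
  then have "A \<cdot>\<^sub>L Blinfun g = id_blinfun" "Blinfun g \<cdot>\<^sub>L A = id_blinfun"
    by (auto intro!: blinfun_eqI simp: g g')
  then show ?thesis unfolding op_invertible_def by blast
qed

text \<open>The Cauchy--Schwarz inequality for the form \<open>(x, y) \<mapsto> A x \<bullet> y\<close> gives
  \<open>\<parallel>A x\<parallel>\<^sup>2 \<le> \<parallel>A\<parallel> (A x \<bullet> x)\<close>, and an invertible operator is bounded below.\<close>

lemma coercive_of_invertible:
  fixes A :: "'h::real_inner \<Rightarrow>\<^sub>L 'h"
  assumes "sadj A" and pos: "\<And>x. 0 \<le> A x \<bullet> x" and "op_invertible A"
  shows "\<exists>m>0. \<forall>x. m * (norm x)\<^sup>2 \<le> A x \<bullet> x"
proof -
  obtain c where c: "c > 0" "\<And>x. norm x \<le> c * norm (A x)"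
    using op_invertible_bounded_below[OF assms(3)] by blast
  have key: "(norm (A x))\<^sup>2 \<le> (norm A + 1) * (A x \<bullet> x)" for x
  proof -
    \<comment> \<open>The form is evaluated at \<open>x - s A x\<close>; a step near \<open>1 / \<parallel>A\<parallel>\<close> is optimal.\<close>
    define s where "s = 1 / (norm A + 1)"
    have s: "s > 0" "s * (norm A + 1) = 1"
      using norm_ge_zero[of A] by (auto simp: s_def add_nonneg_pos simp del: norm_ge_zero)
    define y where "y = A x"
    have "0 \<le> A (x - s *\<^sub>R y) \<bullet> (x - s *\<^sub>R y)" by (rule pos)
    also have "\<dots> = A x \<bullet> x - 2 * s * (norm y)\<^sup>2 + s\<^sup>2 * (A y \<bullet> y)"
    proof -
      have "A y \<bullet> x = y \<bullet> y" using sadjD[OF assms(1), of y x] by (simp add: y_def)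
      then show ?thesis
        by (simp only: power2_norm_eq_inner ap_simps inner_simps y_def[symmetric])
          (simp add: power2_eq_square algebra_simps)
    qed
    also have "s\<^sup>2 * (A y \<bullet> y) \<le> s * (norm y)\<^sup>2"
    proof -
      have "A y \<bullet> y \<le> norm (A y) * norm y" by (rule norm_cauchy_schwarz)
      also have "\<dots> \<le> norm A * norm y * norm y" by (intro mult_right_mono norm_blinfun) auto
      also have "\<dots> \<le> (norm A + 1) * (norm y)\<^sup>2" by (simp add: power2_eq_square algebra_simps)
      finally have "s\<^sup>2 * (A y \<bullet> y) \<le> s\<^sup>2 * ((norm A + 1) * (norm y)\<^sup>2)"
        by (intro mult_left_mono) auto
      also have "\<dots> = s * (s * (norm A + 1)) * (norm y)\<^sup>2" by (simp add: power2_eq_square)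
      finally show ?thesis using s by simp
    qed
    finally have "s * (norm y)\<^sup>2 \<le> A x \<bullet> x" by simp
    then have "(norm A + 1) * (s * (norm y)\<^sup>2) \<le> (norm A + 1) * (A x \<bullet> x)"
      by (intro mult_left_mono) (auto simp: add_nonneg_nonneg)
    moreover have "(norm A + 1) * (s * (norm y)\<^sup>2) = (s * (norm A + 1)) * (norm y)\<^sup>2"
      by (simp only: mult_ac)
    ultimately have "(s * (norm A + 1)) * (norm y)\<^sup>2 \<le> (norm A + 1) * (A x \<bullet> x)" by (simp only:)
    then show ?thesis by (simp only: s(2) mult_1_left y_def)
  qed
  define m where "m = 1 / (c\<^sup>2 * (norm A + 1))"
  have "norm A + 1 > 0" by (simp add: add_nonneg_pos)
  then have m: "m > 0" using c(1) by (simp add: m_def)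
  have "m * (norm x)\<^sup>2 \<le> A x \<bullet> x" for x
  proof -
    have "(norm x)\<^sup>2 \<le> (c * norm (A x))\<^sup>2" using c by (intro power_mono) auto
    also have "\<dots> = c\<^sup>2 * (norm (A x))\<^sup>2" by (simp add: power_mult_distrib)
    also have "\<dots> \<le> c\<^sup>2 * ((norm A + 1) * (A x \<bullet> x))" by (intro mult_left_mono key) auto
    finally have "m * (norm x)\<^sup>2 \<le> m * (c\<^sup>2 * ((norm A + 1) * (A x \<bullet> x)))"
      using m by (intro mult_left_mono) auto
    also have "\<dots> = A x \<bullet> x" using c(1) \<open>norm A + 1 > 0\<close> by (simp add: m_def)
    finally show ?thesis .
  qed
  then show ?thesis using m by blast
qed

section \<open>Polynomials of a self-adjoint operator\<close>

lemma op_poly_altdef: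
  assumes "degree p \<le> n"
  shows "op_poly p A = (\<Sum>i\<le>n. coeff p i *\<^sub>R (((o\<^sub>L) A ^^ i) id_blinfun))"
  unfolding op_poly_def using assms
  by (intro sum.mono_neutral_left) (auto simp: coeff_eq_0)

lemma op_poly_0 [simp]: "op_poly 0 A = 0" by (simp add: op_poly_def)

lemma op_poly_pCons [simp]: "op_poly (pCons c p) A = c *\<^sub>R id_blinfun + A \<cdot>\<^sub>L op_poly p A"
proof -
  have "op_poly (pCons c p) A = (\<Sum>i\<le>Suc (degree p). coeff (pCons c p) i *\<^sub>R (((o\<^sub>L) A ^^ i) id_blinfun))"
    by (intro op_poly_altdef degree_pCons_le)
  also have "\<dots> = c *\<^sub>R id_blinfun + (\<Sum>i\<le>degree p. coeff p i *\<^sub>R (A \<cdot>\<^sub>L ((o\<^sub>L) A ^^ i) id_blinfun))"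
    by (subst sum.atMost_Suc_shift) simp
  also have "(\<Sum>i\<le>degree p. coeff p i *\<^sub>R (A \<cdot>\<^sub>L ((o\<^sub>L) A ^^ i) id_blinfun)) = A \<cdot>\<^sub>L op_poly p A"
    by (simp add: op_poly_def bounded_bilinear.sum_right[OF bounded_bilinear_blinfun_compose] oL_simps)
  finally show ?thesis .
qed

lemma op_poly_add: "op_poly (p + q) A = op_poly p A + op_poly q A"
  by (induction p q rule: poly_induct2) (auto simp: oL_simps scaleR_left_distrib)

lemma op_poly_smult: "op_poly (smult c p) A = c *\<^sub>R op_poly p A"
  by (induction p) (auto simp: oL_simps scaleR_right_distrib)

lemma op_poly_diff: "op_poly (p - q) A = op_poly p A - op_poly q A"
  using op_poly_add[of p "smult (-1) q" A] op_poly_smult[of "-1" q A] by simp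

lemma op_poly_mult: "op_poly (p * q) A = op_poly p A \<cdot>\<^sub>L op_poly q A"
  by (induction p) (auto simp: op_poly_add op_poly_smult oL_simps oL_assoc)

lemma op_poly_intertwine:
  assumes "C \<cdot>\<^sub>L A = B \<cdot>\<^sub>L C"
  shows "C \<cdot>\<^sub>L op_poly p A = op_poly p B \<cdot>\<^sub>L C"
proof (induction p)
  case (pCons c p)
  have "C \<cdot>\<^sub>L (A \<cdot>\<^sub>L op_poly p A) = B \<cdot>\<^sub>L (C \<cdot>\<^sub>L op_poly p A)" using assms by (metis oL_assoc)
  also have "\<dots> = B \<cdot>\<^sub>L op_poly p B \<cdot>\<^sub>L C" by (simp add: pCons oL_assoc)
  finally show ?case by (simp add: oL_simps)
qed simp

lemma sadj_op_poly: "sadj A \<Longrightarrow> sadj (op_poly p A)"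
proof (induction p)
  case (pCons c p)
  have "A \<cdot>\<^sub>L op_poly p A = op_poly p A \<cdot>\<^sub>L A" by (rule op_poly_intertwine) simp
  then show ?case using pCons by (auto intro!: sadj_intros sadj_commute)
qed (auto simp: sadj_intros)

text \<open>The norm of a self-adjoint operator is, up to sign, in its spectrum: almost maximising unit
  vectors for \<open>\<parallel>B x\<parallel>\<close> are almost in the kernel of \<open>B\<^sup>2 - \<parallel>B\<parallel>\<^sup>2\<close>.\<close>

lemma norm_in_spectrum:
  fixes B :: "'h::real_inner \<Rightarrow>\<^sub>L 'h"
  assumes "sadj B" "B \<noteq> 0"
  shows "norm B \<in> op_spectrum B \<or> - norm B \<in> op_spectrum B"
proof (rule ccontr)
  assume neg: "\<not> ?thesis"
  define b where "b = norm B"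
  have b: "b > 0" using assms by (simp add: b_def)
  define D where "D = (B - b *\<^sub>R id_blinfun) \<cdot>\<^sub>L (B - (-b) *\<^sub>R id_blinfun)"
  have "op_invertible D" unfolding D_def
    by (rule op_invertible_compose) (use neg in \<open>auto simp: op_spectrum_def b_def\<close>)
  then obtain c where c: "c > 0" "\<And>x. norm x \<le> c * norm (D x)"
    using op_invertible_bounded_below by blast
  have D: "D x = B (B x) - b\<^sup>2 *\<^sub>R x" for x
    by (simp add: D_def ap_simps power2_eq_square algebra_simps)
  have est: "(norm (D x))\<^sup>2 \<le> b^4 * (norm x)\<^sup>2 - b\<^sup>2 * (norm (B x))\<^sup>2" for x
  proof -
    have "B (B x) \<bullet> x = B x \<bullet> B x" using sadjD[OF assms(1), of "B x" x] by simp
    then have "(norm (D x))\<^sup>2 = (norm (B (B x)))\<^sup>2 - 2 * b\<^sup>2 * (norm (B x))\<^sup>2 + b^4 * (norm x)\<^sup>2"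
      using inner_commute[of x "B (B x)"]
      by (simp only: D power2_norm_eq_inner inner_simps) (simp add: power2_eq_square power4_eq_xxxx algebra_simps)
    moreover have "(norm (B (B x)))\<^sup>2 \<le> (b * norm (B x))\<^sup>2"
      by (intro power_mono) (auto simp: b_def norm_blinfun)
    ultimately show ?thesis by (simp add: power_mult_distrib algebra_simps)
  qed
  \<comment> \<open>Invertibility of \<open>D\<close> improves the bound \<open>\<parallel>B x\<parallel> \<le> b \<parallel>x\<parallel>\<close> by a factor \<open>< 1\<close>.\<close>
  define k where "k = b\<^sup>2 - 1 / (c\<^sup>2 * b\<^sup>2)"
  have bx: "(norm (B x))\<^sup>2 \<le> k * (norm x)\<^sup>2" for x
  proof -
    have "(norm x)\<^sup>2 \<le> (c * norm (D x))\<^sup>2" using c by (intro power_mono) auto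
    also have "\<dots> = c\<^sup>2 * (norm (D x))\<^sup>2" by (simp add: power_mult_distrib)
    also have "\<dots> \<le> c\<^sup>2 * (b^4 * (norm x)\<^sup>2 - b\<^sup>2 * (norm (B x))\<^sup>2)"
      by (intro mult_left_mono est) auto
    finally have "(c\<^sup>2 * b\<^sup>2) * (norm (B x))\<^sup>2 \<le> (c\<^sup>2 * b\<^sup>2) * (k * (norm x)\<^sup>2)"
      using b c(1) by (simp add: k_def algebra_simps power4_eq_xxxx power2_eq_square)
    then show ?thesis using b c(1) by (simp add: mult_le_cancel_left_pos)
  qed
  have "k < b\<^sup>2" using b c(1) by (simp add: k_def)
  have "norm B \<le> sqrt \<bar>k\<bar>"
  proof (rule norm_blinfun_bound)
    fix x
    have "(norm (B x))\<^sup>2 \<le> (sqrt \<bar>k\<bar> * norm x)\<^sup>2"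
      using bx[of x] mult_right_mono[OF abs_ge_self[of k], of "(norm x)\<^sup>2"]
      by (simp add: power_mult_distrib)
    then show "norm (B x) \<le> sqrt \<bar>k\<bar> * norm x" by (rule power2_le_imp_le) simp
  qed simp
  then have "b\<^sup>2 \<le> \<bar>k\<bar>" using power_mono[of "norm B" "sqrt \<bar>k\<bar>" 2] by (simp add: b_def)
  with \<open>k < b\<^sup>2\<close> have "k < 0" by linarith
  then have "(norm (B x))\<^sup>2 \<le> 0" for x
    using bx[of x] mult_nonpos_nonneg[of k "(norm x)\<^sup>2"] zero_le_power2[of "norm x"] by linarith
  then have "norm (B x) = 0" for x by (metis power2_less_eq_zero_iff)
  then have "B x = 0" for x by simp
  then have "B = 0" by (intro blinfun_eqI) simp
  then show False using assms by simp
qed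

lemma poly_map_of_real_add:
  "poly (map_poly complex_of_real (p + q)) z = poly (map_poly complex_of_real p) z + poly (map_poly complex_of_real q) z"
  by (induction p q rule: poly_induct2) (auto simp: map_poly_pCons algebra_simps)

lemma poly_map_of_real_smult:
  "poly (map_poly complex_of_real (smult c p)) z = complex_of_real c * poly (map_poly complex_of_real p) z"
  by (induction p) (auto simp: map_poly_pCons algebra_simps)

lemma poly_map_of_real_mult:
  "poly (map_poly complex_of_real (p * q)) z = poly (map_poly complex_of_real p) z * poly (map_poly complex_of_real q) z"
  by (induction p) (auto simp: map_poly_pCons poly_map_of_real_add poly_map_of_real_smult algebra_simps)

text \<open>Every spectral value of \<open>q(A)\<close> is a value of \<open>q\<close> on the spectrum of \<open>A\<close>, by
  splitting off real linear and quadratic factors: the quadratic \<open>(A - a)\<^sup>2 + b\<^sup>2\<close> with \<open>b \<noteq> 0\<close> is coercive.\<close>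

lemma op_poly_invertible:
  fixes A :: "'h::{real_inner,complete_space} \<Rightarrow>\<^sub>L 'h"
  assumes "sadj A" "q \<noteq> 0" "\<And>s. s \<in> op_spectrum A \<Longrightarrow> poly q s \<noteq> 0"
  shows "op_invertible (op_poly q A)"
  using assms(2,3)
proof (induction "degree q" arbitrary: q rule: less_induct)
  case less
  show ?case
  proof (cases "degree q = 0")
    case True
    then obtain c where q: "q = [:c:]" by (metis degree_eq_zeroE)
    have "op_invertible id_blinfun" unfolding op_invertible_def
      by (intro exI[of _ id_blinfun]) simp
    then show ?thesis using less(2) op_invertible_scaleR[of id_blinfun c] by (simp add: q)
  next
    case False
    define Q where "Q = map_poly complex_of_real q"
    have "degree Q = degree q" by (simp add: Q_def degree_map_poly)
    then have "\<not> constant (poly Q)" using False by (simp add: constant_degree)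
    then obtain z where z: "poly Q z = 0" using fundamental_theorem_of_algebra by blast
    have Qr: "poly (map_poly complex_of_real p) (complex_of_real r) = complex_of_real (poly p r)" for p r
      by (induction p) (auto simp: map_poly_pCons)
    have step: ?thesis if d: "d dvd q" "degree d > 0" "op_invertible (op_poly d A)" for d
    proof -
      obtain p where p: "q = d * p" using d by blast
      then have "p \<noteq> 0" "d \<noteq> 0" using less(2) by auto
      then have "degree p < degree q" using d(2) by (simp add: p degree_mult_eq)
      moreover have "poly p s \<noteq> 0" if "s \<in> op_spectrum A" for s using less(3)[OF that] by (simp add: p)
      ultimately have "op_invertible (op_poly p A)" using less(1) \<open>p \<noteq> 0\<close> by blast
      then show ?thesis using d by (simp add: p op_poly_mult op_invertible_compose)
    qed
    show ?thesis
    proof (cases "Im z = 0")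
      case True
      then have zr: "z = complex_of_real (Re z)" by (simp add: complex_eq_iff)
      then have "poly q (Re z) = 0" using z Qr[of q "Re z"] by (simp add: Q_def)
      then have "[:- Re z, 1:] dvd q" "Re z \<notin> op_spectrum A"
        using less(3) by (auto simp: poly_eq_0_iff_dvd)
      moreover from this(2) have "op_invertible (op_poly [:- Re z, 1:] A)"
        by (simp add: op_spectrum_def)
      ultimately show ?thesis by (intro step[of "[:- Re z, 1:]"]) auto
    next
      case False
      define a where "a = Re z"
      define b where "b = Im z"
      define d where "d = [:a\<^sup>2 + b\<^sup>2, - 2 * a, 1:]"
      have degd: "degree d = 2" by (simp add: d_def)
      define r where "r = q mod d"
      have "d \<noteq> 0" by (simp add: d_def)
      then have "degree r < 2 \<or> r = 0" using degree_mod_less[of d q] degd by (auto simp: r_def)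
      then have "degree r \<le> 1" by auto
      then have "coeff r n = 0" if "n > 1" for n using that by (simp add: coeff_eq_0)
      then have r: "r = [:coeff r 0, coeff r 1:]"
        by (intro poly_eqI) (auto simp: coeff_pCons split: nat.split)
      define r0 where "r0 = coeff r 0"
      define r1 where "r1 = coeff r 1"
      note r = r[folded r0_def r1_def]
      have "q = d * (q div d) + r" by (simp add: r_def)
      then have "poly Q z = poly (map_poly complex_of_real d) z * poly (map_poly complex_of_real (q div d)) z
          + poly (map_poly complex_of_real r) z"
        unfolding Q_def by (metis poly_map_of_real_add poly_map_of_real_mult)
      moreover have "poly (map_poly complex_of_real d) z = 0"
        by (simp add: d_def map_poly_pCons a_def b_def complex_eq_iff power2_eq_square algebra_simps)
      ultimately have "poly (map_poly complex_of_real r) z = 0" using z by simp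
      then have "r1 * b = 0" "r0 + r1 * a = 0"
        by (subst (asm) r, simp add: map_poly_pCons a_def b_def complex_eq_iff algebra_simps)+
      then have "r = 0" using False r by (simp add: b_def)
      then have "d dvd q" by (simp add: r_def mod_eq_0_iff_dvd)
      moreover have "op_invertible (op_poly d A)"
      proof (rule op_invertible_coercive[where m = "b\<^sup>2"])
        show "b\<^sup>2 > 0" using False by (simp add: b_def)
        fix x
        define w where "w = A x - a *\<^sub>R x"
        have "op_poly d A x \<bullet> x = w \<bullet> w + b\<^sup>2 * (x \<bullet> x)"
          using sadjD[OF assms(1), of "A x" x]
          by (simp add: d_def w_def ap_simps inner_simps inner_commute power2_eq_square algebra_simps)
        then show "b\<^sup>2 * (norm x)\<^sup>2 \<le> op_poly d A x \<bullet> x" by (simp add: power2_norm_eq_inner)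
      qed
      ultimately show ?thesis using step[of d] degd by simp
    qed
  qed
qed

text \<open>The operator \<open>p(A)\<close> is self-adjoint, so \<open>\<parallel>p(A)\<parallel>\<close> or \<open>-\<parallel>p(A)\<parallel>\<close> lies in its
  spectrum, and by the previous lemma the spectrum consists of values of \<open>p\<close> on the spectrum of \<open>A\<close>.\<close>

lemma norm_op_poly_le:
  fixes A :: "'h::{real_inner,complete_space} \<Rightarrow>\<^sub>L 'h"
  assumes "sadj A" "c \<ge> 0" "\<And>s. s \<in> op_spectrum A \<Longrightarrow> \<bar>poly p s\<bar> \<le> c"
  shows "norm (op_poly p A) \<le> c"
proof (rule ccontr)
  assume "\<not> ?thesis"
  then have b: "norm (op_poly p A) > c" by simp
  then have "op_poly p A \<noteq> 0" using assms(2) by auto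
  then obtain r where r: "r \<in> op_spectrum (op_poly p A)" "\<bar>r\<bar> = norm (op_poly p A)"
    using norm_in_spectrum[OF sadj_op_poly[OF assms(1)]] by force
  have "poly (p - [:r:]) s \<noteq> 0" if "s \<in> op_spectrum A" for s using assms(3)[OF that] r b by auto
  \<comment> \<open>If \<open>p\<close> were the constant \<open>r\<close>, the spectrum would be empty, which happens only on the zero space.\<close>
  moreover have "p - [:r:] \<noteq> 0"
  proof
    assume "p - [:r:] = 0"
    then have p: "p = [:r:]" by simp
    then have "op_spectrum A = {}" using calculation by (intro equals0I) simp
    have "id_blinfun \<noteq> (0 :: 'h \<Rightarrow>\<^sub>L 'h)" using b p assms(2) by auto
    then have "A \<noteq> 0 \<Longrightarrow> False" using norm_in_spectrum[OF assms(1)] \<open>op_spectrum A = {}\<close> by auto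
    then have "A = 0" by blast
    moreover have "op_invertible (A - 0 *\<^sub>R id_blinfun)"
      using \<open>op_spectrum A = {}\<close> unfolding op_spectrum_def by blast
    ultimately have "op_invertible (0 :: 'h \<Rightarrow>\<^sub>L 'h)" by simp
    then show False using \<open>id_blinfun \<noteq> 0\<close> by (auto simp: op_invertible_def)
  qed
  ultimately have "op_invertible (op_poly (p - [:r:]) A)" using op_poly_invertible[OF assms(1)] by blast
  then show False using r(1) by (simp add: op_spectrum_def op_poly_diff)
qed

section \<open>The continuous functional calculus\<close>

lemma spec_in_sadj: "spec_in m M A \<Longrightarrow> sadj A" by (simp add: spec_in_def)

lemma op_spectrum_subset:
  fixes A :: "'h::{real_inner,complete_space} \<Rightarrow>\<^sub>L 'h"
  assumes "spec_in m M A"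
  shows "op_spectrum A \<subseteq> {m..M}"
proof
  fix r assume r: "r \<in> op_spectrum A"
  have A: "m * (norm x)\<^sup>2 \<le> A x \<bullet> x" "A x \<bullet> x \<le> M * (norm x)\<^sup>2" for x
    using assms by (auto simp: spec_in_def op_le_def ap_simps power2_norm_eq_inner)
  show "r \<in> {m..M}"
  proof (rule ccontr)
    assume "r \<notin> {m..M}"
    then consider "r < m" | "r > M" by force
    then have "op_invertible (A - r *\<^sub>R id_blinfun)"
    proof cases
      case 1
      then show ?thesis
        by (intro op_invertible_coercive[of "m - r"])
          (use A(1) in \<open>auto simp: ap_simps inner_simps power2_norm_eq_inner algebra_simps\<close>)
    next
      case 2
      then have "op_invertible (r *\<^sub>R id_blinfun - A)"
        by (intro op_invertible_coercive[of "r - M"])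
          (use A(2) in \<open>auto simp: ap_simps inner_simps power2_norm_eq_inner algebra_simps\<close>)
      from op_invertible_scaleR[OF this, of "-1"] show ?thesis by simp
    qed
    then show False using r by (simp add: op_spectrum_def)
  qed
qed

lemma weierstrass_poly:
  fixes f :: "real \<Rightarrow> real"
  assumes "continuous_on {a..b} f"
  shows "\<exists>p. uniform_limit {a..b} (\<lambda>n. poly (p n)) f sequentially"
proof -
  have "\<exists>p. \<forall>x\<in>{a..b}. \<bar>f x - poly p x\<bar> < 1 / real (Suc n)" for n
  proof -
    obtain g where g: "real_polynomial_function g" "\<And>x. x \<in> {a..b} \<Longrightarrow> \<bar>f x - g x\<bar> < 1 / real (Suc n)"
      using Stone_Weierstrass_real_polynomial_function[OF compact_Icc assms, of "1 / real (Suc n)"]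
      by auto
    then obtain c N where "g = (\<lambda>x. \<Sum>i\<le>N. c i * x ^ i)"
      using real_polynomial_function_iff_sum by blast
    then have "g x = poly (\<Sum>i\<le>N. monom (c i) i) x" for x by (simp add: poly_sum poly_monom)
    then show ?thesis using g by metis
  qed
  then obtain p where p: "\<And>n x. x \<in> {a..b} \<Longrightarrow> \<bar>f x - poly (p n) x\<bar> < 1 / real (Suc n)"
    by metis
  have "uniform_limit {a..b} (\<lambda>n. poly (p n)) f sequentially"
  proof (rule uniform_limitI)
    fix e :: real assume "e > 0"
    then have "eventually (\<lambda>n. 1 / real (Suc n) < e) sequentially"
      using lim_1_over_real_power[of 1] LIMSEQ_inverse_real_of_nat
      by (auto simp: tendsto_iff inverse_eq_divide dist_norm elim!: allE[of _ e])
    then show "\<forall>\<^sub>F n in sequentially. \<forall>x\<in>{a..b}. dist (poly (p n) x) (f x) < e"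
    proof eventually_elim
      case (elim n)
      show ?case
      proof
        fix x assume "x \<in> {a..b}"
        from less_trans[OF p[OF this, of n] elim] show "dist (poly (p n) x) (f x) < e"
          by (simp add: dist_norm abs_minus_commute)
      qed
    qed
  qed
  then show ?thesis by blast
qed

text \<open>Both the existence and the uniqueness of the limit that defines \<open>f(A)\<close> rest on the bound
  of \<open>\<parallel>p(A)\<parallel>\<close> by the supremum of \<open>\<bar>p\<bar>\<close> over the spectrum.\<close>

lemma cfc_tendsto:
  fixes A :: "'h::{real_inner,complete_space} \<Rightarrow>\<^sub>L 'h"
  assumes A: "spec_in m M A" and p: "uniform_limit {m..M} (\<lambda>n. poly (p n)) f sequentially"
  shows "(\<lambda>n. op_poly (p n) A) \<longlonglongrightarrow> cfc f A"
proof -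
  note sp = op_spectrum_subset[OF A]
  have sA: "sadj A" using A by (rule spec_in_sadj)
  have pS: "uniform_limit (op_spectrum A) (\<lambda>n. poly (p n)) f sequentially"
    using p sp by (rule uniform_limit_on_subset)
  have "Cauchy (\<lambda>n. op_poly (p n) A)"
  proof (rule CauchyI)
    fix e :: real assume "e > 0"
    then have "\<forall>\<^sub>F n in sequentially. \<forall>x\<in>op_spectrum A. dist (poly (p n) x) (f x) < e/4"
      by (intro uniform_limitD[OF pS]) simp
    then obtain N where N: "\<And>n x. n \<ge> N \<Longrightarrow> x \<in> op_spectrum A \<Longrightarrow> \<bar>poly (p n) x - f x\<bar> < e/4"
      by (auto simp: eventually_sequentially dist_norm)
    have "norm (op_poly (p i) A - op_poly (p j) A) < e" if "i \<ge> N" "j \<ge> N" for i j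
    proof -
      have "norm (op_poly (p i - p j) A) \<le> e/2"
      proof (rule norm_op_poly_le[OF sA])
        fix s assume "s \<in> op_spectrum A"
        then have "\<bar>poly (p i) s - f s\<bar> < e/4" "\<bar>poly (p j) s - f s\<bar> < e/4"
          using N that by blast+
        then show "\<bar>poly (p i - p j) s\<bar> \<le> e/2" by (simp add: abs_if split: if_splits)
      qed (use \<open>e > 0\<close> in simp)
      then show ?thesis using \<open>e > 0\<close> by (simp add: op_poly_diff)
    qed
    then show "\<exists>N. \<forall>i\<ge>N. \<forall>j\<ge>N. norm (op_poly (p i) A - op_poly (p j) A) < e" by blast
  qed
  then obtain T where T: "(\<lambda>n. op_poly (p n) A) \<longlonglongrightarrow> T"
    using Cauchy_blinfun_convergent unfolding convergent_def by blast
  have "cfc f A = T" unfolding cfc_def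
  proof (rule the_equality)
    show "\<exists>p. uniform_limit (op_spectrum A) (\<lambda>n. poly (p n)) f sequentially \<and> (\<lambda>n. op_poly (p n) A) \<longlonglongrightarrow> T"
      using pS T by blast
    fix U assume "\<exists>p. uniform_limit (op_spectrum A) (\<lambda>n. poly (p n)) f sequentially \<and> (\<lambda>n. op_poly (p n) A) \<longlonglongrightarrow> U"
    then obtain q where q: "uniform_limit (op_spectrum A) (\<lambda>n. poly (q n)) f sequentially"
      and U: "(\<lambda>n. op_poly (q n) A) \<longlonglongrightarrow> U" by blast
    have "(\<lambda>n. op_poly (p n) A - op_poly (q n) A) \<longlonglongrightarrow> 0"
    proof (rule tendstoI)
      fix e :: real assume "e > 0"
      then have "\<forall>\<^sub>F n in sequentially. \<forall>x\<in>op_spectrum A. dist (poly (p n) x) (f x) < e/4"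
        "\<forall>\<^sub>F n in sequentially. \<forall>x\<in>op_spectrum A. dist (poly (q n) x) (f x) < e/4"
        by (intro uniform_limitD[OF pS] uniform_limitD[OF q]; simp)+
      then show "\<forall>\<^sub>F n in sequentially. dist (op_poly (p n) A - op_poly (q n) A) 0 < e"
      proof eventually_elim
        case (elim n)
        have "norm (op_poly (p n - q n) A) \<le> e/2"
        proof (rule norm_op_poly_le[OF sA])
          fix s assume "s \<in> op_spectrum A"
          then have "\<bar>poly (p n) s - f s\<bar> < e/4" "\<bar>poly (q n) s - f s\<bar> < e/4"
            using elim by (auto simp: dist_norm)
          then show "\<bar>poly (p n - q n) s\<bar> \<le> e/2" by (simp add: abs_if split: if_splits)
        qed (use \<open>e > 0\<close> in simp)
        then show ?case using \<open>e > 0\<close> by (simp add: op_poly_diff)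
      qed
    qed
    moreover have "(\<lambda>n. op_poly (p n) A - op_poly (q n) A) \<longlonglongrightarrow> T - U"
      by (intro tendsto_intros T U)
    ultimately show "U = T" using LIMSEQ_unique by fastforce
  qed
  then show ?thesis using T by simp
qed

lemma cfc_poly:
  fixes A :: "'h::{real_inner,complete_space} \<Rightarrow>\<^sub>L 'h"
  assumes "spec_in m M A"
  shows "cfc (poly p) A = op_poly p A"
  using cfc_tendsto[OF assms, of "\<lambda>_. p" "poly p"] LIMSEQ_unique[OF _ tendsto_const]
  by (metis uniform_limit_const)

lemma cfc_const:
  fixes A :: "'h::{real_inner,complete_space} \<Rightarrow>\<^sub>L 'h"
  assumes "spec_in m M A"
  shows "cfc (\<lambda>_. c) A = c *\<^sub>R id_blinfun"
proof -
  have "(\<lambda>_. c) = poly [:c:]" by (simp add: fun_eq_iff)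
  then show ?thesis using cfc_poly[OF assms, of "[:c:]"] by simp
qed

lemma cfc_ident:
  fixes A :: "'h::{real_inner,complete_space} \<Rightarrow>\<^sub>L 'h"
  assumes "spec_in m M A"
  shows "cfc (\<lambda>x. x) A = A"
proof -
  have "(\<lambda>x. x) = poly [:0, 1::real:]" by (simp add: fun_eq_iff)
  then show ?thesis using cfc_poly[OF assms, of "[:0, 1:]"] by simp
qed

lemma cfc_cong:
  fixes A :: "'h::{real_inner,complete_space} \<Rightarrow>\<^sub>L 'h"
  assumes "spec_in m M A" "\<And>x. x \<in> {m..M} \<Longrightarrow> f x = g x"
  shows "cfc f A = cfc g A"
proof -
  have "uniform_limit (op_spectrum A) p f sequentially \<longleftrightarrow> uniform_limit (op_spectrum A) p g sequentially" for p
    using op_spectrum_subset[OF assms(1)] assms(2) by (intro uniform_limit_cong') auto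
  then show ?thesis by (simp add: cfc_def)
qed

context
  fixes A :: "'h::{real_inner,complete_space} \<Rightarrow>\<^sub>L 'h" and m M :: real and f :: "real \<Rightarrow> real"
  assumes A: "spec_in m M A" and f: "continuous_on {m..M} f"
begin

lemma cfc_add:
  assumes g: "continuous_on {m..M} g"
  shows "cfc (\<lambda>x. f x + g x) A = cfc f A + cfc g A"
proof -
  obtain p q where p: "uniform_limit {m..M} (\<lambda>n. poly (p n)) f sequentially"
    and q: "uniform_limit {m..M} (\<lambda>n. poly (q n)) g sequentially"
    using weierstrass_poly f g by metis
  have "uniform_limit {m..M} (\<lambda>n. poly (p n + q n)) (\<lambda>x. f x + g x) sequentially"
    using uniform_limit_add[OF p q] by (simp add: uniform_limit_iff)
  from cfc_tendsto[OF A this] tendsto_add[OF cfc_tendsto[OF A p] cfc_tendsto[OF A q]]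
  show ?thesis by (simp add: op_poly_add LIMSEQ_unique)
qed

lemma cfc_mult:
  assumes g: "continuous_on {m..M} g"
  shows "cfc (\<lambda>x. f x * g x) A = cfc f A \<cdot>\<^sub>L cfc g A"
proof -
  obtain p q where p: "uniform_limit {m..M} (\<lambda>n. poly (p n)) f sequentially"
    and q: "uniform_limit {m..M} (\<lambda>n. poly (q n)) g sequentially"
    using weierstrass_poly f g by metis
  have "bounded (f ` {m..M})" "bounded (g ` {m..M})"
    using f g by (auto intro!: compact_imp_bounded compact_continuous_image)
  from uniform_lim_mult[OF p q this]
  have "uniform_limit {m..M} (\<lambda>n. poly (p n * q n)) (\<lambda>x. f x * g x) sequentially"
    by (simp add: uniform_limit_iff)
  from cfc_tendsto[OF A this] tendsto_oL[OF cfc_tendsto[OF A p] cfc_tendsto[OF A q]]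
  show ?thesis by (simp add: op_poly_mult LIMSEQ_unique)
qed

lemma cfc_cmult: "cfc (\<lambda>x. c * f x) A = c *\<^sub>R cfc f A"
proof -
  obtain p where p: "uniform_limit {m..M} (\<lambda>n. poly (p n)) f sequentially"
    using weierstrass_poly f by metis
  have "uniform_limit {m..M} (\<lambda>n. poly (smult c (p n))) (\<lambda>x. c * f x) sequentially"
    using bounded_linear.uniform_limit[OF bounded_linear_mult_right[of c] p] by (simp add: uniform_limit_iff)
  from cfc_tendsto[OF A this] tendsto_scaleR[OF tendsto_const cfc_tendsto[OF A p]]
  show ?thesis by (simp add: op_poly_smult LIMSEQ_unique)
qed

lemma sadj_cfc: "sadj (cfc f A)"
proof -
  obtain p where p: "uniform_limit {m..M} (\<lambda>n. poly (p n)) f sequentially"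
    using weierstrass_poly f by metis
  show ?thesis by (rule sadj_lim[OF cfc_tendsto[OF A p]]) (rule sadj_op_poly[OF spec_in_sadj[OF A]])
qed

lemma cfc_intertwine:
  fixes B C :: "'h \<Rightarrow>\<^sub>L 'h"
  assumes B: "spec_in m M B" and C: "C \<cdot>\<^sub>L A = B \<cdot>\<^sub>L C"
  shows "C \<cdot>\<^sub>L cfc f A = cfc f B \<cdot>\<^sub>L C"
proof -
  obtain p where p: "uniform_limit {m..M} (\<lambda>n. poly (p n)) f sequentially"
    using weierstrass_poly f by metis
  have "(\<lambda>n. C \<cdot>\<^sub>L op_poly (p n) A) \<longlonglongrightarrow> C \<cdot>\<^sub>L cfc f A" "(\<lambda>n. op_poly (p n) B \<cdot>\<^sub>L C) \<longlonglongrightarrow> cfc f B \<cdot>\<^sub>L C"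
    by (intro tendsto_oL tendsto_const cfc_tendsto[OF A p] cfc_tendsto[OF B p])+
  then show ?thesis using LIMSEQ_unique by (simp add: op_poly_intertwine[OF C])
qed

lemma cfc_closed:
  assumes "closed L" "\<And>p. op_poly p A \<in> L"
  shows "cfc f A \<in> L"
proof -
  obtain p where p: "uniform_limit {m..M} (\<lambda>n. poly (p n)) f sequentially"
    using weierstrass_poly f by metis
  show ?thesis
    by (rule Lim_in_closed_set[OF assms(1) _ _ cfc_tendsto[OF A p]]) (auto simp: assms(2))
qed

lemma norm_cfc_le:
  assumes c: "c \<ge> 0" "\<And>x. x \<in> {m..M} \<Longrightarrow> \<bar>f x\<bar> \<le> c"
  shows "norm (cfc f A) \<le> c"
proof (rule field_le_epsilon)
  fix e :: real assume "e > 0"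
  obtain p where p: "uniform_limit {m..M} (\<lambda>n. poly (p n)) f sequentially"
    using weierstrass_poly f by metis
  have "\<forall>\<^sub>F n in sequentially. \<forall>x\<in>{m..M}. dist (poly (p n) x) (f x) < e"
    by (rule uniform_limitD[OF p \<open>e > 0\<close>])
  then have "\<forall>\<^sub>F n in sequentially. norm (op_poly (p n) A) \<le> c + e"
  proof eventually_elim
    case (elim n)
    show ?case
    proof (rule norm_op_poly_le[OF spec_in_sadj[OF A]])
      fix s assume "s \<in> op_spectrum A"
      then have "s \<in> {m..M}" using op_spectrum_subset[OF A] by blast
      then have "\<bar>poly (p n) s - f s\<bar> < e" "\<bar>f s\<bar> \<le> c"
        using elim c by (auto simp: dist_norm)
      then show "\<bar>poly (p n) s\<bar> \<le> c + e" by linarith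
    qed (use c \<open>e > 0\<close> in simp)
  qed
  then show "norm (cfc f A) \<le> c + e"
    using tendsto_norm[OF cfc_tendsto[OF A p]] by (intro tendsto_upperbound) auto
qed

text \<open>A nonnegative function of \<open>A\<close> is the square of the self-adjoint operator \<open>(sqrt f)(A)\<close>.\<close>

lemma cfc_nonneg:
  assumes "\<And>x. x \<in> {m..M} \<Longrightarrow> 0 \<le> f x"
  shows "0 \<preceq> cfc f A"
proof -
  have c: "continuous_on {m..M} (\<lambda>x. sqrt (f x))" using f by (intro continuous_intros)
  obtain p where p: "uniform_limit {m..M} (\<lambda>n. poly (p n)) (\<lambda>x. sqrt (f x)) sequentially"
    using weierstrass_poly c by metis
  define R where "R = cfc (\<lambda>x. sqrt (f x)) A"
  have sR: "sadj R" unfolding R_def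
    by (rule sadj_lim[OF cfc_tendsto[OF A p]]) (rule sadj_op_poly[OF spec_in_sadj[OF A]])
  have "bounded ((\<lambda>x. sqrt (f x)) ` {m..M})"
    using c by (auto intro!: compact_imp_bounded compact_continuous_image)
  from uniform_lim_mult[OF p p this this]
  have "uniform_limit {m..M} (\<lambda>n. poly (p n * p n)) (\<lambda>x. sqrt (f x) * sqrt (f x)) sequentially"
    by (simp add: uniform_limit_iff del: real_sqrt_mult_self)
  from cfc_tendsto[OF A this] tendsto_oL[OF cfc_tendsto[OF A p] cfc_tendsto[OF A p]]
  have "cfc (\<lambda>x. sqrt (f x) * sqrt (f x)) A = R \<cdot>\<^sub>L R" by (simp add: op_poly_mult LIMSEQ_unique R_def)
  moreover have "cfc (\<lambda>x. sqrt (f x) * sqrt (f x)) A = cfc f A"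
    by (rule cfc_cong[OF A]) (use assms in simp)
  ultimately have "cfc f A = R \<cdot>\<^sub>L R" by (simp only:)
  then have "cfc f A x \<bullet> x = R x \<bullet> R x" for x using sadjD[OF sR, of "R x" x] by simp
  then show ?thesis by (simp add: op_le_def)
qed

lemma cfc_compose_poly: "cfc (\<lambda>x. poly q (f x)) A = op_poly q (cfc f A)"
proof (induction q)
  case 0
  show ?case using cfc_const[OF A, of 0] by simp
next
  case (pCons c q)
  have q: "continuous_on {m..M} (\<lambda>x. poly q (f x))" by (intro continuous_intros f)
  then have fq: "continuous_on {m..M} (\<lambda>x. f x * poly q (f x))" by (intro continuous_intros f)
  obtain p where p: "uniform_limit {m..M} (\<lambda>n. poly (p n)) (\<lambda>x. f x * poly q (f x)) sequentially"
    using weierstrass_poly fq by metis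
  have "uniform_limit {m..M} (\<lambda>n. poly ([:c:] + p n)) (\<lambda>x. c + f x * poly q (f x)) sequentially"
    using uniform_limit_add[OF uniform_limit_const[where c = "\<lambda>_. c"] p] by (simp add: uniform_limit_iff)
  from cfc_tendsto[OF A this] tendsto_add[OF tendsto_const cfc_tendsto[OF A p], of "c *\<^sub>R id_blinfun"]
  have "cfc (\<lambda>x. c + f x * poly q (f x)) A = c *\<^sub>R id_blinfun + cfc (\<lambda>x. f x * poly q (f x)) A"
    unfolding op_poly_add by (simp add: LIMSEQ_unique)
  then show ?case using cfc_mult[OF q] pCons by simp
qed

end

lemma cfc_diff:
  fixes A :: "'h::{real_inner,complete_space} \<Rightarrow>\<^sub>L 'h"
  assumes "spec_in m M A" "continuous_on {m..M} f" "continuous_on {m..M} g"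
  shows "cfc (\<lambda>x. f x - g x) A = cfc f A - cfc g A"
proof -
  have "continuous_on {m..M} (\<lambda>x. (-1) * g x)" using assms(3) by (intro continuous_intros)
  then show ?thesis
    using cfc_add[OF assms(1,2), of "\<lambda>x. (-1) * g x"] cfc_cmult[OF assms(1,3), of "-1"] by simp
qed

lemma cfc_mono:
  fixes A :: "'h::{real_inner,complete_space} \<Rightarrow>\<^sub>L 'h"
  assumes "spec_in m M A" "continuous_on {m..M} f" "continuous_on {m..M} g"
    "\<And>x. x \<in> {m..M} \<Longrightarrow> f x \<le> g x"
  shows "cfc f A \<preceq> cfc g A"
proof -
  have "0 \<preceq> cfc (\<lambda>x. g x - f x) A"
    by (rule cfc_nonneg[OF assms(1)]) (use assms in \<open>auto intro!: continuous_intros\<close>)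
  then have "0 \<preceq> cfc g A - cfc f A" by (simp only: cfc_diff[OF assms(1,3,2)])
  then show ?thesis by (simp add: op_le_def ap_simps inner_simps)
qed

lemma spec_in_cfc:
  fixes A :: "'h::{real_inner,complete_space} \<Rightarrow>\<^sub>L 'h"
  assumes "spec_in m M A" "continuous_on {m..M} f" "\<And>x. x \<in> {m..M} \<Longrightarrow> a \<le> f x \<and> f x \<le> b"
  shows "spec_in a b (cfc f A)"
  using cfc_mono[OF assms(1) continuous_on_const assms(2), of a]
    cfc_mono[OF assms(1,2) continuous_on_const, of b] assms
  by (auto simp: spec_in_def sadj_cfc cfc_const[OF assms(1)])

lemma cfc_compose:
  fixes A :: "'h::{real_inner,complete_space} \<Rightarrow>\<^sub>L 'h"
  assumes A: "spec_in m M A" and f: "continuous_on {m..M} f" and g: "continuous_on {a..b} g"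
    and fab: "\<And>x. x \<in> {m..M} \<Longrightarrow> a \<le> f x \<and> f x \<le> b"
  shows "cfc g (cfc f A) = cfc (\<lambda>x. g (f x)) A"
proof -
  obtain p where p: "uniform_limit {a..b} (\<lambda>n. poly (p n)) g sequentially"
    using weierstrass_poly g by metis
  have 1: "(\<lambda>n. op_poly (p n) (cfc f A)) \<longlonglongrightarrow> cfc g (cfc f A)"
    by (rule cfc_tendsto[OF spec_in_cfc[OF A f fab] p])
  have gf: "continuous_on {m..M} (\<lambda>x. g (f x))"
    by (rule continuous_on_compose2[OF g f]) (use fab in auto)
  have "(\<lambda>n. op_poly (p n) (cfc f A)) \<longlonglongrightarrow> cfc (\<lambda>x. g (f x)) A"
  proof (rule tendstoI)
    fix e :: real assume "e > 0"
    then have "\<forall>\<^sub>F n in sequentially. \<forall>x\<in>{a..b}. dist (poly (p n) x) (g x) < e/2"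
      by (intro uniform_limitD[OF p]) simp
    then show "\<forall>\<^sub>F n in sequentially. dist (op_poly (p n) (cfc f A)) (cfc (\<lambda>x. g (f x)) A) < e"
    proof eventually_elim
      case (elim n)
      have pf: "continuous_on {m..M} (\<lambda>x. poly (p n) (f x))" by (intro continuous_intros f)
      have "norm (cfc (\<lambda>x. poly (p n) (f x) - g (f x)) A) \<le> e/2"
      proof (rule norm_cfc_le[OF A])
        fix x assume "x \<in> {m..M}"
        then show "\<bar>poly (p n) (f x) - g (f x)\<bar> \<le> e/2" using fab elim by (force simp: dist_norm)
      qed (use pf gf \<open>e > 0\<close> in \<open>auto intro!: continuous_intros\<close>)
      then show ?case using \<open>e > 0\<close>
        by (simp add: cfc_diff[OF A pf gf] cfc_compose_poly[OF A f] dist_norm)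
    qed
  qed
  then show ?thesis using 1 LIMSEQ_unique by blast
qed

lemma spec_in_norm_le:
  fixes A :: "'h::{real_inner,complete_space} \<Rightarrow>\<^sub>L 'h"
  assumes "spec_in m M A" "\<bar>m\<bar> \<le> c" "\<bar>M\<bar> \<le> c"
  shows "norm A \<le> c"
proof -
  have "norm (cfc (\<lambda>x. x) A) \<le> c"
    by (rule norm_cfc_le[OF assms(1)]) (use assms in auto)
  then show ?thesis by (simp add: cfc_ident[OF assms(1)])
qed

text \<open>Polynomials are Lipschitz on bounded sets of operators. As they approximate a continuous function
  uniformly, with an error that is the same for all operators with bounds \<open>m\<close> and \<open>M\<close>, that function is
  uniformly continuous on these operators.\<close>

lemma op_poly_Lipschitz:
  "\<exists>K\<ge>0. \<forall>A B :: 'h::real_normed_vector \<Rightarrow>\<^sub>L 'h. norm A \<le> c \<and> norm B \<le> c \<longrightarrow>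
     norm (op_poly p A) \<le> K \<and> norm (op_poly p A - op_poly p B) \<le> K * norm (A - B)"
proof (induction p)
  case 0
  show ?case by (intro exI[of _ 0]) simp
next
  case (pCons a p)
  then obtain K where K: "K \<ge> 0" "\<And>A B :: 'h \<Rightarrow>\<^sub>L 'h. norm A \<le> c \<Longrightarrow> norm B \<le> c \<Longrightarrow>
     norm (op_poly p A) \<le> K \<and> norm (op_poly p A - op_poly p B) \<le> K * norm (A - B)" by blast
  define K' where "K' = \<bar>a\<bar> + \<bar>c\<bar> * K + K"
  have "norm (op_poly (pCons a p) A) \<le> K' \<and>
     norm (op_poly (pCons a p) A - op_poly (pCons a p) B) \<le> K' * norm (A - B)"
    if AB: "norm A \<le> c" "norm B \<le> c" for A B :: "'h \<Rightarrow>\<^sub>L 'h"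
  proof
    have c: "0 \<le> c" using AB norm_ge_zero[of A] by linarith
    have "norm (op_poly (pCons a p) A) \<le> norm (a *\<^sub>R (id_blinfun::'h \<Rightarrow>\<^sub>L 'h)) + norm (A \<cdot>\<^sub>L op_poly p A)"
      unfolding op_poly_pCons by (rule norm_triangle_ineq)
    also have "\<dots> \<le> \<bar>a\<bar> * 1 + c * K"
    proof (rule add_mono)
      show "norm (a *\<^sub>R (id_blinfun::'h \<Rightarrow>\<^sub>L 'h)) \<le> \<bar>a\<bar> * 1"
        unfolding norm_scaleR by (intro mult_left_mono norm_blinfun_id_le) auto
      show "norm (A \<cdot>\<^sub>L op_poly p A) \<le> c * K"
        using norm_blinfun_compose[of A "op_poly p A"] K(2)[OF AB] AB c
        by (meson mult_mono norm_ge_zero order_trans)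
    qed
    also have "\<dots> \<le> K'" using c K(1) by (simp add: K'_def)
    finally show "norm (op_poly (pCons a p) A) \<le> K'" .
    have "op_poly (pCons a p) A - op_poly (pCons a p) B
        = A \<cdot>\<^sub>L (op_poly p A - op_poly p B) + (A - B) \<cdot>\<^sub>L op_poly p B" by (simp add: oL_simps)
    also have "norm \<dots> \<le> norm A * norm (op_poly p A - op_poly p B) + norm (A - B) * norm (op_poly p B)"
      by (intro norm_triangle_mono norm_blinfun_compose)
    also have "\<dots> \<le> c * (K * norm (A - B)) + norm (A - B) * K"
      using K AB c by (intro add_mono mult_mono) auto
    also have "\<dots> \<le> K' * norm (A - B)" using c by (simp add: K'_def algebra_simps)
    finally show "norm (op_poly (pCons a p) A - op_poly (pCons a p) B) \<le> K' * norm (A - B)" .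
  qed
  moreover have "K' \<ge> 0" using K(1) by (simp add: K'_def)
  ultimately show ?case by blast
qed

lemma cfc_uniformly_continuous:
  assumes f: "continuous_on {m..M} f" and "e > 0"
  shows "\<exists>d>0. \<forall>A B :: 'h::{real_inner,complete_space} \<Rightarrow>\<^sub>L 'h.
     spec_in m M A \<and> spec_in m M B \<and> norm (A - B) < d \<longrightarrow> norm (cfc f A - cfc f B) < e"
proof -
  obtain p where p: "uniform_limit {m..M} (\<lambda>n. poly (p n)) f sequentially"
    using weierstrass_poly f by metis
  have "\<forall>\<^sub>F n in sequentially. \<forall>x\<in>{m..M}. dist (poly (p n) x) (f x) < e/4"
    using \<open>e > 0\<close> by (intro uniform_limitD[OF p]) simp
  from eventually_happens'[OF sequentially_bot this]
  obtain n where n: "\<And>x. x \<in> {m..M} \<Longrightarrow> \<bar>poly (p n) x - f x\<bar> < e/4"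
    by (auto simp only: dist_norm real_norm_def)
  define q where "q = p n"
  define c where "c = \<bar>m\<bar> + \<bar>M\<bar>"
  obtain K where K: "K \<ge> 0" "\<And>A B :: 'h \<Rightarrow>\<^sub>L 'h. norm A \<le> c \<Longrightarrow> norm B \<le> c \<Longrightarrow>
     norm (op_poly q A - op_poly q B) \<le> K * norm (A - B)" using op_poly_Lipschitz[of c q] by blast
  have app: "norm (op_poly q A - cfc f A) \<le> e/4" if "spec_in m M A" for A :: "'h \<Rightarrow>\<^sub>L 'h"
  proof -
    have "norm (cfc (\<lambda>x. poly q x - f x) A) \<le> e/4"
      using n \<open>e > 0\<close> by (intro norm_cfc_le[OF that]) (auto intro!: continuous_intros f less_imp_le simp: q_def)
    moreover have "cfc (\<lambda>x. poly q x - f x) A = op_poly q A - cfc f A"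
      using cfc_diff[OF that _ f, of "poly q"] cfc_poly[OF that, of q] by (simp add: continuous_on_poly)
    ultimately show ?thesis by simp
  qed
  have "norm (cfc f A - cfc f B) < e"
    if "spec_in m M A" "spec_in m M B" "norm (A - B) < e / (4 * (K + 1))" for A B :: "'h \<Rightarrow>\<^sub>L 'h"
  proof -
    have "norm A \<le> c" "norm B \<le> c" using that by (auto intro!: spec_in_norm_le simp: c_def)
    then have "norm (op_poly q A - op_poly q B) \<le> K * norm (A - B)" by (rule K(2))
    also have "\<dots> \<le> (K + 1) * norm (A - B)" by (simp add: mult_right_mono)
    also have "\<dots> \<le> e/4" using that(3) K(1) by (simp add: field_simps)
    finally have 1: "norm (op_poly q A - op_poly q B) \<le> e/4" .
    have tri: "norm (a - b + c) \<le> norm a + norm b + norm c" for a b c :: "'h \<Rightarrow>\<^sub>L 'h"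
      using norm_triangle_ineq[of "a - b" c] norm_triangle_ineq4[of a b] by linarith
    have "cfc f A - cfc f B = (op_poly q A - op_poly q B) - (op_poly q A - cfc f A) + (op_poly q B - cfc f B)"
      by simp
    then have "norm (cfc f A - cfc f B) \<le> norm (op_poly q A - op_poly q B) + norm (op_poly q A - cfc f A)
        + norm (op_poly q B - cfc f B)"
      by (simp only: tri)
    then show ?thesis using 1 app[OF that(1)] app[OF that(2)] \<open>e > 0\<close> by linarith
  qed
  moreover have "e / (4 * (K + 1)) > 0" using \<open>e > 0\<close> K(1) by simp
  ultimately show ?thesis by blast
qed

section \<open>Powers of positive operators\<close>

definition posop :: "('h::real_inner \<Rightarrow>\<^sub>L 'h) \<Rightarrow> bool" where
  "posop A \<longleftrightarrow> sadj A \<and> (\<exists>m>0. m *\<^sub>R id_blinfun \<preceq> A)"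

text \<open>For \<open>R \<ge> 0\<close>, the closed ball of radius \<open>R\<close> about the identity for the Thompson metric.\<close>

definition bnd :: "real \<Rightarrow> ('h::real_inner \<Rightarrow>\<^sub>L 'h) \<Rightarrow> bool" where
  "bnd R A \<longleftrightarrow> spec_in (exp (- R)) (exp R) A"

lemma posop_sadj: "posop A \<Longrightarrow> sadj A" by (simp add: posop_def)

lemma spec_in_mono: "spec_in m M A \<Longrightarrow> m' \<le> m \<Longrightarrow> M \<le> M' \<Longrightarrow> spec_in m' M' A"
  unfolding spec_in_def by (meson op_le_scalar op_le_trans)

lemma bnd_mono: "bnd R A \<Longrightarrow> R \<le> S \<Longrightarrow> bnd S A"
  unfolding bnd_def by (erule spec_in_mono) auto

lemma spec_in_posop: "spec_in m M A \<Longrightarrow> m > 0 \<Longrightarrow> posop A"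
  by (auto simp: spec_in_def posop_def)

lemma bnd_posop: "bnd R A \<Longrightarrow> posop A"
  by (auto simp: bnd_def intro: spec_in_posop)

lemma posop_bnd:
  assumes "posop A"
  obtains R where "R \<ge> 0" "bnd R A"
proof -
  obtain m where m: "m > 0" "m *\<^sub>R id_blinfun \<preceq> A" using assms by (auto simp: posop_def)
  define R where "R = max 0 (max (- ln m) (ln (norm A + 1)))"
  have n: "norm A + 1 > 0" by (simp add: add_nonneg_pos)
  have "exp (- R) \<le> exp (ln m)" by (subst exp_le_cancel_iff) (simp add: R_def)
  moreover have "exp (ln (norm A + 1)) \<le> exp R" by (subst exp_le_cancel_iff) (simp add: R_def)
  ultimately have "exp (- R) \<le> m" "norm A \<le> exp R" using m n by simp_all
  then have "spec_in (exp (- R)) (exp R) A"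
    using assms m op_le_norm[of A] unfolding spec_in_def posop_def by (meson op_le_scalar op_le_trans)
  then show ?thesis by (intro that[of R]) (auto simp: bnd_def R_def)
qed

lemma exp_Icc_pos: "x \<in> {exp (- R)..exp R} \<Longrightarrow> x > 0" for x R :: real
  using less_le_trans[OF exp_gt_zero] by auto

lemma cont_powr_exp: "continuous_on {exp (- R)..exp R} (\<lambda>x. x powr t)" for R t :: real
  by (intro continuous_intros) (use exp_Icc_pos in force)+

lemma cont_ln_exp: "continuous_on {exp (- R)..exp R} ln" for R :: real
  by (intro continuous_intros) (use exp_Icc_pos in force)+

lemma abs_ln_le: "x \<in> {exp (- R)..exp R} \<Longrightarrow> \<bar>ln x\<bar> \<le> R" for x R :: real
  using ln_le_cancel_iff[of "exp (- R)" x] ln_le_cancel_iff[of x "exp R"] exp_Icc_pos[of x R] by auto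

lemma powr_bounds:
  fixes x R t :: real
  assumes "x \<in> {exp (- R)..exp R}"
  shows "exp (- (\<bar>t\<bar> * R)) \<le> x powr t \<and> x powr t \<le> exp (\<bar>t\<bar> * R)"
proof -
  have "\<bar>t * ln x\<bar> \<le> \<bar>t\<bar> * R" using abs_ln_le[OF assms] by (simp add: abs_mult mult_left_mono)
  then show ?thesis using exp_Icc_pos[OF assms] by (simp add: powr_def abs_le_iff)
qed

lemma bnd_op_powr:
  fixes A :: "'h::{real_inner,complete_space} \<Rightarrow>\<^sub>L 'h"
  assumes "bnd R A"
  shows "bnd (\<bar>t\<bar> * R) (op_powr A t)"
  using assms unfolding bnd_def op_powr_def
  by (intro spec_in_cfc[of "exp (- R)" "exp R"] cont_powr_exp powr_bounds)

context
  fixes A :: "'h::{real_inner,complete_space} \<Rightarrow>\<^sub>L 'h"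
  assumes A: "posop A"
begin

lemma posop_powr: "posop (op_powr A t)"
  using A by (metis posop_bnd bnd_op_powr bnd_posop)

lemma op_powr_add: "op_powr A s \<cdot>\<^sub>L op_powr A t = op_powr A (s + t)"
proof -
  obtain R where R: "spec_in (exp (- R)) (exp R) A" using A posop_bnd bnd_def by metis
  show ?thesis unfolding op_powr_def powr_add
    by (rule cfc_mult[OF R cont_powr_exp cont_powr_exp, symmetric])
qed

lemma op_powr_zero: "op_powr A 0 = id_blinfun"
proof -
  obtain R where R: "spec_in (exp (- R)) (exp R) A" using A posop_bnd bnd_def by metis
  have "cfc (\<lambda>x. x powr 0) A = cfc (\<lambda>_. 1) A"
    by (rule cfc_cong[OF R]) (use exp_Icc_pos in force)
  then show ?thesis unfolding op_powr_def using cfc_const[OF R, of 1] by simp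
qed

lemma op_powr_one: "op_powr A 1 = A"
proof -
  obtain R where R: "spec_in (exp (- R)) (exp R) A" using A posop_bnd bnd_def by metis
  have "cfc (\<lambda>x. x powr 1) A = cfc (\<lambda>x. x) A"
    by (rule cfc_cong[OF R]) (use exp_Icc_pos in force)
  then show ?thesis unfolding op_powr_def using cfc_ident[OF R] by simp
qed

lemma op_powr_powr: "op_powr (op_powr A s) t = op_powr A (s * t)"
proof -
  obtain R where R: "spec_in (exp (- R)) (exp R) A" using A posop_bnd bnd_def by metis
  have "cfc (\<lambda>x. x powr t) (cfc (\<lambda>x. x powr s) A) = cfc (\<lambda>x. (x powr s) powr t) A"
    by (rule cfc_compose[OF R cont_powr_exp cont_powr_exp]) (use powr_bounds in blast)
  then show ?thesis by (simp add: op_powr_def powr_powr)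
qed

lemma op_powr_scaleR:
  assumes "c > 0"
  shows "op_powr (c *\<^sub>R A) t = (c powr t) *\<^sub>R op_powr A t"
proof -
  obtain R where R: "spec_in (exp (- R)) (exp R) A" using A posop_bnd bnd_def by metis
  define S where "S = R + \<bar>ln c\<bar>"
  have "exp (- S) \<le> c * x \<and> c * x \<le> exp S" if "x \<in> {exp (- R)..exp R}" for x
  proof -
    have "\<bar>ln (c * x)\<bar> \<le> S" using abs_ln_le[OF that] exp_Icc_pos[OF that] assms
      by (simp add: ln_mult S_def)
    then show ?thesis using exp_Icc_pos[OF that] assms
      by (metis abs_le_iff exp_le_cancel_iff exp_ln minus_le_iff mult_pos_pos)
  qed
  from cfc_compose[OF R _ cont_powr_exp[where t = t] this]
  have "cfc (\<lambda>x. x powr t) (cfc (\<lambda>x. c * x) A) = cfc (\<lambda>x. (c * x) powr t) A"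
    by (simp add: continuous_on_mult_const)
  moreover have "cfc (\<lambda>x. c * x) A = c *\<^sub>R A"
    using cfc_cmult[OF R continuous_on_id, of c] by (simp add: cfc_ident[OF R])
  moreover have "cfc (\<lambda>x. (c * x) powr t) A = cfc (\<lambda>x. (c powr t) * (x powr t)) A"
    by (rule cfc_cong[OF R]) (use exp_Icc_pos assms in \<open>force simp: powr_mult\<close>)
  ultimately show ?thesis
    using cfc_cmult[OF R cont_powr_exp, of "c powr t" t] by (simp add: op_powr_def)
qed

lemma op_powr_cancel [simp]:
  "op_powr A t \<cdot>\<^sub>L op_powr A (- t) = id_blinfun" "op_powr A (- t) \<cdot>\<^sub>L op_powr A t = id_blinfun"
  "op_powr A t \<cdot>\<^sub>L (op_powr A (- t) \<cdot>\<^sub>L B) = B" "op_powr A (- t) \<cdot>\<^sub>L (op_powr A t \<cdot>\<^sub>L B) = B"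
  by (simp_all add: op_powr_add op_powr_zero flip: oL_assoc)

lemma op_powr_inverse_unique:
  assumes "A \<cdot>\<^sub>L B = id_blinfun"
  shows "B = op_powr A (-1)"
proof -
  have "op_powr A (-1) \<cdot>\<^sub>L (op_powr A 1 \<cdot>\<^sub>L B) = B" by (rule op_powr_cancel)
  then show ?thesis using assms by (simp add: op_powr_one)
qed

end

lemma sadj_powr: "posop A \<Longrightarrow> sadj (op_powr A t)" for A :: "'h::{real_inner,complete_space} \<Rightarrow>\<^sub>L 'h"
  using posop_powr posop_sadj by blast

lemma posop_ge: "posop A \<Longrightarrow> sadj B \<Longrightarrow> A \<preceq> B \<Longrightarrow> posop B"
  unfolding posop_def by (meson op_le_trans)

lemma posop_scaleR: "posop A \<Longrightarrow> c > 0 \<Longrightarrow> posop (c *\<^sub>R A)"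
proof -
  assume A: "posop A" and c: "c > 0"
  then obtain m where m: "m > 0" "m *\<^sub>R id_blinfun \<preceq> A" by (auto simp: posop_def)
  from op_le_scaleR[OF m(2), of c] c m(1) A show "posop (c *\<^sub>R A)"
    by (auto simp: posop_def sadj_intros intro!: exI[of _ "c * m"])
qed

lemma posop_cong:
  fixes A :: "'h::{real_inner,complete_space} \<Rightarrow>\<^sub>L 'h"
  assumes "posop A" "posop B"
  shows "posop (op_powr A t \<cdot>\<^sub>L B \<cdot>\<^sub>L op_powr A t)"
proof -
  obtain m where m: "m > 0" "m *\<^sub>R id_blinfun \<preceq> B" using assms(2) by (auto simp: posop_def)
  have s: "sadj (op_powr A t)" by (rule sadj_powr[OF assms(1)])
  have "op_powr A t \<cdot>\<^sub>L (m *\<^sub>R id_blinfun) \<cdot>\<^sub>L op_powr A t \<preceq> op_powr A t \<cdot>\<^sub>L B \<cdot>\<^sub>L op_powr A t"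
    by (rule op_le_cong[OF m(2) s])
  then have le: "m *\<^sub>R op_powr A (t + t) \<preceq> op_powr A t \<cdot>\<^sub>L B \<cdot>\<^sub>L op_powr A t"
    by (simp add: oL_simps op_powr_add assms)
  show ?thesis
  proof (rule posop_ge[OF _ _ le])
    show "posop (m *\<^sub>R op_powr A (t + t))" by (intro posop_scaleR posop_powr assms m)
    show "sadj (op_powr A t \<cdot>\<^sub>L B \<cdot>\<^sub>L op_powr A t)" by (intro sadj_intros(6) s posop_sadj assms)
  qed
qed

text \<open>Continuity in the exponent, which extends the Loewner--Heinz inequality from dyadic exponents to all
  of them.\<close>

lemma op_powr_Lipschitz:
  fixes A :: "'h::{real_inner,complete_space} \<Rightarrow>\<^sub>L 'h"
  assumes A: "bnd R A" and R: "R \<ge> 0" and st: "0 \<le> s" "s \<le> 1" "0 \<le> t" "t \<le> 1"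
  shows "norm (op_powr A s - op_powr A t) \<le> exp R * R * \<bar>s - t\<bar>"
proof -
  note A' = A[unfolded bnd_def]
  have e: "exp a - exp b \<le> exp R * \<bar>a - b\<bar>" if "a \<le> R" for a b :: real
  proof -
    have "1 + (b - a) \<le> exp (b - a)" by (rule exp_ge_add_one_self)
    then have "exp a * (1 + (b - a)) \<le> exp a * exp (b - a)" by (intro mult_left_mono) auto
    then have "exp a - exp b \<le> exp a * (a - b)" by (simp add: algebra_simps flip: exp_add)
    also have "\<dots> \<le> exp a * \<bar>a - b\<bar>" by (intro mult_left_mono) auto
    also have "\<dots> \<le> exp R * \<bar>a - b\<bar>" using that by (intro mult_right_mono) auto
    finally show ?thesis .
  qed
  have "norm (cfc (\<lambda>x. x powr s - x powr t) A) \<le> exp R * R * \<bar>s - t\<bar>"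
  proof (rule norm_cfc_le[OF A'])
    fix x assume x: "x \<in> {exp (- R)..exp R}"
    have *: "u * ln x \<le> R" if "0 \<le> u" "u \<le> 1" for u
      using abs_ln_le[OF x] that R mult_mono[of u 1 "\<bar>ln x\<bar>" R] abs_ge_self[of "u * ln x"]
      by (simp add: abs_mult)
    have "\<bar>x powr s - x powr t\<bar> \<le> exp R * \<bar>s * ln x - t * ln x\<bar>"
      using e[OF *[OF st(1,2)], of "t * ln x"] e[OF *[OF st(3,4)], of "s * ln x"] exp_Icc_pos[OF x]
      by (simp add: powr_def abs_le_iff abs_minus_commute)
    also have "\<dots> = exp R * \<bar>ln x\<bar> * \<bar>s - t\<bar>" by (simp add: abs_mult flip: left_diff_distrib)
    also have "\<dots> \<le> exp R * R * \<bar>s - t\<bar>" using abs_ln_le[OF x] by (intro mult_right_mono mult_left_mono) auto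
    finally show "\<bar>x powr s - x powr t\<bar> \<le> exp R * R * \<bar>s - t\<bar>" .
  qed (use R in \<open>auto intro!: continuous_on_diff cont_powr_exp\<close>)
  then show ?thesis
    by (simp only: op_powr_def cfc_diff[OF A' cont_powr_exp cont_powr_exp])
qed

section \<open>The Loewner--Heinz inequality\<close>

lemma norm_le_adjoint:
  fixes C D :: "'h::real_inner \<Rightarrow>\<^sub>L 'h"
  assumes "\<And>x y. C x \<bullet> y = x \<bullet> D y"
  shows "norm C \<le> norm D"
proof (rule norm_blinfun_bound)
  fix x
  have "norm (C x) * norm (C x) = x \<bullet> D (C x)"
    using assms[of x "C x"] by (simp add: power2_norm_eq_inner flip: power2_eq_square)
  also have "\<dots> \<le> norm x * (norm D * norm (C x))"
    by (intro order_trans[OF norm_cauchy_schwarz] mult_left_mono norm_blinfun) auto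
  finally have "norm (C x) * norm (C x) \<le> norm (C x) * (norm D * norm x)" by (simp add: mult_ac)
  then show "norm (C x) \<le> norm D * norm x"
    by (cases "norm (C x) = 0") (auto simp del: norm_eq_zero simp: mult_le_cancel_left)
qed simp

lemma norm_sadj_square:
  assumes "sadj T"
  shows "norm (T \<cdot>\<^sub>L T) = norm T * norm T"
proof (rule antisym[OF norm_blinfun_compose])
  have "norm T \<le> sqrt (norm (T \<cdot>\<^sub>L T))"
  proof (rule norm_blinfun_bound)
    fix x
    have "(norm (T x))\<^sup>2 = (T \<cdot>\<^sub>L T) x \<bullet> x" using sadjD[OF assms, of "T x" x]
      by (simp add: power2_norm_eq_inner)
    also have "\<dots> \<le> norm (T \<cdot>\<^sub>L T) * norm x * norm x"
      by (intro order_trans[OF norm_cauchy_schwarz] mult_right_mono norm_blinfun) auto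
    also have "\<dots> = (sqrt (norm (T \<cdot>\<^sub>L T)) * norm x)\<^sup>2" by (simp add: power_mult_distrib power2_eq_square)
    finally show "norm (T x) \<le> sqrt (norm (T \<cdot>\<^sub>L T)) * norm x" by (rule power2_le_imp_le) simp
  qed simp
  then have "(norm T)\<^sup>2 \<le> (sqrt (norm (T \<cdot>\<^sub>L T)))\<^sup>2" by (intro power_mono) auto
  then show "norm T * norm T \<le> norm (T \<cdot>\<^sub>L T)" by (simp add: power2_eq_square)
qed

text \<open>The norm of a self-adjoint operator is its spectral radius, hence is at most the norm of any
  operator similar to it.\<close>

lemma norm_sadj_similar_le_1:
  assumes T: "sadj T" "T = V \<cdot>\<^sub>L Z \<cdot>\<^sub>L W" and WV: "W \<cdot>\<^sub>L V = id_blinfun" and Z: "norm Z \<le> 1"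
  shows "norm T \<le> 1"
proof (rule ccontr)
  assume "\<not> norm T \<le> 1"
  then have gt: "norm T > 1" by simp
  have WV': "W \<cdot>\<^sub>L (V \<cdot>\<^sub>L U) = U" for U using WV by (simp flip: oL_assoc)
  define pw where "pw k = ((\<lambda>U. U \<cdot>\<^sub>L U) ^^ k) T" for k
  have pw: "sadj (pw k) \<and> norm (pw k) = norm T ^ (2 ^ k) \<and> (\<exists>Z'. norm Z' \<le> 1 \<and> pw k = V \<cdot>\<^sub>L Z' \<cdot>\<^sub>L W)" for k
  proof (induction k)
    case 0
    then show ?case using T Z by (auto simp: pw_def)
  next
    case (Suc k)
    then obtain Z' where Z': "norm Z' \<le> 1" "pw k = V \<cdot>\<^sub>L Z' \<cdot>\<^sub>L W" by blast
    have *: "pw (Suc k) = pw k \<cdot>\<^sub>L pw k" by (simp add: pw_def)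
    have "norm (Z' \<cdot>\<^sub>L Z') \<le> 1" using norm_blinfun_compose[of Z' Z'] Z'(1)
      mult_mono[OF Z'(1) Z'(1)] by simp
    moreover have "pw (Suc k) = V \<cdot>\<^sub>L (Z' \<cdot>\<^sub>L Z') \<cdot>\<^sub>L W" by (simp add: * Z' oL_assoc WV')
    moreover have "norm (pw (Suc k)) = norm T ^ (2 ^ Suc k)"
      using Suc by (simp add: * norm_sadj_square flip: power_add mult_2)
    moreover have "sadj (pw (Suc k))" using Suc by (simp add: * sadj_commute)
    ultimately show ?case by blast
  qed
  obtain n where n: "norm V * norm W < norm T ^ n" using real_arch_pow[OF gt] by blast
  obtain Z' where Z': "norm Z' \<le> 1" "pw n = V \<cdot>\<^sub>L Z' \<cdot>\<^sub>L W" using pw by blast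
  have "norm (V \<cdot>\<^sub>L Z' \<cdot>\<^sub>L W) \<le> norm V * norm Z' * norm W"
    by (meson norm_blinfun_compose mult_right_mono norm_ge_zero order_trans)
  also have "\<dots> \<le> norm V * norm W"
    using mult_mono[OF mult_left_mono[OF Z'(1), of "norm V"] order_refl, of "norm W"] by simp
  finally have "norm T ^ (2 ^ n) < norm T ^ n" using n Z' pw[of n] by simp
  moreover have "norm T ^ n \<le> norm T ^ (2 ^ n)"
    using gt less_exp[of n] by (intro power_increasing) auto
  ultimately show False by simp
qed

context
  fixes A B :: "'h::{real_inner,complete_space} \<Rightarrow>\<^sub>L 'h"
  assumes A: "posop A" and B: "posop B" and AB: "A \<preceq> B"
begin

text \<open>The inequality \<open>A\<^sup>2\<^sup>a \<preceq> B\<^sup>2\<^sup>a\<close> says that \<open>\<parallel>A\<^sup>a x\<parallel> \<le> \<parallel>B\<^sup>a x\<parallel>\<close> for all \<open>x\<close>.\<close>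

lemma powr_quotient_norm:
  assumes "op_powr A (2 * a) \<preceq> op_powr B (2 * a)"
  shows "norm (op_powr A a \<cdot>\<^sub>L op_powr B (- a)) \<le> 1"
proof (rule norm_blinfun_bound)
  fix x
  define y where "y = op_powr B (- a) x"
  have sq: "C (y) \<bullet> C y = (C \<cdot>\<^sub>L C) y \<bullet> y" if "sadj C" for C
    using sadjD[OF that, of "C y" y] by simp
  have "(norm (op_powr A a y))\<^sup>2 = op_powr A (2 * a) y \<bullet> y"
    using sq[OF sadj_powr[OF A, of a]] by (simp add: power2_norm_eq_inner op_powr_add[OF A])
  also have "\<dots> \<le> op_powr B (2 * a) y \<bullet> y" using assms by (simp add: op_le_def)
  also have "\<dots> = (norm (op_powr B a y))\<^sup>2"
    using sq[OF sadj_powr[OF B, of a]] by (simp add: power2_norm_eq_inner op_powr_add[OF B])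
  also have "op_powr B a y = x" unfolding y_def
    using arg_cong[OF op_powr_cancel(1)[OF B, of a], of "\<lambda>C. C x"] by simp
  finally have "norm (op_powr A a y) \<le> norm x" by (rule power2_le_imp_le) simp
  then show "norm ((op_powr A a \<cdot>\<^sub>L op_powr B (- a)) x) \<le> 1 * norm x" by (simp add: y_def)
qed simp

text \<open>Pedersen's argument. For \<open>2 c = a + b\<close> the operator \<open>T = B\<^sup>-\<^sup>c A\<^sup>2\<^sup>c B\<^sup>-\<^sup>c\<close> is similar to the
  product of the two contractions \<open>B\<^sup>-\<^sup>a A\<^sup>a\<close> and \<open>A\<^sup>b B\<^sup>-\<^sup>b\<close>. It is also self-adjoint, so it is
  itself a contraction, and \<open>T \<preceq> 1\<close> is the claim.\<close>

lemma powr_mono_midpoint: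
  assumes s: "op_powr A s \<preceq> op_powr B s" and t: "op_powr A t \<preceq> op_powr B t"
  shows "op_powr A ((s + t) / 2) \<preceq> op_powr B ((s + t) / 2)"
proof -
  define a b c where "a = s / 2" and "b = t / 2" and "c = (s + t) / 4"
  define T where "T = op_powr B (- c) \<cdot>\<^sub>L op_powr A (2 * c) \<cdot>\<^sub>L op_powr B (- c)"
  define Z where "Z = (op_powr B (- a) \<cdot>\<^sub>L op_powr A a) \<cdot>\<^sub>L (op_powr A b \<cdot>\<^sub>L op_powr B (- b))"
  have "norm (op_powr A a \<cdot>\<^sub>L op_powr B (- a)) \<le> 1" "norm (op_powr A b \<cdot>\<^sub>L op_powr B (- b)) \<le> 1"
    using s t by (auto intro!: powr_quotient_norm simp: a_def b_def)
  moreover have "norm (op_powr B (- a) \<cdot>\<^sub>L op_powr A a) \<le> norm (op_powr A a \<cdot>\<^sub>L op_powr B (- a))"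
    by (rule norm_le_adjoint) (simp add: sadjD[OF sadj_powr[OF A]] sadjD[OF sadj_powr[OF B]])
  ultimately have "norm (op_powr B (- a) \<cdot>\<^sub>L op_powr A a) * norm (op_powr A b \<cdot>\<^sub>L op_powr B (- b)) \<le> 1 * 1"
    by (intro mult_mono) auto
  then have Z: "norm Z \<le> 1" unfolding Z_def
    using order_trans[OF norm_blinfun_compose] by fastforce
  have "T = op_powr B (a - c) \<cdot>\<^sub>L Z \<cdot>\<^sub>L op_powr B (b - c)"
  proof -
    have "op_powr B (a - c) \<cdot>\<^sub>L Z \<cdot>\<^sub>L op_powr B (b - c) = (op_powr B (a - c) \<cdot>\<^sub>L op_powr B (- a)) \<cdot>\<^sub>L
      (op_powr A a \<cdot>\<^sub>L op_powr A b) \<cdot>\<^sub>L (op_powr B (- b) \<cdot>\<^sub>L op_powr B (b - c))" by (simp add: Z_def oL_assoc)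
    also have "\<dots> = op_powr B (a - c + - a) \<cdot>\<^sub>L op_powr A (a + b) \<cdot>\<^sub>L op_powr B (- b + (b - c))"
      by (simp only: op_powr_add[OF A] op_powr_add[OF B])
    also have "a - c + - a = - c" by simp
    also have "- b + (b - c) = - c" by simp
    also have "a + b = 2 * c" by (simp add: a_def b_def c_def)
    also have "op_powr B (- c) \<cdot>\<^sub>L op_powr A (2 * c) \<cdot>\<^sub>L op_powr B (- c) = T" by (simp add: T_def)
    finally show ?thesis ..
  qed
  moreover have "op_powr B (b - c) \<cdot>\<^sub>L op_powr B (a - c) = id_blinfun"
  proof -
    have "b - c + (a - c) = 0" by (simp add: a_def b_def c_def field_simps)
    then show ?thesis by (simp only: op_powr_add[OF B] op_powr_zero[OF B])
  qed
  moreover have sT: "sadj T" unfolding T_def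
    by (intro sadj_intros sadj_powr A B)
  ultimately have "norm T \<le> 1" using Z by (intro norm_sadj_similar_le_1[of T]) auto
  then have "T \<preceq> 1 *\<^sub>R id_blinfun" by (meson op_le_norm op_le_scalar op_le_trans)
  from op_le_cong[OF this sadj_powr[OF B, of c]]
  have "op_powr B c \<cdot>\<^sub>L T \<cdot>\<^sub>L op_powr B c \<preceq> op_powr B (2 * c)" by (simp add: op_powr_add B oL_simps)
  moreover have "op_powr B c \<cdot>\<^sub>L T \<cdot>\<^sub>L op_powr B c = op_powr A (2 * c)" by (simp add: T_def oL_assoc B)
  moreover have "2 * c = (s + t) / 2" by (simp add: c_def)
  ultimately show ?thesis by (simp only:)
qed

lemma powr_mono_dyadic: "j \<le> 2 ^ k \<Longrightarrow> op_powr A (real j / 2 ^ k) \<preceq> op_powr B (real j / 2 ^ k)"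
proof (induction k arbitrary: j)
  case 0
  then have "j = 0 \<or> j = 1" by auto
  then show ?case by (auto simp: op_powr_zero op_powr_one A B AB)
next
  case (Suc k)
  show ?case
  proof (cases "even j")
    case True
    then obtain i where "j = 2 * i" by blast
    then show ?thesis using Suc.IH[of i] Suc.prems by simp
  next
    case False
    then obtain i where i: "j = 2 * i + 1" by (blast elim: oddE)
    then have "i + 1 \<le> 2 ^ k" using Suc.prems by auto
    from powr_mono_midpoint[OF Suc.IH[of i] Suc.IH[OF this]] this
    have "op_powr A ((real i / 2 ^ k + real (i + 1) / 2 ^ k) / 2) \<preceq> op_powr B ((real i / 2 ^ k + real (i + 1) / 2 ^ k) / 2)"
      by simp
    moreover have "(real i / 2 ^ k + real (i + 1) / 2 ^ k) / 2 = real j / 2 ^ Suc k"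
      by (simp add: i field_simps)
    ultimately show ?thesis by (simp only:)
  qed
qed

text \<open>By the midpoint lemma the inequality holds for dyadic exponents, and both sides are continuous in the
  exponent.\<close>

lemma loewner_heinz:
  assumes t: "0 \<le> t" "t \<le> 1"
  shows "op_powr A t \<preceq> op_powr B t"
proof -
  define u where "u k = real (nat \<lfloor>2 ^ k * t\<rfloor>) / 2 ^ k" for k :: nat
  have u: "t - 1 / 2 ^ k \<le> u k" "u k \<le> t" "0 \<le> u k" for k
  proof -
    define N :: real where "N = 2 ^ k"
    have N: "N > 0" by (simp add: N_def)
    have "0 \<le> N * t" using N t by simp
    then have "real (nat \<lfloor>N * t\<rfloor>) = of_int \<lfloor>N * t\<rfloor>" by simp
    then have *: "u k = of_int \<lfloor>N * t\<rfloor> / N" by (simp only: u_def N_def)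
    show "0 \<le> u k" by (simp add: u_def)
    show "u k \<le> t" unfolding *
      using of_int_floor_le[of "N * t"] N by (simp add: pos_divide_le_eq mult.commute)
    have "t \<le> (of_int \<lfloor>N * t\<rfloor> + 1) / N"
      using real_of_int_floor_add_one_ge[of "N * t"] N by (simp add: pos_le_divide_eq mult.commute)
    then show "t - 1 / 2 ^ k \<le> u k" unfolding * N_def[symmetric] by (simp add: add_divide_distrib)
  qed
  have lim: "(\<lambda>k. op_powr C (u k)) \<longlonglongrightarrow> op_powr C t" if C: "posop C" for C :: "'h \<Rightarrow>\<^sub>L 'h"
  proof -
    obtain R where R: "R \<ge> 0" "bnd R C" using C by (rule posop_bnd)
    have "norm (op_powr C (u k) - op_powr C t) \<le> exp R * R * (1 / 2) ^ k" for k
    proof -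
      have "norm (op_powr C (u k) - op_powr C t) \<le> exp R * R * \<bar>u k - t\<bar>"
        by (rule op_powr_Lipschitz[OF R(2,1) u(3) order_trans[OF u(2) t(2)] t])
      also have "\<dots> \<le> exp R * R * (1 / 2) ^ k"
      proof (rule mult_left_mono)
        have "\<bar>u k - t\<bar> \<le> 1 / 2 ^ k" using u(1,2)[of k] by linarith
        then show "\<bar>u k - t\<bar> \<le> (1 / 2) ^ k" by (simp only: power_one_over)
      qed (use R(1) in simp)
      finally show ?thesis .
    qed
    then have ev: "\<forall>\<^sub>F k in sequentially. norm (op_powr C (u k) - op_powr C t) \<le> exp R * R * (1 / 2) ^ k"
      by (intro always_eventually allI)
    have "(\<lambda>k. (1 / 2 :: real) ^ k) \<longlonglongrightarrow> 0" by (rule LIMSEQ_realpow_zero) auto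
    from tendsto_mult_right_zero[OF this, of "exp R * R"]
    show ?thesis by (rule LIM_zero_cancel[OF Lim_null_comparison[OF ev]])
  qed
  have "op_powr A (u k) \<preceq> op_powr B (u k)" for k
  proof -
    have "nat \<lfloor>2 ^ k * t\<rfloor> \<le> 2 ^ k"
    proof -
      have "u k \<le> 1" using u(2)[of k] t by linarith
      then have "real (nat \<lfloor>2 ^ k * t\<rfloor>) \<le> real (2 ^ k)" by (simp add: u_def)
      then show ?thesis by (simp only: of_nat_le_iff)
    qed
    then show ?thesis unfolding u_def by (rule powr_mono_dyadic)
  qed
  then show ?thesis by (rule op_le_lim[OF lim[OF A] lim[OF B]])
qed

end

section \<open>The Thompson metric\<close>

abbreviation sqr :: "('h::real_normed_vector \<Rightarrow>\<^sub>L 'h) \<Rightarrow> ('h \<Rightarrow>\<^sub>L 'h)" where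
  "sqr A \<equiv> op_powr A (1/2)"

abbreviation isqr :: "('h::real_normed_vector \<Rightarrow>\<^sub>L 'h) \<Rightarrow> ('h \<Rightarrow>\<^sub>L 'h)" where
  "isqr A \<equiv> op_powr A (- (1/2))"

lemma sqr_cancel:
  fixes A :: "'h::{real_inner,complete_space} \<Rightarrow>\<^sub>L 'h"
  assumes "posop A"
  shows "sqr A \<cdot>\<^sub>L isqr A = id_blinfun" "isqr A \<cdot>\<^sub>L sqr A = id_blinfun"
    "sqr A \<cdot>\<^sub>L (isqr A \<cdot>\<^sub>L B) = B" "isqr A \<cdot>\<^sub>L (sqr A \<cdot>\<^sub>L B) = B"
    "sqr A \<cdot>\<^sub>L sqr A = A" "sqr A \<cdot>\<^sub>L (sqr A \<cdot>\<^sub>L B) = A \<cdot>\<^sub>L B"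
    "isqr A \<cdot>\<^sub>L (A \<cdot>\<^sub>L isqr A) = id_blinfun"
    "isqr A \<cdot>\<^sub>L (isqr A \<cdot>\<^sub>L (A \<cdot>\<^sub>L B)) = B"
proof -
  show 1: "sqr A \<cdot>\<^sub>L isqr A = id_blinfun" "isqr A \<cdot>\<^sub>L sqr A = id_blinfun" "sqr A \<cdot>\<^sub>L sqr A = A"
    using assms by (simp_all add: op_powr_add op_powr_zero op_powr_one)
  show 2: "sqr A \<cdot>\<^sub>L (isqr A \<cdot>\<^sub>L B) = B" "isqr A \<cdot>\<^sub>L (sqr A \<cdot>\<^sub>L B) = B"
    "sqr A \<cdot>\<^sub>L (sqr A \<cdot>\<^sub>L B) = A \<cdot>\<^sub>L B" for B
    by (simp_all only: oL_assoc[symmetric] 1 oL_id)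
  have "isqr A \<cdot>\<^sub>L (A \<cdot>\<^sub>L B) = sqr A \<cdot>\<^sub>L B" for B by (simp only: 2 flip: 2(3))
  note 3 = this
  show "isqr A \<cdot>\<^sub>L (A \<cdot>\<^sub>L isqr A) = id_blinfun" "isqr A \<cdot>\<^sub>L (isqr A \<cdot>\<^sub>L (A \<cdot>\<^sub>L B)) = B"
    by (simp_all only: 1 2 3)
qed

lemma op_le_antisym:
  fixes A B :: "'h::{real_inner,complete_space} \<Rightarrow>\<^sub>L 'h"
  assumes "sadj A" "sadj B" "A \<preceq> B" "B \<preceq> A"
  shows "A = B"
proof -
  have "spec_in 0 0 (A - B)" using assms
    by (auto simp: spec_in_def sadj_intros op_le_def ap_simps inner_simps)
  from spec_in_norm_le[OF this, of 0] show ?thesis by simp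
qed

text \<open>Taking logarithms and exponentials translates between a norm bound and an order bound.\<close>

lemma norm_op_log_le_iff:
  fixes C :: "'h::{real_inner,complete_space} \<Rightarrow>\<^sub>L 'h"
  assumes C: "posop C" and r: "0 \<le> r"
  shows "norm (op_log C) \<le> r \<longleftrightarrow> bnd r C"
proof
  assume "bnd r C"
  then show "norm (op_log C) \<le> r" unfolding bnd_def op_log_def
    by (rule norm_cfc_le[OF _ cont_ln_exp r abs_ln_le])
next
  assume n: "norm (op_log C) \<le> r"
  obtain R where R: "R \<ge> 0" "bnd R C" using C by (rule posop_bnd)
  note C' = R(2)[unfolded bnd_def]
  define L where "L = op_log C"
  have sL: "sadj L" unfolding L_def op_log_def by (rule sadj_cfc[OF C' cont_ln_exp])
  have "L \<preceq> r *\<^sub>R id_blinfun"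
    using op_le_norm[of L] op_le_scalar[OF n] unfolding L_def by (rule op_le_trans)
  moreover have "- L \<preceq> r *\<^sub>R id_blinfun"
    using op_le_norm[of "- L"] op_le_scalar[OF n] unfolding L_def norm_minus_cancel by (rule op_le_trans)
  then have "(- r) *\<^sub>R id_blinfun \<preceq> L"
    unfolding op_le_def by (auto simp: ap_simps minus_le_iff)
  ultimately have spL: "spec_in (- r) r L" using sL by (simp add: spec_in_def)
  have e: "cfc exp L = C"
  proof -
    have "cfc exp L = cfc (\<lambda>x. exp (ln x)) C" unfolding L_def op_log_def
    proof (rule cfc_compose[OF C' cont_ln_exp])
      show "continuous_on {-R..R} (exp :: real \<Rightarrow> real)" by (intro continuous_intros)
      show "- R \<le> ln x \<and> ln x \<le> R" if "x \<in> {exp (- R)..exp R}" for x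
        using abs_ln_le[OF that] by (auto simp: abs_le_iff)
    qed
    also have "\<dots> = cfc (\<lambda>x. x) C" by (rule cfc_cong[OF C']) (simp add: exp_Icc_pos)
    finally show ?thesis by (simp add: cfc_ident[OF C'])
  qed
  have "spec_in (exp (- r)) (exp r) (cfc exp L)"
    by (rule spec_in_cfc[OF spL]) (auto intro!: continuous_intros)
  then show "bnd r C" by (simp add: e bnd_def)
qed

text \<open>The Thompson distance in terms of the order. All further properties of the metric follow from this
  description.\<close>

lemma thompson_le_iff:
  fixes A B :: "'h::{real_inner,complete_space} \<Rightarrow>\<^sub>L 'h"
  assumes A: "posop A" and B: "posop B" and r: "0 \<le> r"
  shows "thompson_dist A B \<le> r \<longleftrightarrow> exp (- r) *\<^sub>R A \<preceq> B \<and> B \<preceq> exp r *\<^sub>R A"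
proof -
  define C where "C = isqr A \<cdot>\<^sub>L B \<cdot>\<^sub>L isqr A"
  have pC: "posop C" unfolding C_def using A B by (rule posop_cong)
  have up: "sqr A \<cdot>\<^sub>L C \<cdot>\<^sub>L sqr A = B" "sqr A \<cdot>\<^sub>L (s *\<^sub>R id_blinfun) \<cdot>\<^sub>L sqr A = s *\<^sub>R A" for s
    by (simp_all add: C_def oL_assoc sqr_cancel[OF A] oL_simps)
  have down: "isqr A \<cdot>\<^sub>L (s *\<^sub>R A) \<cdot>\<^sub>L isqr A = s *\<^sub>R id_blinfun" for s
    by (simp add: oL_simps oL_assoc sqr_cancel[OF A])
  have 1: "s *\<^sub>R id_blinfun \<preceq> C \<longleftrightarrow> s *\<^sub>R A \<preceq> B" for s
    using op_le_cong[OF _ sadj_powr[OF A, of "1/2"], of "s *\<^sub>R id_blinfun" C]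
      op_le_cong[OF _ sadj_powr[OF A, of "- (1/2)"], of "s *\<^sub>R A" B]
    by (auto simp only: up down C_def[symmetric])
  have 2: "C \<preceq> s *\<^sub>R id_blinfun \<longleftrightarrow> B \<preceq> s *\<^sub>R A" for s
    using op_le_cong[OF _ sadj_powr[OF A, of "1/2"], of C "s *\<^sub>R id_blinfun"]
      op_le_cong[OF _ sadj_powr[OF A, of "- (1/2)"], of B "s *\<^sub>R A"]
    by (auto simp only: up down C_def[symmetric])
  have "thompson_dist A B \<le> r \<longleftrightarrow> bnd r C"
    using norm_op_log_le_iff[OF pC r] by (simp add: thompson_dist_def C_def)
  then show ?thesis using posop_sadj[OF pC] by (simp add: bnd_def spec_in_def 1 2)
qed

lemma thompson_nonneg [simp]: "0 \<le> thompson_dist A B"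
  by (simp add: thompson_dist_def)

lemma thompson_leD:
  fixes A B :: "'h::{real_inner,complete_space} \<Rightarrow>\<^sub>L 'h"
  assumes "posop A" "posop B" "thompson_dist A B \<le> r"
  shows "exp (- r) *\<^sub>R A \<preceq> B" "B \<preceq> exp r *\<^sub>R A"
  using thompson_le_iff[OF assms(1,2), of r] assms(3) order_trans[OF thompson_nonneg assms(3)] by auto

lemma thompson_leD':
  fixes A B :: "'h::{real_inner,complete_space} \<Rightarrow>\<^sub>L 'h"
  assumes "posop A" "posop B" "thompson_dist A B \<le> r"
  shows "A \<preceq> exp r *\<^sub>R B"
  using op_le_scaleR[OF thompson_leD(1)[OF assms], of "exp r"] by (simp flip: exp_add)

lemma thompson_leI:
  fixes A B :: "'h::{real_inner,complete_space} \<Rightarrow>\<^sub>L 'h"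
  assumes "posop A" "posop B" "0 \<le> r" "A \<preceq> exp r *\<^sub>R B" "B \<preceq> exp r *\<^sub>R A"
  shows "thompson_dist A B \<le> r"
proof -
  have "exp (- r) *\<^sub>R A \<preceq> B" using op_le_scaleR[OF assms(4), of "exp (- r)"] by (simp flip: exp_add)
  then show ?thesis using thompson_le_iff assms by blast
qed

lemma thompson_sym:
  fixes A B :: "'h::{real_inner,complete_space} \<Rightarrow>\<^sub>L 'h"
  assumes "posop A" "posop B"
  shows "thompson_dist A B = thompson_dist B A"
proof -
  have "thompson_dist B A \<le> thompson_dist A B" if "posop A" "posop B" for A B :: "'h \<Rightarrow>\<^sub>L 'h"
    using thompson_leI[OF that(2,1) thompson_nonneg thompson_leD(2)[OF that order_refl] thompson_leD'[OF that order_refl]] .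
  then show ?thesis using assms by (intro antisym) auto
qed

lemma thompson_triangle:
  fixes A B C :: "'h::{real_inner,complete_space} \<Rightarrow>\<^sub>L 'h"
  assumes "posop A" "posop B" "posop C"
  shows "thompson_dist A C \<le> thompson_dist A B + thompson_dist B C"
proof -
  have *: "X \<preceq> exp (r + s) *\<^sub>R Z" if "X \<preceq> exp r *\<^sub>R Y" "Y \<preceq> exp s *\<^sub>R Z" for X Y Z :: "'h \<Rightarrow>\<^sub>L 'h" and r s
    using op_le_trans[OF that(1) op_le_scaleR[OF that(2), of "exp r"]] by (simp add: exp_add)
  show ?thesis
  proof (rule thompson_leI[OF assms(1,3)])
    show "A \<preceq> exp (thompson_dist A B + thompson_dist B C) *\<^sub>R C"
      by (rule *[OF thompson_leD'[OF assms(1,2) order_refl] thompson_leD'[OF assms(2,3) order_refl]])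
    have "C \<preceq> exp (thompson_dist B C + thompson_dist A B) *\<^sub>R A"
      by (rule *[OF thompson_leD(2)[OF assms(2,3) order_refl] thompson_leD(2)[OF assms(1,2) order_refl]])
    then show "C \<preceq> exp (thompson_dist A B + thompson_dist B C) *\<^sub>R A" by (simp only: add.commute)
  qed auto
qed

lemma thompson_self:
  fixes A :: "'h::{real_inner,complete_space} \<Rightarrow>\<^sub>L 'h"
  assumes "posop A" shows "thompson_dist A A = 0"
  using thompson_leI[OF assms assms, of 0] by (simp add: antisym)

lemma thompson_eq_0_iff:
  fixes A B :: "'h::{real_inner,complete_space} \<Rightarrow>\<^sub>L 'h"
  assumes "posop A" "posop B"
  shows "thompson_dist A B = 0 \<longleftrightarrow> A = B"
proof
  assume "thompson_dist A B = 0"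
  then have "thompson_dist A B \<le> 0" by simp
  from thompson_leD[OF assms this] show "A = B"
    using assms by (intro op_le_antisym) (auto intro: posop_sadj)
qed (use thompson_self assms in auto)

text \<open>The Thompson metric and the norm are comparable on bounded sets.\<close>

lemma bnd_dist:
  fixes A B :: "'h::{real_inner,complete_space} \<Rightarrow>\<^sub>L 'h"
  assumes A: "bnd R A" and B: "posop B" and d: "thompson_dist A B \<le> r"
  shows "bnd (R + r) B"
proof -
  note pA = bnd_posop[OF A]
  have "exp (- r) *\<^sub>R (exp (- R) *\<^sub>R id_blinfun) \<preceq> exp (- r) *\<^sub>R A" "exp r *\<^sub>R A \<preceq> exp r *\<^sub>R (exp R *\<^sub>R id_blinfun)"
    using A by (auto simp only: bnd_def spec_in_def intro!: op_le_scaleR exp_ge_zero)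
  from op_le_trans[OF this(1) thompson_leD(1)[OF pA B d]] op_le_trans[OF thompson_leD(2)[OF pA B d] this(2)]
  show ?thesis using B by (simp add: bnd_def spec_in_def posop_sadj add.commute flip: exp_add)
qed

lemma thompson_bnd:
  fixes A B :: "'h::{real_inner,complete_space} \<Rightarrow>\<^sub>L 'h"
  assumes A: "bnd R A" and B: "bnd S B" and "0 \<le> R + S"
  shows "thompson_dist A B \<le> R + S"
proof -
  have *: "X \<preceq> exp (r + s) *\<^sub>R Y" if "bnd r X" "bnd s Y" for X Y :: "'h \<Rightarrow>\<^sub>L 'h" and r s
  proof -
    have "X \<preceq> exp r *\<^sub>R id_blinfun" "exp (- s) *\<^sub>R id_blinfun \<preceq> Y"
      using that by (auto simp: bnd_def spec_in_def)
    from op_le_trans[OF this(1)] op_le_scaleR[OF this(2), of "exp (r + s)"]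
    show ?thesis by (simp flip: exp_add)
  qed
  show ?thesis using *[OF A B] *[OF B A] assms
    by (intro thompson_leI bnd_posop[OF A] bnd_posop[OF B]) (auto simp: add.commute)
qed

lemma norm_diff_le_thompson:
  fixes A B :: "'h::{real_inner,complete_space} \<Rightarrow>\<^sub>L 'h"
  assumes A: "bnd R A" and B: "posop B" and d: "thompson_dist A B \<le> r"
  shows "norm (B - A) \<le> exp R * (exp r - 1)"
proof -
  note pA = bnd_posop[OF A]
  have r: "0 \<le> r" using d thompson_nonneg order_trans by blast
  have AR: "A \<preceq> exp R *\<^sub>R id_blinfun" using A by (simp add: bnd_def spec_in_def)
  define c where "c = exp R * (exp r - 1)"
  have e: "1 - exp (- r) \<le> exp r - 1"
  proof -
    have "2 \<le> exp r + exp (- r)"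
      using exp_ge_add_one_self[of r] exp_ge_add_one_self[of "- r"] by linarith
    then show ?thesis by linarith
  qed
  have Ax: "0 \<le> A x \<bullet> x" "A x \<bullet> x \<le> exp R * (x \<bullet> x)" for x
  proof -
    have "exp (- R) * (x \<bullet> x) \<le> A x \<bullet> x" using A by (simp add: bnd_def spec_in_def op_le_def ap_simps)
    then show "0 \<le> A x \<bullet> x" by (meson exp_ge_zero inner_ge_zero mult_nonneg_nonneg order_trans)
    show "A x \<bullet> x \<le> exp R * (x \<bullet> x)" using AR by (simp add: op_le_def ap_simps)
  qed
  have B': "exp (- r) * (A x \<bullet> x) \<le> B x \<bullet> x" "B x \<bullet> x \<le> exp r * (A x \<bullet> x)" for x
    using thompson_leD[OF pA B d] by (auto simp: op_le_def ap_simps)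
  have up: "(B - A) x \<bullet> x \<le> c * (x \<bullet> x)" for x
  proof -
    have "(exp r - 1) * (A x \<bullet> x) \<le> (exp r - 1) * (exp R * (x \<bullet> x))"
      using r by (intro mult_left_mono Ax) auto
    then show ?thesis using B'(2)[of x] by (simp add: c_def ap_simps inner_simps algebra_simps)
  qed
  have lo: "- c * (x \<bullet> x) \<le> (B - A) x \<bullet> x" for x
  proof -
    have "(1 - exp (- r)) * (A x \<bullet> x) \<le> (exp r - 1) * (A x \<bullet> x)" using e Ax(1) by (intro mult_right_mono)
    also have "\<dots> \<le> (exp r - 1) * (exp R * (x \<bullet> x))"
      using r by (intro mult_left_mono Ax) auto
    finally show ?thesis using B'(1)[of x] by (simp add: c_def ap_simps inner_simps algebra_simps)
  qed
  have "spec_in (- c) c (B - A)"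
    unfolding spec_in_def op_le_def using up lo posop_sadj[OF pA] posop_sadj[OF B]
    by (auto simp: ap_simps sadj_intros)
  moreover have "c \<ge> 0" using r by (simp add: c_def)
  ultimately show ?thesis using spec_in_norm_le[of "- c" c "B - A" c] by (simp add: c_def)
qed

lemma thompson_le_norm:
  fixes A B :: "'h::{real_inner,complete_space} \<Rightarrow>\<^sub>L 'h"
  assumes m: "m > 0" and A: "sadj A" "m *\<^sub>R id_blinfun \<preceq> A" and B: "sadj B" "m *\<^sub>R id_blinfun \<preceq> B"
  shows "thompson_dist A B \<le> norm (A - B) / m"
proof -
  define r where "r = norm (A - B) / m"
  have r: "0 \<le> r" using m by (simp add: r_def)
  have *: "X \<preceq> exp r *\<^sub>R Y" if X: "norm (X - Y) = m * r" and Y: "m *\<^sub>R id_blinfun \<preceq> Y" for X Y :: "'h \<Rightarrow>\<^sub>L 'h"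
  proof -
    have "0 \<preceq> m *\<^sub>R (id_blinfun :: 'h \<Rightarrow>\<^sub>L 'h)" using m by (simp add: op_le_def ap_simps)
    then have Y0: "0 \<preceq> Y" using Y by (rule op_le_trans)
    have "X \<preceq> Y + (m * r) *\<^sub>R id_blinfun" using norm_op_le[of X Y] X by simp
    also have "\<dots> \<preceq> Y + r *\<^sub>R Y"
      using op_le_add[OF op_le_refl op_le_scaleR[OF Y r]] by (simp add: mult.commute)
    also have "\<dots> = (1 + r) *\<^sub>R Y" by (simp add: scaleR_left_distrib)
    also have "\<dots> \<preceq> exp r *\<^sub>R Y"
      using Y0 exp_ge_add_one_self[of r] by (auto simp: op_le_def ap_simps intro!: mult_right_mono)
    finally show ?thesis .
  qed
  have "norm (A - B) = m * r" "norm (B - A) = m * r" using m by (auto simp: r_def norm_minus_commute)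
  from *[OF this(1) B(2)] *[OF this(2) A(2)] have "thompson_dist A B \<le> r"
    using m A B r by (intro thompson_leI) (auto simp: posop_def)
  then show ?thesis by (simp add: r_def)
qed

lemma sum_scaleR_const: "(\<Sum>i\<in>I. w i *\<^sub>R A) = (\<Sum>i\<in>I. w i) *\<^sub>R A" for A :: "'a::real_vector"
  by (induction I rule: infinite_finite_induct) (auto simp: scaleR_left_distrib)

lemma sadj_sum:
  "(\<And>i. i \<in> I \<Longrightarrow> sadj (A i)) \<Longrightarrow> sadj (\<Sum>i\<in>I. A i)"
  by (induction I rule: infinite_finite_induct) (auto simp: sadj_intros)

lemma bnd_convex_sum:
  fixes A :: "'i \<Rightarrow> 'h::{real_inner,complete_space} \<Rightarrow>\<^sub>L 'h"
  assumes "\<And>i. i \<in> I \<Longrightarrow> bnd R (A i)" "\<And>i. i \<in> I \<Longrightarrow> 0 \<le> w i" "(\<Sum>i\<in>I. w i) = 1"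
  shows "bnd R (\<Sum>i\<in>I. w i *\<^sub>R A i)"
proof -
  have "(\<Sum>i\<in>I. w i *\<^sub>R (exp (- R) *\<^sub>R id_blinfun)) \<preceq> (\<Sum>i\<in>I. w i *\<^sub>R A i)"
    "(\<Sum>i\<in>I. w i *\<^sub>R A i) \<preceq> (\<Sum>i\<in>I. w i *\<^sub>R (exp R *\<^sub>R id_blinfun))"
    using assms by (intro op_le_sum op_le_scaleR; simp add: bnd_def spec_in_def)+
  then show ?thesis unfolding sum_scaleR_const assms(3)
    using assms by (auto simp: bnd_def spec_in_def intro!: sadj_sum sadj_intros)
qed

lemma thompson_convex_sum:
  fixes A B :: "'i \<Rightarrow> 'h::{real_inner,complete_space} \<Rightarrow>\<^sub>L 'h"
  assumes "\<And>i. i \<in> I \<Longrightarrow> bnd R (A i)" "\<And>i. i \<in> I \<Longrightarrow> bnd R (B i)"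
    "\<And>i. i \<in> I \<Longrightarrow> 0 \<le> w i" "(\<Sum>i\<in>I. w i) = 1" "0 \<le> r"
    "\<And>i. i \<in> I \<Longrightarrow> thompson_dist (A i) (B i) \<le> r"
  shows "thompson_dist (\<Sum>i\<in>I. w i *\<^sub>R A i) (\<Sum>i\<in>I. w i *\<^sub>R B i) \<le> r"
proof (rule thompson_leI)
  have *: "A i \<preceq> exp r *\<^sub>R B i" "B i \<preceq> exp r *\<^sub>R A i" if "i \<in> I" for i
  proof -
    note p = bnd_posop[OF assms(1)[OF that]] bnd_posop[OF assms(2)[OF that]] assms(6)[OF that]
    show "A i \<preceq> exp r *\<^sub>R B i" by (rule thompson_leD'[OF p])
    show "B i \<preceq> exp r *\<^sub>R A i" by (rule thompson_leD(2)[OF p])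
  qed
  have "(\<Sum>i\<in>I. w i *\<^sub>R A i) \<preceq> (\<Sum>i\<in>I. w i *\<^sub>R (exp r *\<^sub>R B i))"
    by (intro op_le_sum op_le_scaleR *(1) assms(3))
  moreover have "(\<Sum>i\<in>I. w i *\<^sub>R B i) \<preceq> (\<Sum>i\<in>I. w i *\<^sub>R (exp r *\<^sub>R A i))"
    by (intro op_le_sum op_le_scaleR *(2) assms(3))
  moreover have "exp r *\<^sub>R (\<Sum>i\<in>I. w i *\<^sub>R C i) = (\<Sum>i\<in>I. w i *\<^sub>R (exp r *\<^sub>R C i))"
    for C :: "'i \<Rightarrow> 'h \<Rightarrow>\<^sub>L 'h"
    by (simp add: scaleR_sum_right mult.commute)
  ultimately show "(\<Sum>i\<in>I. w i *\<^sub>R A i) \<preceq> exp r *\<^sub>R (\<Sum>i\<in>I. w i *\<^sub>R B i)"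
    "(\<Sum>i\<in>I. w i *\<^sub>R B i) \<preceq> exp r *\<^sub>R (\<Sum>i\<in>I. w i *\<^sub>R A i)"
    by simp_all
  show "posop (\<Sum>i\<in>I. w i *\<^sub>R A i)" "posop (\<Sum>i\<in>I. w i *\<^sub>R B i)"
    by (rule bnd_posop[OF bnd_convex_sum[OF assms(1,3,4)]] bnd_posop[OF bnd_convex_sum[OF assms(2,3,4)]]; assumption)+
qed (rule assms)

section \<open>The weighted geometric mean\<close>

context
  fixes A B :: "'h::{real_inner,complete_space} \<Rightarrow>\<^sub>L 'h"
  assumes A: "posop A" and B: "posop B"
begin

lemma posop_geom_mean: "posop (geom_mean A t B)"
  unfolding geom_mean_def by (intro posop_cong posop_powr A B)

text \<open>With \<open>C = isqr A \<cdot>\<^sub>L sqr B\<close> and its adjoint \<open>D\<close>, the left side is built from a power of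
  \<open>C \<cdot>\<^sub>L D\<close> and the right side from a power of the inverse of \<open>D \<cdot>\<^sub>L C\<close>; and \<open>C\<close> intertwines
  \<open>D \<cdot>\<^sub>L C\<close> and \<open>C \<cdot>\<^sub>L D\<close>.\<close>

lemma geom_mean_sym: "geom_mean A t B = geom_mean B (1 - t) A"
proof -
  define C where "C = isqr A \<cdot>\<^sub>L sqr B"
  define D where "D = sqr B \<cdot>\<^sub>L isqr A"
  define M1 where "M1 = isqr A \<cdot>\<^sub>L B \<cdot>\<^sub>L isqr A"
  define M2 where "M2 = isqr B \<cdot>\<^sub>L A \<cdot>\<^sub>L isqr B"
  define N where "N = D \<cdot>\<^sub>L C"
  have M1: "M1 = C \<cdot>\<^sub>L D" by (simp add: M1_def C_def D_def oL_assoc sqr_cancel[OF B])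
  have iA: "isqr A \<cdot>\<^sub>L isqr A = op_powr A (-1)" using op_powr_add[OF A, of "- (1/2)" "- (1/2)"] by simp
  have N: "N = sqr B \<cdot>\<^sub>L op_powr A (-1) \<cdot>\<^sub>L sqr B"
    using iA by (simp add: N_def C_def D_def oL_assoc flip: iA)
  have pos: "posop M1" "posop M2" "posop N" unfolding M1_def M2_def N
    by (intro posop_cong posop_powr A B)+
  have NM2: "N \<cdot>\<^sub>L M2 = id_blinfun"
    by (simp add: N_def C_def D_def M2_def oL_assoc sqr_cancel[OF B] sqr_cancel[OF A])
  then have M2: "M2 = op_powr N (-1)" by (rule op_powr_inverse_unique[OF pos(3)])
  obtain R1 R2 where "bnd R1 M1" "bnd R2 N" using posop_bnd pos by metis
  then have sp: "spec_in (exp (- max R1 R2)) (exp (max R1 R2)) M1" "spec_in (exp (- max R1 R2)) (exp (max R1 R2)) N"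
    by (auto intro: bnd_mono simp flip: bnd_def)
  have "C \<cdot>\<^sub>L N = M1 \<cdot>\<^sub>L C" by (simp add: N_def M1 oL_assoc)
  from cfc_intertwine[OF sp(2) cont_powr_exp sp(1) this, of t]
  have tw: "C \<cdot>\<^sub>L op_powr N t = op_powr M1 t \<cdot>\<^sub>L C" by (simp add: op_powr_def)
  have Ci: "C \<cdot>\<^sub>L (isqr B \<cdot>\<^sub>L sqr A) = id_blinfun" by (simp add: C_def oL_assoc sqr_cancel[OF A] sqr_cancel[OF B])
  have "op_powr M1 t = C \<cdot>\<^sub>L op_powr N t \<cdot>\<^sub>L (isqr B \<cdot>\<^sub>L sqr A)"
    by (simp only: tw oL_assoc Ci oL_id)
  moreover have "geom_mean A t B = sqr A \<cdot>\<^sub>L op_powr M1 t \<cdot>\<^sub>L sqr A"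
    by (simp add: geom_mean_def M1_def)
  ultimately have L: "geom_mean A t B = sqr B \<cdot>\<^sub>L op_powr N t \<cdot>\<^sub>L (isqr B \<cdot>\<^sub>L A)"
    by (simp add: C_def oL_assoc sqr_cancel[OF A])
  have "op_powr M2 (1 - t) = op_powr N t \<cdot>\<^sub>L op_powr N (-1)"
    by (simp add: M2 op_powr_powr pos op_powr_add)
  also have "op_powr N (-1) = isqr B \<cdot>\<^sub>L A \<cdot>\<^sub>L isqr B" using M2 M2_def by simp
  moreover have "geom_mean B (1 - t) A = sqr B \<cdot>\<^sub>L op_powr M2 (1 - t) \<cdot>\<^sub>L sqr B"
    by (simp add: geom_mean_def M2_def)
  ultimately have "geom_mean B (1 - t) A = sqr B \<cdot>\<^sub>L op_powr N t \<cdot>\<^sub>L (isqr B \<cdot>\<^sub>L A)"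
    by (simp add: oL_assoc sqr_cancel[OF B])
  then show ?thesis using L by simp
qed

lemma geom_mean_scale_right:
  assumes "c > 0"
  shows "geom_mean A t (c *\<^sub>R B) = (c powr t) *\<^sub>R geom_mean A t B"
proof -
  have "op_powr (c *\<^sub>R (isqr A \<cdot>\<^sub>L B \<cdot>\<^sub>L isqr A)) t = (c powr t) *\<^sub>R op_powr (isqr A \<cdot>\<^sub>L B \<cdot>\<^sub>L isqr A) t"
    by (rule op_powr_scaleR[OF posop_cong[OF A B] assms])
  then show ?thesis by (simp add: geom_mean_def oL_simps)
qed

lemma geom_mean_mono_right:
  assumes t: "0 \<le> t" "t \<le> 1" and C: "posop C" "B \<preceq> C"
  shows "geom_mean A t B \<preceq> geom_mean A t C"
  unfolding geom_mean_def
  by (rule op_le_cong[OF loewner_heinz[OF posop_cong[OF A B] posop_cong[OF A C(1)]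
        op_le_cong[OF C(2) sadj_powr[OF A]] t] sadj_powr[OF A]])

end

lemma geom_mean_same:
  fixes A :: "'h::{real_inner,complete_space} \<Rightarrow>\<^sub>L 'h"
  assumes "posop A"
  shows "geom_mean A t A = A"
  using op_powr_powr[OF assms, of 0 t] assms
  by (simp add: geom_mean_def oL_assoc sqr_cancel op_powr_zero)

text \<open>Loewner--Heinz gives monotonicity in the second argument, and the symmetry of the mean carries it over
  to the first one; the scalars come out by homogeneity.\<close>

lemma geom_mean_le:
  fixes A B A' B' :: "'h::{real_inner,complete_space} \<Rightarrow>\<^sub>L 'h"
  assumes pos: "posop A" "posop B" "posop A'" "posop B'" and t: "0 \<le> t" "t \<le> 1"
    and A: "A \<preceq> exp r *\<^sub>R A'" and B: "B \<preceq> exp q *\<^sub>R B'"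
  shows "geom_mean A t B \<preceq> exp ((1 - t) * r + t * q) *\<^sub>R geom_mean A' t B'"
proof -
  have p: "posop (exp r *\<^sub>R A')" "posop (exp q *\<^sub>R B')" using pos by (auto intro: posop_scaleR)
  have "geom_mean A t B \<preceq> geom_mean A t (exp q *\<^sub>R B')"
    by (rule geom_mean_mono_right[OF pos(1,2) t p(2) B])
  also have "\<dots> = exp (t * q) *\<^sub>R geom_mean A t B'"
    by (simp add: geom_mean_scale_right[OF pos(1,4)] powr_def)
  also have "geom_mean A t B' = geom_mean B' (1 - t) A" by (rule geom_mean_sym[OF pos(1,4)])
  also have "exp (t * q) *\<^sub>R geom_mean B' (1 - t) A \<preceq> exp (t * q) *\<^sub>R geom_mean B' (1 - t) (exp r *\<^sub>R A')"
    using t by (intro op_le_scaleR geom_mean_mono_right pos p A) auto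
  also have "geom_mean B' (1 - t) (exp r *\<^sub>R A') = exp ((1 - t) * r) *\<^sub>R geom_mean A' t B'"
    using geom_mean_sym[OF pos(3,4), of t]
    by (simp add: geom_mean_scale_right[OF pos(4,3)] powr_def)
  finally show ?thesis by (simp add: exp_add mult.commute)
qed

text \<open>The Busemann convexity of the Thompson metric along geometric means: monotonicity and
  homogeneity turn the two order bounds into one.\<close>

lemma geom_mean_contract:
  fixes A B A' B' :: "'h::{real_inner,complete_space} \<Rightarrow>\<^sub>L 'h"
  assumes pos: "posop A" "posop B" "posop A'" "posop B'" and t: "0 \<le> t" "t \<le> 1"
  shows "thompson_dist (geom_mean A t B) (geom_mean A' t B')
    \<le> (1 - t) * thompson_dist A A' + t * thompson_dist B B'"
proof (rule thompson_leI)
  show "geom_mean A t B \<preceq> exp ((1 - t) * thompson_dist A A' + t * thompson_dist B B') *\<^sub>R geom_mean A' t B'"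
    by (rule geom_mean_le[OF pos t thompson_leD'[OF pos(1,3) order_refl] thompson_leD'[OF pos(2,4) order_refl]])
  show "geom_mean A' t B' \<preceq> exp ((1 - t) * thompson_dist A A' + t * thompson_dist B B') *\<^sub>R geom_mean A t B"
    by (rule geom_mean_le[OF pos(3,4,1,2) t thompson_leD(2)[OF pos(1,3) order_refl] thompson_leD(2)[OF pos(2,4) order_refl]])
qed (use t in \<open>auto intro: posop_geom_mean pos\<close>)

lemma geom_mean_dist_left:
  fixes A B :: "'h::{real_inner,complete_space} \<Rightarrow>\<^sub>L 'h"
  assumes pos: "posop A" "posop B" and t: "0 \<le> t" "t \<le> 1"
  shows "thompson_dist A (geom_mean A t B) \<le> t * thompson_dist A B"
  using geom_mean_contract[OF pos(1,1) pos t] by (simp add: geom_mean_same pos thompson_self)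

section \<open>First-order expansion of the geometric mean\<close>

lemma tendsto_null_bound:
  fixes f :: "nat \<Rightarrow> 'a::real_normed_vector"
  assumes "\<And>n. norm (f n) \<le> c * norm (g n)" "g \<longlonglongrightarrow> (0::'b::real_normed_vector)"
  shows "f \<longlonglongrightarrow> 0"
proof -
  have "(\<lambda>n. c * norm (g n)) \<longlonglongrightarrow> 0"
    using tendsto_mult_right_zero[OF tendsto_norm_zero[OF assms(2)]] .
  then show ?thesis by (rule Lim_null_comparison[OF always_eventually[OF allI[OF assms(1)]]])
qed

lemma cfc_seq:
  fixes A B :: "nat \<Rightarrow> 'h::{real_inner,complete_space} \<Rightarrow>\<^sub>L 'h"
  assumes f: "continuous_on {m..M} f" and A: "\<And>n. spec_in m M (A n)" and B: "\<And>n. spec_in m M (B n)"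
    and AB: "(\<lambda>n. A n - B n) \<longlonglongrightarrow> 0"
  shows "(\<lambda>n. cfc f (A n) - cfc f (B n)) \<longlonglongrightarrow> 0"
proof (rule tendstoI)
  fix e :: real assume "e > 0"
  obtain d where d: "d > 0" "\<And>A B :: 'h \<Rightarrow>\<^sub>L 'h. spec_in m M A \<Longrightarrow> spec_in m M B \<Longrightarrow> norm (A - B) < d \<Longrightarrow>
      norm (cfc f A - cfc f B) < e"
    using cfc_uniformly_continuous[OF f \<open>e > 0\<close>, where 'h = 'h] by blast
  from tendstoD[OF AB d(1)] show "\<forall>\<^sub>F n in sequentially. dist (cfc f (A n) - cfc f (B n)) 0 < e"
    by eventually_elim (simp add: d A B)
qed

lemma oL_seq:
  fixes A A' B B' :: "nat \<Rightarrow> 'h::real_normed_vector \<Rightarrow>\<^sub>L 'h"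
  assumes A: "(\<lambda>n. A n - A' n) \<longlonglongrightarrow> 0" and B: "(\<lambda>n. B n - B' n) \<longlonglongrightarrow> 0"
    and bd: "\<And>n. norm (B n) \<le> b" "\<And>n. norm (A' n) \<le> a"
  shows "(\<lambda>n. A n \<cdot>\<^sub>L B n - A' n \<cdot>\<^sub>L B' n) \<longlonglongrightarrow> 0"
proof -
  have 1: "(\<lambda>n. (A n - A' n) \<cdot>\<^sub>L B n) \<longlonglongrightarrow> 0"
  proof (rule tendsto_null_bound[OF _ A])
    fix n
    have "norm ((A n - A' n) \<cdot>\<^sub>L B n) \<le> norm (A n - A' n) * norm (B n)" by (rule norm_blinfun_compose)
    also have "\<dots> \<le> norm (A n - A' n) * b" by (intro mult_left_mono bd) auto
    finally show "norm ((A n - A' n) \<cdot>\<^sub>L B n) \<le> b * norm (A n - A' n)" by (simp only: mult.commute)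
  qed
  have 2: "(\<lambda>n. A' n \<cdot>\<^sub>L (B n - B' n)) \<longlonglongrightarrow> 0"
  proof (rule tendsto_null_bound[OF _ B])
    fix n
    have "norm (A' n \<cdot>\<^sub>L (B n - B' n)) \<le> norm (A' n) * norm (B n - B' n)" by (rule norm_blinfun_compose)
    also have "\<dots> \<le> a * norm (B n - B' n)" by (intro mult_right_mono bd) auto
    finally show "norm (A' n \<cdot>\<^sub>L (B n - B' n)) \<le> a * norm (B n - B' n)" .
  qed
  show ?thesis using tendsto_add[OF 1 2] by (simp add: oL_simps)
qed

lemma bnd_norm:
  fixes A :: "'h::{real_inner,complete_space} \<Rightarrow>\<^sub>L 'h"
  assumes "bnd R A" "0 \<le> R"
  shows "norm A \<le> exp R"
  by (rule spec_in_norm_le[OF assms(1)[unfolded bnd_def]]) (use assms(2) in auto)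

lemma norm_cong_le:
  fixes A X :: "'h::{real_inner,complete_space} \<Rightarrow>\<^sub>L 'h"
  assumes X: "posop X"
  shows "norm (sqr X \<cdot>\<^sub>L A \<cdot>\<^sub>L sqr X) \<le> norm X * norm A"
proof -
  have "norm (sqr X \<cdot>\<^sub>L A \<cdot>\<^sub>L sqr X) \<le> norm (sqr X \<cdot>\<^sub>L A) * norm (sqr X)" by (rule norm_blinfun_compose)
  also have "\<dots> \<le> norm (sqr X) * norm A * norm (sqr X)"
    by (intro mult_right_mono norm_blinfun_compose) auto
  also have "\<dots> = (norm (sqr X) * norm (sqr X)) * norm A" by (simp only: mult_ac)
  also have "norm (sqr X) * norm (sqr X) = norm X"
    by (simp only: norm_sadj_square[OF sadj_powr[OF X], symmetric] sqr_cancel[OF X])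
  finally show ?thesis .
qed

lemma bnd_quotient:
  fixes X A :: "'h::{real_inner,complete_space} \<Rightarrow>\<^sub>L 'h"
  assumes "posop X" "posop A" "thompson_dist X A \<le> r"
  shows "bnd r (isqr X \<cdot>\<^sub>L A \<cdot>\<^sub>L isqr X)"
proof -
  have "0 \<le> r" using assms(3) thompson_nonneg order_trans by blast
  then show ?thesis
    using norm_op_log_le_iff[OF posop_cong[OF assms(1,2)], of r "- (1/2)"] assms(3)
    by (simp add: thompson_dist_def)
qed

lemma log_at_eq: "log_at X A = sqr X \<cdot>\<^sub>L op_log (isqr X \<cdot>\<^sub>L A \<cdot>\<^sub>L isqr X) \<cdot>\<^sub>L sqr X"
  by (simp add: log_at_def)

lemma geom_mean_eq: "geom_mean X t A = sqr X \<cdot>\<^sub>L op_powr (isqr X \<cdot>\<^sub>L A \<cdot>\<^sub>L isqr X) t \<cdot>\<^sub>L sqr X"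
  by (simp add: geom_mean_def)

lemma norm_log_at_le:
  fixes X A :: "'h::{real_inner,complete_space} \<Rightarrow>\<^sub>L 'h"
  assumes "posop X"
  shows "norm (log_at X A) \<le> norm X * thompson_dist X A"
  using norm_cong_le[OF assms, of "op_log (isqr X \<cdot>\<^sub>L A \<cdot>\<^sub>L isqr X)"]
  by (simp add: log_at_eq thompson_dist_def)

lemma sadj_log_at:
  fixes X A :: "'h::{real_inner,complete_space} \<Rightarrow>\<^sub>L 'h"
  assumes "posop X" "posop A"
  shows "sadj (log_at X A)"
proof -
  have "spec_in (exp (- thompson_dist X A)) (exp (thompson_dist X A)) (isqr X \<cdot>\<^sub>L A \<cdot>\<^sub>L isqr X)"
    using bnd_quotient[OF assms order_refl] by (simp only: bnd_def)
  then show ?thesis unfolding log_at_eq op_log_def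
    by (intro sadj_intros(6) sadj_powr assms sadj_cfc[OF _ cont_ln_exp])
qed

text \<open>Joint uniform continuity on bounded sets, in terms of sequences.\<close>

lemma log_at_seq:
  fixes X X' A A' :: "nat \<Rightarrow> 'h::{real_inner,complete_space} \<Rightarrow>\<^sub>L 'h"
  assumes R: "0 \<le> R" and X: "\<And>n. bnd R (X n)" "\<And>n. bnd R (X' n)"
    and A: "\<And>n. bnd R (A n)" "\<And>n. bnd R (A' n)"
    and XX: "(\<lambda>n. X n - X' n) \<longlonglongrightarrow> 0" and AA: "(\<lambda>n. A n - A' n) \<longlonglongrightarrow> 0"
  shows "(\<lambda>n. log_at (X n) (A n) - log_at (X' n) (A' n)) \<longlonglongrightarrow> 0"
proof -
  have pw: "(\<lambda>n. op_powr (X n) s - op_powr (X' n) s) \<longlonglongrightarrow> 0" for s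
    unfolding op_powr_def using X
    by (intro cfc_seq[OF cont_powr_exp _ _ XX]) (auto simp: bnd_def)
  define b where "b = exp R * exp R * exp R"
  have e1: "1 \<le> exp R" using R by simp
  have pwb: "norm (op_powr C s) \<le> exp R" if "bnd R C" "\<bar>s\<bar> \<le> 1" for C :: "'h \<Rightarrow>\<^sub>L 'h" and s
  proof -
    have "bnd R (op_powr C s)"
      by (rule bnd_mono[OF bnd_op_powr[OF that(1)]]) (use R that mult_right_mono[of "\<bar>s\<bar>" 1 R] in auto)
    then show ?thesis using R by (rule bnd_norm)
  qed
  note nb = pwb[OF X(1)] pwb[OF X(2)] bnd_norm[OF A(1) R] bnd_norm[OF A(2) R]
  have m2: "norm (C \<cdot>\<^sub>L D) \<le> c * d" if "norm C \<le> c" "norm D \<le> d" for C D :: "'h \<Rightarrow>\<^sub>L 'h" and c d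
    using order_trans[OF norm_blinfun_compose mult_mono[OF that order_trans[OF norm_ge_zero that(1)] norm_ge_zero]] .
  define Q where "Q n = isqr (X n) \<cdot>\<^sub>L A n \<cdot>\<^sub>L isqr (X n)" for n
  define Q' where "Q' n = isqr (X' n) \<cdot>\<^sub>L A' n \<cdot>\<^sub>L isqr (X' n)" for n
  have "(\<lambda>n. isqr (X n) \<cdot>\<^sub>L A n - isqr (X' n) \<cdot>\<^sub>L A' n) \<longlonglongrightarrow> 0"
    by (rule oL_seq[OF pw AA, where a = "exp R" and b = "exp R"]) (use nb in auto)
  then have QQ: "(\<lambda>n. Q n - Q' n) \<longlonglongrightarrow> 0" unfolding Q_def Q'_def
    by (rule oL_seq[OF _ pw, where a = "exp R * exp R" and b = "exp R"]) (use nb in \<open>auto intro!: m2\<close>)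
  have bQ: "bnd (R + R) (Q n)" "bnd (R + R) (Q' n)" for n
    unfolding Q_def Q'_def
    using bnd_quotient[OF bnd_posop[OF X(1)] bnd_posop[OF A(1)] thompson_bnd[OF X(1) A(1)], of n n]
      bnd_quotient[OF bnd_posop[OF X(2)] bnd_posop[OF A(2)] thompson_bnd[OF X(2) A(2)], of n n] R
    by simp_all
  have lb: "norm (op_log C) \<le> R + R" if "bnd (R + R) C" for C :: "'h \<Rightarrow>\<^sub>L 'h"
    using norm_op_log_le_iff[OF bnd_posop[OF that], of "R + R"] that R by simp
  have "(\<lambda>n. op_log (Q n) - op_log (Q' n)) \<longlonglongrightarrow> 0"
    unfolding op_log_def using bQ by (intro cfc_seq[OF cont_ln_exp _ _ QQ]) (auto simp only: bnd_def)
  then have "(\<lambda>n. sqr (X n) \<cdot>\<^sub>L op_log (Q n) - sqr (X' n) \<cdot>\<^sub>L op_log (Q' n)) \<longlonglongrightarrow> 0"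
    by (rule oL_seq[OF pw, where a = "exp R" and b = "R + R"]) (use nb lb bQ in auto)
  then have "(\<lambda>n. sqr (X n) \<cdot>\<^sub>L op_log (Q n) \<cdot>\<^sub>L sqr (X n) - sqr (X' n) \<cdot>\<^sub>L op_log (Q' n) \<cdot>\<^sub>L sqr (X' n)) \<longlonglongrightarrow> 0"
    by (rule oL_seq[OF _ pw, where a = "exp R * (R + R)" and b = "exp R"]) (use nb lb bQ in \<open>auto intro!: m2\<close>)
  then show ?thesis by (simp only: log_at_eq Q_def Q'_def)
qed

lemma exp_second_order: "\<bar>exp u - 1 - u\<bar> \<le> u\<^sup>2 * exp \<bar>u\<bar>" for u :: real
proof -
  have 1: "0 \<le> exp u - 1 - u" using exp_ge_add_one_self[of u] by linarith
  have "(1 - u) * exp u \<le> exp (- u) * exp u"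
    using exp_ge_add_one_self[of "- u"] by (intro mult_right_mono) auto
  then have "(1 - u) * exp u \<le> 1" by (simp flip: exp_add)
  then have 2: "exp u - 1 \<le> u * exp u" by (simp add: algebra_simps)
  have "u * (exp u - 1) \<le> u\<^sup>2 * exp \<bar>u\<bar>"
  proof (cases "u \<ge> 0")
    case True
    then have "u * (exp u - 1) \<le> u * (u * exp u)" using 2 by (intro mult_left_mono)
    then show ?thesis using True by (simp add: power2_eq_square mult.assoc)
  next
    case False
    have "u * (exp u - 1) = (- u) * (1 - exp u)" by (simp add: algebra_simps)
    also have "\<dots> \<le> (- u) * (- u)" using False 1 by (intro mult_left_mono) auto
    also have "\<dots> \<le> u\<^sup>2 * exp \<bar>u\<bar>"
      using mult_left_mono[of 1 "exp \<bar>u\<bar>" "u\<^sup>2"] by (simp add: power2_eq_square)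
    finally show ?thesis .
  qed
  moreover have "exp u - 1 - u \<le> u * (exp u - 1)" using 2 by (simp add: algebra_simps)
  ultimately show ?thesis using 1 by simp
qed

text \<open>With \<open>C = isqr X \<cdot>\<^sub>L A \<cdot>\<^sub>L isqr X\<close> the remainder is the congruence by \<open>sqr X\<close> of
  \<open>C\<^sup>t - 1 - t log C\<close>, to which the scalar estimate applies with \<open>u = t log C\<close>.\<close>

lemma geom_mean_second_order:
  fixes X A :: "'h::{real_inner,complete_space} \<Rightarrow>\<^sub>L 'h"
  assumes X: "bnd R X" and A: "bnd R A" and R: "0 \<le> R" and t: "0 \<le> t" "t \<le> 1"
  shows "norm (geom_mean X t A - X - t *\<^sub>R log_at X A) \<le> exp R * ((R + R)\<^sup>2 * exp (R + R)) * t\<^sup>2"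
proof -
  define S where "S = R + R"
  have S: "0 \<le> S" using R by (simp add: S_def)
  define C where "C = isqr X \<cdot>\<^sub>L A \<cdot>\<^sub>L isqr X"
  note pX = bnd_posop[OF X]
  have C: "spec_in (exp (- S)) (exp S) C" unfolding C_def S_def bnd_def[symmetric]
    by (rule bnd_quotient[OF pX bnd_posop[OF A] thompson_bnd[OF X A]]) (use R in simp)
  define D where "D = op_powr C t - id_blinfun - t *\<^sub>R op_log C"
  have cl: "continuous_on {exp (- S)..exp S} (\<lambda>x. t * ln x)" by (intro continuous_on_mult_left cont_ln_exp)
  have cp: "continuous_on {exp (- S)..exp S} (\<lambda>x. x powr t - 1)"
    by (intro continuous_on_diff cont_powr_exp continuous_on_const)
  have "D = cfc (\<lambda>x. x powr t - 1 - t * ln x) C"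
    by (simp add: D_def op_powr_def op_log_def cfc_diff[OF C cp cl] cfc_cmult[OF C cont_ln_exp]
        cfc_diff[OF C cont_powr_exp continuous_on_const] cfc_const[OF C])
  moreover have "norm (cfc (\<lambda>x. x powr t - 1 - t * ln x) C) \<le> S\<^sup>2 * exp S * t\<^sup>2"
  proof (rule norm_cfc_le[OF C continuous_on_diff[OF cp cl]])
    fix x assume x: "x \<in> {exp (- S)..exp S}"
    define u where "u = t * ln x"
    have au: "\<bar>u\<bar> \<le> t * S" using abs_ln_le[OF x] t by (simp add: u_def abs_mult mult_left_mono)
    have "t * S \<le> S" using t S mult_right_mono[of t 1 S] by simp
    then have "exp \<bar>u\<bar> \<le> exp S" using au by simp
    moreover have "u\<^sup>2 \<le> (t * S)\<^sup>2" using power_mono[OF au, of 2] by simp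
    ultimately have "u\<^sup>2 * exp \<bar>u\<bar> \<le> (t * S)\<^sup>2 * exp S" by (intro mult_mono) auto
    moreover have "x powr t = exp u" using exp_Icc_pos[OF x] by (simp add: powr_def u_def)
    ultimately show "\<bar>x powr t - 1 - t * ln x\<bar> \<le> S\<^sup>2 * exp S * t\<^sup>2"
      using exp_second_order[of u] by (simp add: u_def[symmetric] power_mult_distrib mult_ac)
  qed simp
  ultimately have D: "norm D \<le> S\<^sup>2 * exp S * t\<^sup>2" by simp
  have "geom_mean X t A - X - t *\<^sub>R log_at X A = sqr X \<cdot>\<^sub>L D \<cdot>\<^sub>L sqr X"
    by (simp add: D_def geom_mean_eq log_at_eq oL_simps sqr_cancel[OF pX] flip: C_def)
  then have "norm (geom_mean X t A - X - t *\<^sub>R log_at X A) \<le> norm X * norm D"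
    using norm_cong_le[OF pX, of D] by simp
  also have "\<dots> \<le> exp R * (S\<^sup>2 * exp S * t\<^sup>2)" using bnd_norm[OF X R] D by (intro mult_mono) auto
  finally show ?thesis by (simp add: S_def mult.assoc)
qed

text \<open>A step of size \<open>t\<close> towards \<open>A\<close>, started near \<open>X\<close>, moves by \<open>t log\<^sub>X A\<close> up to \<open>o(t)\<close>,
  uniformly on bounded sets.\<close>

lemma geom_mean_first_order_seq:
  fixes X X' A :: "nat \<Rightarrow> 'h::{real_inner,complete_space} \<Rightarrow>\<^sub>L 'h"
  assumes R: "0 \<le> R" and X: "\<And>n. bnd R (X n)" "\<And>n. bnd R (X' n)" and A: "\<And>n. bnd R (A n)"
    and XX: "(\<lambda>n. X n - X' n) \<longlonglongrightarrow> 0" and t: "\<And>n. 0 < t n" "\<And>n. t n \<le> 1" "t \<longlonglongrightarrow> 0"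
  shows "(\<lambda>n. (1 / t n) *\<^sub>R (geom_mean (X' n) (t n) (A n) - X' n - t n *\<^sub>R log_at (X n) (A n))) \<longlonglongrightarrow> 0"
proof -
  define c where "c = exp R * ((R + R)\<^sup>2 * exp (R + R))"
  have "(\<lambda>n. (1 / t n) *\<^sub>R (geom_mean (X' n) (t n) (A n) - X' n - t n *\<^sub>R log_at (X' n) (A n))) \<longlonglongrightarrow> 0"
  proof (rule tendsto_null_bound[OF _ t(3)])
    fix n
    have "norm (geom_mean (X' n) (t n) (A n) - X' n - t n *\<^sub>R log_at (X' n) (A n)) \<le> c * (t n)\<^sup>2"
      unfolding c_def using t(1)[of n] t(2)[of n] by (intro geom_mean_second_order X A R) auto
    then have "norm (geom_mean (X' n) (t n) (A n) - X' n - t n *\<^sub>R log_at (X' n) (A n)) / t n \<le> c * (t n)\<^sup>2 / t n"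
      using t(1)[of n] by (intro divide_right_mono) auto
    then show "norm ((1 / t n) *\<^sub>R (geom_mean (X' n) (t n) (A n) - X' n - t n *\<^sub>R log_at (X' n) (A n))) \<le> c * norm (t n)"
      using t(1)[of n] by (simp add: power2_eq_square)
  qed
  moreover have "(\<lambda>n. log_at (X n) (A n) - log_at (X' n) (A n)) \<longlonglongrightarrow> 0"
    by (rule log_at_seq[OF R X A A XX]) simp
  ultimately have "(\<lambda>n. (1 / t n) *\<^sub>R (geom_mean (X' n) (t n) (A n) - X' n - t n *\<^sub>R log_at (X' n) (A n))
      - (log_at (X n) (A n) - log_at (X' n) (A n))) \<longlonglongrightarrow> 0 - 0" by (rule tendsto_diff)
  moreover have "(1 / t n) *\<^sub>R (geom_mean (X' n) (t n) (A n) - X' n - t n *\<^sub>R log_at (X' n) (A n))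
      - (log_at (X n) (A n) - log_at (X' n) (A n))
      = (1 / t n) *\<^sub>R (geom_mean (X' n) (t n) (A n) - X' n - t n *\<^sub>R log_at (X n) (A n))" for n
    using t(1)[of n] by (simp add: scaleR_diff_right)
  ultimately show ?thesis by simp
qed

lemma thompson_tendsto_imp_norm:
  fixes X :: "nat \<Rightarrow> 'h::{real_inner,complete_space} \<Rightarrow>\<^sub>L 'h"
  assumes "posop Y" "\<And>n. posop (X n)" "(\<lambda>n. thompson_dist (X n) Y) \<longlonglongrightarrow> 0"
  shows "X \<longlonglongrightarrow> Y"
proof -
  obtain R where R: "R \<ge> 0" "bnd R Y" using assms(1) by (rule posop_bnd)
  have "norm (X n - Y) \<le> exp R * (exp (thompson_dist (X n) Y) - 1)" for n
    by (rule norm_diff_le_thompson[OF R(2) assms(2)]) (simp add: thompson_sym assms)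
  then have ev: "\<forall>\<^sub>F n in sequentially. norm (X n - Y) \<le> exp R * (exp (thompson_dist (X n) Y) - 1)"
    by (intro always_eventually allI)
  have "(\<lambda>n. exp R * (exp (thompson_dist (X n) Y) - 1)) \<longlonglongrightarrow> exp R * (exp 0 - 1)"
    by (intro tendsto_mult tendsto_const tendsto_diff tendsto_exp assms(3))
  then have "(\<lambda>n. exp R * (exp (thompson_dist (X n) Y) - 1)) \<longlonglongrightarrow> 0" by simp
  then show ?thesis by (rule LIM_zero_cancel[OF Lim_null_comparison[OF ev]])
qed

section \<open>Inductive means of a deterministic sequence\<close>

text \<open>The value at \<open>0\<close> makes the recursion produce \<open>y 1\<close> at index \<open>1\<close>, since
  \<open>geom_mean (y 1) 1 (y 1) = y 1\<close>.\<close>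

primrec ind_mean :: "(nat \<Rightarrow> 'h::real_normed_vector \<Rightarrow>\<^sub>L 'h) \<Rightarrow> nat \<Rightarrow> ('h \<Rightarrow>\<^sub>L 'h)" where
  "ind_mean y 0 = y 1"
| "ind_mean y (Suc n) = geom_mean (ind_mean y n) (1 / (real n + 1)) (y (Suc n))"

lemma step_weight: "(real n + 1) * (1 - 1 / (real n + 1)) = real n" "(real n + 1) * (1 / (real n + 1)) = 1"
  by (simp_all add: right_diff_distrib)

lemma posop_ind_mean:
  fixes y :: "nat \<Rightarrow> 'h::{real_inner,complete_space} \<Rightarrow>\<^sub>L 'h"
  assumes "\<And>i. i \<ge> 1 \<Longrightarrow> posop (y i)"
  shows "posop (ind_mean y n)"
  using assms by (induction n) (auto intro: posop_geom_mean)

lemma ind_mean_contract: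
  fixes y z :: "nat \<Rightarrow> 'h::{real_inner,complete_space} \<Rightarrow>\<^sub>L 'h"
  assumes "\<And>i. i \<ge> 1 \<Longrightarrow> posop (y i)" "\<And>i. i \<ge> 1 \<Longrightarrow> posop (z i)"
  shows "real n * thompson_dist (ind_mean y n) (ind_mean z n) \<le> (\<Sum>i=1..n. thompson_dist (y i) (z i))"
proof (induction n)
  case (Suc n)
  have "thompson_dist (ind_mean y (Suc n)) (ind_mean z (Suc n))
    \<le> (1 - 1 / (real n + 1)) * thompson_dist (ind_mean y n) (ind_mean z n)
      + 1 / (real n + 1) * thompson_dist (y (Suc n)) (z (Suc n))"
    unfolding ind_mean.simps
    by (intro geom_mean_contract posop_ind_mean assms) auto
  from mult_left_mono[OF this, of "real n + 1"]
  have "(real n + 1) * thompson_dist (ind_mean y (Suc n)) (ind_mean z (Suc n))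
    \<le> real n * thompson_dist (ind_mean y n) (ind_mean z n) + thompson_dist (y (Suc n)) (z (Suc n))"
    by (simp only: distrib_left mult.assoc[symmetric] step_weight mult_1)
  then show ?case using Suc by (simp add: add.commute del: ind_mean.simps)
qed simp

text \<open>The bound on \<open>V\<close> is what the lower bound of \<open>X\<close> can lose when \<open>R\<close> grows by \<open>1\<close>; the upper bound
  can gain more.\<close>

lemma bnd_perturb:
  fixes X V :: "'h::{real_inner,complete_space} \<Rightarrow>\<^sub>L 'h"
  assumes X: "bnd R X" and R: "0 \<le> R" and V: "sadj V" "norm V \<le> exp (- R) - exp (- R - 1)"
  shows "bnd (R + 1) (X + V)"
proof -
  have u: "exp R + norm V \<le> exp (R + 1)"
  proof -
    have "norm V \<le> exp (- R)" using V(2) exp_gt_zero[of "- R - 1"] by linarith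
    also have "\<dots> \<le> exp R" using R by simp
    finally have "exp R + norm V \<le> 2 * exp R" by simp
    also have "\<dots> \<le> exp 1 * exp R" using exp_ge_add_one_self[of 1] by (intro mult_right_mono) auto
    finally show ?thesis by (simp add: add.commute flip: exp_add)
  qed
  have Xb: "exp (- R) * (x \<bullet> x) \<le> X x \<bullet> x" "X x \<bullet> x \<le> exp R * (x \<bullet> x)" for x
    using X by (auto simp: bnd_def spec_in_def op_le_def ap_simps)
  have Vb: "V x \<bullet> x \<le> norm V * (x \<bullet> x)" "- (norm V * (x \<bullet> x)) \<le> V x \<bullet> x" for x
    using op_le_norm[of V] op_le_norm[of "- V"] by (auto simp: op_le_def ap_simps minus_le_iff)
  have "exp (- (R + 1)) * (x \<bullet> x) \<le> (X + V) x \<bullet> x" for x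
  proof -
    have "- (R + 1) = - R - 1" by simp
    then have "exp (- (R + 1)) \<le> exp (- R) - norm V" using V(2) by (simp only: le_diff_eq)
    then have "exp (- (R + 1)) * (x \<bullet> x) \<le> (exp (- R) - norm V) * (x \<bullet> x)" by (intro mult_right_mono) auto
    then show ?thesis using Xb(1)[of x] Vb(2)[of x] by (simp add: left_diff_distrib ap_simps inner_simps)
  qed
  moreover have "(X + V) x \<bullet> x \<le> exp (R + 1) * (x \<bullet> x)" for x
  proof -
    have "(exp R + norm V) * (x \<bullet> x) \<le> exp (R + 1) * (x \<bullet> x)" using u by (intro mult_right_mono) auto
    then show ?thesis using Xb(2)[of x] Vb(1)[of x] by (simp add: distrib_right ap_simps inner_simps)
  qed
  moreover have "sadj (X + V)" using X V by (auto simp: bnd_def spec_in_def intro: sadj_intros)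
  ultimately show ?thesis by (simp add: bnd_def spec_in_def op_le_def ap_simps)
qed

lemma thompson_le_norm_bnd:
  fixes A B :: "'h::{real_inner,complete_space} \<Rightarrow>\<^sub>L 'h"
  assumes "bnd R A" "bnd R B"
  shows "thompson_dist A B \<le> exp R * norm (A - B)"
proof -
  have "thompson_dist A B \<le> norm (A - B) / exp (- R)"
    by (rule thompson_le_norm) (use assms in \<open>auto simp: bnd_def spec_in_def\<close>)
  then show ?thesis by (simp add: exp_minus divide_inverse mult.commute)
qed

lemma thompson_tendsto_of_norm:
  fixes X :: "nat \<Rightarrow> 'h::{real_inner,complete_space} \<Rightarrow>\<^sub>L 'h"
  assumes "\<And>n. bnd R (X n)" "bnd R Y" "X \<longlonglongrightarrow> Y"
  shows "(\<lambda>n. thompson_dist (X n) Y) \<longlonglongrightarrow> 0"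
  by (rule tendsto_null_bound[where g = "\<lambda>n. X n - Y" and c = "exp R"])
    (use assms in \<open>auto simp: LIM_zero intro: thompson_le_norm_bnd\<close>)

text \<open>The comparison sequence is \<open>X + V\<^sub>n\<close>. It runs through the same recursion as the inductive mean
  up to an error that is small relative to the step size \<open>1/(n+1)\<close>: by the first-order expansion the
  step from \<open>X + V\<^sub>n\<close> towards \<open>y\<^sub>n\<^sub>+\<^sub>1\<close> is about \<open>log\<^sub>X y\<^sub>n\<^sub>+\<^sub>1 / (n+1)\<close>, which is the increment
  of \<open>V\<close> up to \<open>V\<^sub>n/(n+1)\<close>. Far points \<open>y\<close> are controlled by the tail hypothesis.\<close>

theorem ind_mean_tendsto:
  fixes y :: "nat \<Rightarrow> 'h::{real_inner,complete_space} \<Rightarrow>\<^sub>L 'h"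
  defines "V \<equiv> \<lambda>X n. (1 / real n) *\<^sub>R (\<Sum>i=1..n. log_at X (y i))"
  assumes y: "\<And>i. i \<ge> 1 \<Longrightarrow> posop (y i)" and X: "posop X"
    and V0: "V X \<longlonglongrightarrow> 0"
    and tail: "\<And>e. e > 0 \<Longrightarrow> \<exists>r\<ge>0. \<forall>\<^sub>F n in sequentially.
      (\<Sum>i=1..n. if thompson_dist X (y i) > r then 1 + thompson_dist X (y i) else 0) \<le> e * real n"
  shows "(\<lambda>n. thompson_dist (ind_mean y n) X) \<longlonglongrightarrow> 0"
proof -
  define W where "W = V X"
  define l where "l i = log_at X (y i)" for i
  have W_Suc: "W (Suc n) = W n + (1 / (real n + 1)) *\<^sub>R (l (Suc n) - W n)" for n
  proof (cases "n = 0")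
    case False
    have 1: "real n *\<^sub>R W n = (\<Sum>i=1..n. l i)" using False by (simp add: W_def V_def l_def)
    have "W (Suc n) = (1 / (real n + 1)) *\<^sub>R (real n *\<^sub>R W n + l (Suc n))"
      unfolding 1 by (simp add: W_def V_def l_def add.commute)
    also have "real n *\<^sub>R W n = (real n + 1) *\<^sub>R W n - W n" by (simp add: scaleR_left_distrib)
    finally show ?thesis by (simp add: scaleR_diff_right scaleR_add_right)
  qed (simp add: W_def V_def l_def)
  have W0: "W \<longlonglongrightarrow> 0" using V0 by (simp add: W_def)
  obtain RX where RX: "RX \<ge> 0" "bnd RX X" using X by (rule posop_bnd)
  define K where "K = RX + 1"
  have K: "K \<ge> 0" and XK: "bnd K X" using RX by (auto simp: K_def intro: bnd_mono)
  have sW: "sadj (W n)" for n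
    unfolding W_def V_def using y X by (intro sadj_intros(5) sadj_sum sadj_log_at) auto
  have "exp (- RX) - exp (- RX - 1) > 0" by simp
  from tendstoD[OF W0 this] obtain N where N: "\<And>n. n \<ge> N \<Longrightarrow> norm (W n) < exp (- RX) - exp (- RX - 1)"
    by (auto simp: eventually_sequentially)
  have bdR: "bnd K (X + W n)" if "n \<ge> N" for n
    unfolding K_def using N[OF that] by (intro bnd_perturb RX sW) auto
  \<comment> \<open>The error \<open>e n\<close> is the defect of \<open>X + W\<close> in the recursion, relative to the step \<open>1/(n+1)\<close>.\<close>
  define a where "a n = thompson_dist (ind_mean y n) (X + W n)" for n
  define G where "G n = geom_mean (X + W n) (1 / (real n + 1)) (y (Suc n))" for n
  define e where "e n = (real n + 1) * thompson_dist (G n) (X + W (Suc n))" for n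
  have pG: "posop (G n)" if "n \<ge> N" for n
    unfolding G_def using bdR[OF that] y by (intro posop_geom_mean) (auto intro: bnd_posop)
  have rec: "real (Suc n) * a (Suc n) \<le> real n * a n + e n" if n: "n \<ge> N" for n
  proof -
    note p = bnd_posop[OF bdR[OF n]] bnd_posop[OF bdR[of "Suc n"]] posop_ind_mean[OF y]
    have "a (Suc n) \<le> thompson_dist (ind_mean y (Suc n)) (G n) + thompson_dist (G n) (X + W (Suc n))"
      unfolding a_def using n by (intro thompson_triangle p pG y) auto
    also have "thompson_dist (ind_mean y (Suc n)) (G n) \<le> (1 - 1 / (real n + 1)) * a n
        + 1 / (real n + 1) * thompson_dist (y (Suc n)) (y (Suc n))"
      unfolding a_def ind_mean.simps G_def using n by (intro geom_mean_contract p y) auto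
    finally have "a (Suc n) \<le> (1 - 1 / (real n + 1)) * a n + thompson_dist (G n) (X + W (Suc n))"
      using y by (simp add: thompson_self)
    from mult_left_mono[OF this, of "real n + 1"]
    have "(real n + 1) * a (Suc n) \<le> real n * a n + e n"
      by (simp only: e_def distrib_left mult.assoc[symmetric] step_weight)
    then show ?thesis by (simp add: add.commute)
  qed
  define C where "C = 2 + exp K * (norm X + 1)"
  have C: "C \<ge> 2" by (simp add: C_def)
  from tendstoD[OF W0, of 1] obtain N1 where N1: "\<And>n. n \<ge> N1 \<Longrightarrow> norm (W n) < 1"
    by (auto simp: eventually_sequentially)
  have RX1: "\<exists>N2. \<forall>n\<ge>N2. thompson_dist X (X + W n) \<le> 1"
  proof -
    have "exp (- K) > 0" by simp
    from tendstoD[OF W0 this] obtain N2 where N2: "\<And>n. n \<ge> N2 \<Longrightarrow> norm (W n) < exp (- K)"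
      by (auto simp: eventually_sequentially)
    have "thompson_dist X (X + W n) \<le> 1" if "n \<ge> max N N2" for n
    proof -
      have "thompson_dist X (X + W n) \<le> exp K * norm (W n)"
        using thompson_le_norm_bnd[OF XK bdR[of n]] that by simp
      also have "\<dots> \<le> exp K * exp (- K)" using N2[of n] that by (intro mult_left_mono) auto
      finally show ?thesis by (simp flip: exp_add)
    qed
    then show ?thesis by blast
  qed
  then obtain N2 where N2: "\<And>n. n \<ge> N2 \<Longrightarrow> thompson_dist X (X + W n) \<le> 1" by blast

  have far: "e n \<le> C * (1 + thompson_dist X (y (Suc n)))" if n: "n \<ge> max N (max N1 N2)" for n
  proof -
    define t where "t = 1 / (real n + 1)"
    have t: "0 \<le> t" "t \<le> 1" "(real n + 1) * t = 1" by (auto simp: t_def)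
    define D where "D = thompson_dist X (y (Suc n))"
    have D: "D \<ge> 0" by (simp add: D_def)
    note p = bnd_posop[OF bdR[of n]] bnd_posop[OF bdR[of "Suc n"]]
    have "thompson_dist (G n) (X + W n) = thompson_dist (X + W n) (G n)"
      using n by (intro thompson_sym p pG) auto
    also have "\<dots> \<le> t * thompson_dist (X + W n) (y (Suc n))"
      unfolding G_def t_def[symmetric] using n by (intro geom_mean_dist_left p y t) auto
    also have "\<dots> \<le> t * (thompson_dist (X + W n) X + D)"
      unfolding D_def using n t by (intro mult_left_mono thompson_triangle p X y) auto
    also have "thompson_dist (X + W n) X = thompson_dist X (X + W n)"
      using n by (intro thompson_sym p X) auto
    also have "t * (thompson_dist X (X + W n) + D) \<le> t * (1 + D)"
      using N2[of n] n t by (intro mult_left_mono) auto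
    finally have 1: "thompson_dist (G n) (X + W n) \<le> t * (1 + D)" .
    have "thompson_dist (X + W n) (X + W (Suc n)) \<le> exp K * norm ((X + W n) - (X + W (Suc n)))"
      using n by (intro thompson_le_norm_bnd bdR) auto
    also have "norm ((X + W n) - (X + W (Suc n))) = t * norm (l (Suc n) - W n)"
    proof -
      have "(X + W n) - (X + W (Suc n)) = - (t *\<^sub>R (l (Suc n) - W n))" by (simp add: W_Suc t_def)
      then have "norm ((X + W n) - (X + W (Suc n))) = norm (t *\<^sub>R (l (Suc n) - W n))"
        by (simp only: norm_minus_cancel)
      then show ?thesis using t(1) by (simp only: norm_scaleR abs_of_nonneg)
    qed
    also have "norm (l (Suc n) - W n) \<le> norm X * D + 1"
      using norm_log_at_le[OF X, of "y (Suc n)"] N1[of n] n norm_triangle_ineq4[of "l (Suc n)" "W n"]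
      by (simp add: l_def D_def)
    also have "norm X * D + 1 \<le> (norm X + 1) * (1 + D)" using D by (simp add: algebra_simps)
    finally have 2: "thompson_dist (X + W n) (X + W (Suc n)) \<le> exp K * (t * ((norm X + 1) * (1 + D)))"
      using t by (simp add: mult_left_mono)
    have "thompson_dist (G n) (X + W (Suc n)) \<le> t * (1 + D) + exp K * (t * ((norm X + 1) * (1 + D)))"
      using thompson_triangle[OF pG[of n] p] n 1 2 by fastforce
    then have "e n \<le> (real n + 1) * (t * (1 + D) + exp K * (t * ((norm X + 1) * (1 + D))))"
      unfolding e_def by (intro mult_left_mono) auto
    also have "\<dots> = ((real n + 1) * t) * ((1 + exp K * (norm X + 1)) * (1 + D))"
      by (simp add: algebra_simps)
    also have "\<dots> \<le> C * (1 + D)" unfolding t(3) using D by (simp add: C_def mult_right_mono)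
    finally show ?thesis by (simp add: D_def)
  qed
  have near: "\<exists>N'. \<forall>n\<ge>N'. thompson_dist X (y (Suc n)) \<le> r \<longrightarrow> e n \<le> \<eta>" if r: "r \<ge> 0" and \<eta>: "\<eta> > 0" for r \<eta>
  proof -
    define M where "M = max N N2"
    define z where "z n = (if thompson_dist X (y (Suc (n + M))) \<le> r then y (Suc (n + M)) else X)" for n
    \<comment> \<open>Far points are replaced by \<open>X\<close> to obtain a bounded sequence; the indices start at \<open>M\<close>, from
      which on the comparison sequence is bounded as well.\<close>
    define S where "S = K + r + 1"
    have S: "S \<ge> 0" "K \<le> S" using K r by (auto simp: S_def)
    have zS: "bnd (K + r) (z n)" for n
      using bnd_dist[OF XK y, of "Suc (n + M)" r] XK r by (auto simp: z_def intro: bnd_mono)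
    have zS': "bnd S (z n)" for n by (rule bnd_mono[OF zS]) (simp add: S_def)
    have RS: "bnd S (X + W (n + M))" for n by (rule bnd_mono[OF bdR S(2)]) (simp add: M_def)
    have XS: "bnd S X" by (rule bnd_mono[OF XK S(2)])
    define t where "t n = 1 / (real (n + M) + 1)" for n
    have t: "0 < t n" "t n \<le> 1" for n by (auto simp: t_def)
    have t0: "t \<longlonglongrightarrow> 0"
      unfolding t_def using LIMSEQ_ignore_initial_segment[OF LIMSEQ_inverse_real_of_nat, of M]
      by (simp add: inverse_eq_divide add.commute)
    have W0M: "(\<lambda>n. W (n + M)) \<longlonglongrightarrow> 0" using W0 by (rule LIMSEQ_ignore_initial_segment)
    have "(\<lambda>n. X - (X + W (n + M))) \<longlonglongrightarrow> 0" using tendsto_minus[OF W0M] by simp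
    from geom_mean_first_order_seq[OF S(1) XS RS zS' this t t0]
    have lim: "(\<lambda>n. (1 / t n) *\<^sub>R (geom_mean (X + W (n + M)) (t n) (z n) - (X + W (n + M)) - t n *\<^sub>R log_at X (z n))
        + W (n + M)) \<longlonglongrightarrow> 0 + 0"
      by (intro tendsto_add W0M)
    define d where "d n = (1 / t n) *\<^sub>R (geom_mean (X + W (n + M)) (t n) (z n) - (X + W (n + M)) - t n *\<^sub>R log_at X (z n))
        + W (n + M)" for n
    have "exp (S + r + 2) > 0" by simp
    then have "\<eta> / exp (S + r + 2) > 0" using \<eta> by simp
    then obtain N3 where N3: "\<And>n. n \<ge> N3 \<Longrightarrow> norm (d n) < \<eta> / exp (S + r + 2)"
      using tendstoD[OF lim, of "\<eta> / exp (S + r + 2)"] by (auto simp: eventually_sequentially d_def)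
    have "e n \<le> \<eta>" if n: "n \<ge> N3 + M" and near: "thompson_dist X (y (Suc n)) \<le> r" for n
    proof -
      define k where "k = n - M"
      have k: "n = k + M" "k \<ge> N3" using n by (auto simp: k_def)
      have nN: "n \<ge> N" "n \<ge> N2" using n by (auto simp: M_def)
      have zk: "z k = y (Suc n)" using near by (simp add: z_def k)
      have tk: "t k = 1 / (real n + 1)" by (simp add: t_def k)
      have Gk: "geom_mean (X + W n) (t k) (y (Suc n)) = G n" by (simp add: G_def tk)
      have "G n - (X + W (Suc n)) = t k *\<^sub>R d k"
      proof -
        have "t k *\<^sub>R d k = G n - (X + W n) - t k *\<^sub>R l (Suc n) + t k *\<^sub>R W n"
          using t(1)[of k] by (simp add: d_def zk l_def scaleR_add_right Gk k(1)[symmetric])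
        moreover have "W (Suc n) = W n + (t k *\<^sub>R l (Suc n) - t k *\<^sub>R W n)"
          by (simp add: W_Suc tk scaleR_diff_right)
        ultimately show ?thesis by simp
      qed
      then have nd: "norm (G n - (X + W (Suc n))) = t k * norm (d k)" using t(1)[of k] by simp
      have "thompson_dist (X + W n) (G n) \<le> t k * thompson_dist (X + W n) (z k)"
        unfolding G_def zk tk using nN by (intro geom_mean_dist_left bnd_posop[OF bdR] y) auto
      also have "\<dots> \<le> 1 * (thompson_dist (X + W n) X + thompson_dist X (z k))"
        using t[of k] nN y by (intro mult_mono thompson_triangle bnd_posop[OF bdR] X) (auto simp: zk)
      also have "\<dots> \<le> 1 + r"
        using N2[OF nN(2)] near nN by (simp add: zk thompson_sym[OF bnd_posop[OF bdR] X])
      finally have "bnd (K + (1 + r)) (G n)" using nN by (intro bnd_dist[OF bdR[OF nN(1)] pG]) auto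
      then have "bnd (S + r + 2) (G n)" by (rule bnd_mono) (use r in \<open>simp add: S_def\<close>)
      moreover have "bnd (S + r + 2) (X + W (Suc n))"
        by (rule bnd_mono[OF bdR]) (use nN r K in \<open>auto simp: S_def\<close>)
      ultimately have "thompson_dist (G n) (X + W (Suc n)) \<le> exp (S + r + 2) * (t k * norm (d k))"
        unfolding nd[symmetric] by (rule thompson_le_norm_bnd)
      then have "e n \<le> (real n + 1) * (exp (S + r + 2) * (t k * norm (d k)))"
        unfolding e_def by (intro mult_left_mono) auto
      also have "\<dots> = exp (S + r + 2) * norm (d k)" by (simp add: tk)
      also have "\<dots> \<le> exp (S + r + 2) * (\<eta> / exp (S + r + 2))"
        using N3[OF k(2)] by (intro mult_left_mono) auto
      finally show ?thesis by simp
    qed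
    then show ?thesis by blast
  qed
  have a0: "a \<longlonglongrightarrow> 0"
  proof (rule LIMSEQ_I)
    fix \<epsilon> :: real assume "\<epsilon> > 0"
    \<comment> \<open>The sums of errors are at most \<open>n \<eta> + C n \<eta>\<close> plus a constant that is eventually below \<open>n \<eta>\<close>.\<close>
    define \<eta> where "\<eta> = \<epsilon> / (2 * (C + 1))"
    have \<eta>: "\<eta> > 0" using C \<open>\<epsilon> > 0\<close> by (simp add: \<eta>_def)
    obtain r where r: "r \<ge> 0" and tl: "\<forall>\<^sub>F n in sequentially.
      (\<Sum>i=1..n. if thompson_dist X (y i) > r then 1 + thompson_dist X (y i) else 0) \<le> \<eta> * real n"
      using tail[OF \<eta>] by blast
    define T where "T i = (if thompson_dist X (y i) > r then 1 + thompson_dist X (y i) else 0)" for i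
    have T: "T i \<ge> 0" for i by (simp add: T_def add_nonneg_nonneg)
    obtain N' where N': "\<And>n. n \<ge> N' \<Longrightarrow> thompson_dist X (y (Suc n)) \<le> r \<Longrightarrow> e n \<le> \<eta>"
      using near[OF r \<eta>] by blast
    obtain N4 where N4: "\<And>n. n \<ge> N4 \<Longrightarrow> (\<Sum>i=1..n. T i) \<le> \<eta> * real n"
      using tl by (auto simp: eventually_sequentially T_def)
    define M where "M = max N' (max N (max N1 N2))"
    have en: "e n \<le> \<eta> + C * T (Suc n)" if "n \<ge> M" for n
    proof (cases "thompson_dist X (y (Suc n)) \<le> r")
      case True
      then show ?thesis using N'[of n] that C T[of "Suc n"] by (simp add: M_def add_increasing2)
    next
      case False
      then show ?thesis using far[of n] that \<eta> by (simp add: M_def T_def)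
    qed
    define c0 where "c0 = real M * a M"
    have bound: "real n * a n \<le> c0 + real n * \<eta> + C * (\<Sum>i=1..n. T i)" if "n \<ge> M" for n
      using that
    proof (induction n rule: dec_induct)
      case base
      have "0 \<le> (\<Sum>i=1..M. T i)" by (intro sum_nonneg T)
      then show ?case using C \<eta> by (simp add: c0_def add_increasing2)
    next
      case (step n)
      have "real (Suc n) * a (Suc n) \<le> real n * a n + e n" using step by (intro rec) (simp add: M_def)
      also have "\<dots> \<le> (c0 + real n * \<eta> + C * (\<Sum>i=1..n. T i)) + (\<eta> + C * T (Suc n))"
        using step en[of n] by (intro add_mono) auto
      finally show ?case by (simp add: algebra_simps)
    qed
    obtain N5 where N5: "real N5 > c0 / \<eta>" using reals_Archimedean2 by blast
    have "a n < \<epsilon>" if n: "n \<ge> Suc (max M (max N4 N5))" for n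
    proof -
      have "c0 < real N5 * \<eta>" using N5 \<eta> by (simp add: pos_divide_less_eq)
      also have "\<dots> \<le> real n * \<eta>" using n \<eta> by (intro mult_right_mono) auto
      finally have "c0 < real n * \<eta>" .
      moreover have "C * (\<Sum>i=1..n. T i) \<le> C * (\<eta> * real n)" using n C by (intro mult_left_mono N4) auto
      moreover have "real n * a n \<le> c0 + real n * \<eta> + C * (\<Sum>i=1..n. T i)" using n by (intro bound) simp
      ultimately have "real n * a n < real n * \<eta> + real n * \<eta> + C * (\<eta> * real n)" by linarith
      also have "\<dots> \<le> real n * (2 * (C + 1) * \<eta>)" using C \<eta> by (simp add: algebra_simps)
      also have "2 * (C + 1) * \<eta> = \<epsilon>" using C by (simp add: \<eta>_def)
      finally show ?thesis using n by (simp add: mult_less_cancel_left_pos)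
    qed
    then show "\<exists>no. \<forall>n\<ge>no. norm (a n - 0) < \<epsilon>" by (auto simp: a_def)
  qed
  have "(\<lambda>n. a n + exp K * norm (W n)) \<longlonglongrightarrow> 0 + exp K * 0"
    by (intro tendsto_add a0 tendsto_mult tendsto_const tendsto_norm_zero W0)
  then have lim: "(\<lambda>n. a n + exp K * norm (W n)) \<longlonglongrightarrow> 0" by simp
  have "\<forall>\<^sub>F n in sequentially. norm (thompson_dist (ind_mean y n) X) \<le> a n + exp K * norm (W n)"
    unfolding eventually_sequentially
  proof (intro exI[of _ N] allI impI)
    fix n assume n: "n \<ge> N"
    have "thompson_dist (X + W n) X \<le> exp K * norm (W n)"
      using thompson_le_norm_bnd[OF bdR[OF n] XK] by simp
    moreover have "thompson_dist (ind_mean y n) X \<le> a n + thompson_dist (X + W n) X"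
      unfolding a_def by (intro thompson_triangle posop_ind_mean y bnd_posop[OF bdR[OF n]] X)
    ultimately have "thompson_dist (ind_mean y n) X \<le> a n + exp K * norm (W n)" by linarith
    then show "norm (thompson_dist (ind_mean y n) X) \<le> a n + exp K * norm (W n)"
      by (simp only: real_norm_def abs_of_nonneg[OF thompson_nonneg])
  qed
  then show ?thesis using lim by (rule Lim_null_comparison)
qed

section \<open>Laws of large numbers for functions of an i.i.d. sequence\<close>

locale iid_sequence = prob_space \<Omega> for \<Omega> :: "'w measure" +
  fixes \<mu> :: "'a measure" and Y :: "nat \<Rightarrow> 'w \<Rightarrow> 'a"
  assumes indep: "indep_vars (\<lambda>_. \<mu>) Y {1..}"
    and law: "\<And>i. i \<ge> 1 \<Longrightarrow> distr \<Omega> \<mu> (Y i) = \<mu>"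
begin

lemma Y_measurable: "i \<ge> 1 \<Longrightarrow> Y i \<in> measurable \<Omega> \<mu>"
  using indep unfolding indep_vars_def by auto

lemma prob_space_law: "prob_space \<mu>"
  using prob_space_distr[OF Y_measurable[of 1]] law[of 1] by simp

lemma Y_comp: "g \<in> borel_measurable \<mu> \<Longrightarrow> i \<ge> 1 \<Longrightarrow> (\<lambda>\<omega>. g (Y i \<omega>)) \<in> borel_measurable \<Omega>"
  by (rule measurable_compose[OF Y_measurable])

lemma expectation_Y:
  fixes g :: "'a \<Rightarrow> real"
  assumes "g \<in> borel_measurable \<mu>" "i \<ge> 1"
  shows "expectation (\<lambda>\<omega>. g (Y i \<omega>)) = (\<integral>x. g x \<partial>\<mu>)"
  using integral_distr[OF Y_measurable[OF assms(2)] assms(1)] law[OF assms(2)] by simp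

lemma prob_Y:
  assumes "B \<in> sets \<mu>" "i \<ge> 1"
  shows "prob {\<omega>\<in>space \<Omega>. Y i \<omega> \<in> B} = measure \<mu> B"
proof -
  have "measure (distr \<Omega> \<mu> (Y i)) B = prob (Y i -` B \<inter> space \<Omega>)"
    by (rule measure_distr[OF Y_measurable[OF assms(2)] assms(1)])
  moreover have "Y i -` B \<inter> space \<Omega> = {\<omega>\<in>space \<Omega>. Y i \<omega> \<in> B}" by auto
  ultimately show ?thesis using law[OF assms(2)] by simp
qed

lemma indep_comp:
  "g \<in> borel_measurable \<mu> \<Longrightarrow> indep_vars (\<lambda>_. borel) (\<lambda>i \<omega>. g (Y i \<omega>)) {1..}"
  by (rule indep_vars_compose2[OF indep]) auto

text \<open>Independence makes the mixed terms of the square vanish.\<close>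

lemma second_moment_sum:
  fixes h :: "'a \<Rightarrow> real"
  assumes h: "h \<in> borel_measurable \<mu>" and bd: "\<And>x. \<bar>h x\<bar> \<le> c" and mean: "(\<integral>x. h x \<partial>\<mu>) = 0"
  shows "integrable \<Omega> (\<lambda>\<omega>. (\<Sum>i=1..n. h (Y i \<omega>))\<^sup>2) \<and>
    expectation (\<lambda>\<omega>. (\<Sum>i=1..n. h (Y i \<omega>))\<^sup>2) = real n * (\<integral>x. (h x)\<^sup>2 \<partial>\<mu>)"
proof (induction n)
  case (Suc n)
  define S where "S \<omega> = (\<Sum>i=1..n. h (Y i \<omega>))" for \<omega>
  define Z where "Z \<omega> = h (Y (Suc n) \<omega>)" for \<omega>
  have m: "S \<in> borel_measurable \<Omega>" "Z \<in> borel_measurable \<Omega>"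
    unfolding S_def Z_def by (intro borel_measurable_sum Y_comp h; simp)+
  have S: "\<bar>S \<omega>\<bar> \<le> real n * c" for \<omega>
  proof -
    have "\<bar>S \<omega>\<bar> \<le> (\<Sum>i=1..n. \<bar>h (Y i \<omega>)\<bar>)" unfolding S_def by (rule sum_abs)
    also have "\<dots> \<le> (\<Sum>i=1..n. c)" by (rule sum_mono) (rule bd)
    finally show ?thesis by simp
  qed
  have iS: "integrable \<Omega> S" using S by (intro integrable_const_bound[of _ "real n * c"] m) auto
  have iZ: "integrable \<Omega> Z" using bd by (intro integrable_const_bound[of _ c] m) (auto simp: Z_def)
  have iZ2: "integrable \<Omega> (\<lambda>\<omega>. (Z \<omega>)\<^sup>2)"
  proof (rule integrable_const_bound[of _ "c\<^sup>2"])
    show "AE \<omega> in \<Omega>. norm ((Z \<omega>)\<^sup>2) \<le> c\<^sup>2"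
      using power_mono[OF bd abs_ge_zero, of _ 2] by (simp add: Z_def)
    show "(\<lambda>\<omega>. (Z \<omega>)\<^sup>2) \<in> borel_measurable \<Omega>" using m by measurable
  qed
  have "indep_vars (\<lambda>_. borel) (\<lambda>i \<omega>. h (Y i \<omega>)) (insert (Suc n) {1..n})"
    by (rule indep_vars_subset[OF indep_comp[OF h]]) auto
  then have ind: "indep_var borel Z borel S" unfolding Z_def S_def by (rule indep_vars_sum[rotated 2]) auto
  note ZS = indep_var_lebesgue_integral[OF ind iZ iS] indep_var_integrable[OF ind iZ iS]
  have "expectation Z = 0" unfolding Z_def using expectation_Y[OF h, of "Suc n"] mean by simp
  then have ZS0: "expectation (\<lambda>\<omega>. Z \<omega> * S \<omega>) = 0" using ZS(1) by simp
  have Z2: "expectation (\<lambda>\<omega>. (Z \<omega>)\<^sup>2) = (\<integral>x. (h x)\<^sup>2 \<partial>\<mu>)" unfolding Z_def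
    by (rule expectation_Y) (use h in auto)
  have eq: "(\<Sum>i=1..Suc n. h (Y i \<omega>))\<^sup>2 = (S \<omega>)\<^sup>2 + (2 * (Z \<omega> * S \<omega>) + (Z \<omega>)\<^sup>2)" for \<omega>
    by (simp add: S_def Z_def power2_eq_square algebra_simps)
  have iS2: "integrable \<Omega> (\<lambda>\<omega>. (S \<omega>)\<^sup>2)" "expectation (\<lambda>\<omega>. (S \<omega>)\<^sup>2) = real n * (\<integral>x. (h x)\<^sup>2 \<partial>\<mu>)"
    using Suc by (auto simp: S_def)
  show ?case unfolding eq using iS2 iZ2 ZS(2) ZS0 Z2
    by (simp add: distrib_right)
qed simp

lemma ex_inverse_less:
  fixes e :: real
  assumes "e > 0"
  shows "\<exists>p::nat. 1 / (real p + 1) < e"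
proof -
  obtain p :: nat where "inverse (real (Suc p)) < e" using reals_Archimedean[OF assms] by blast
  then show ?thesis by (intro exI[of _ p]) (simp add: inverse_eq_divide add.commute)
qed

text \<open>The two pointwise estimates that make the error probabilities in the following law of large numbers
  summable: the sum in the first one is dominated by its largest term, and the sum in the second one by its
  first nonzero term.\<close>

lemma dyadic_tail_sum:
  fixes g :: real
  assumes "0 \<le> g"
  shows "(\<Sum>j<J. if 2 ^ j < g then 2 ^ j else 0) \<le> 2 * g"
proof (induction J)
  case (Suc J)
  have le: "(\<Sum>j<J. if 2 ^ j < g then 2 ^ j else 0) \<le> (2 ^ J :: real)" for J
  proof (induction J)
    case (Suc J)
    have "(if 2 ^ J < g then 2 ^ J else 0) \<le> (2 ^ J :: real)" by simp
    then show ?case using Suc unfolding sum.lessThan_Suc power_Suc by linarith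
  qed simp
  show ?case
  proof (cases "2 ^ J < g")
    case True
    then show ?thesis using le[of J] by simp
  next
    case False
    then show ?thesis using Suc by simp
  qed
qed (use assms in simp)

lemma dyadic_truncation_sum:
  fixes g :: real
  assumes "0 \<le> g"
  shows "(\<Sum>j<J. (if g \<le> 2 ^ j then g else 0)\<^sup>2 / 2 ^ j) \<le> 2 * g"
proof -
  define s where "s J = (\<Sum>j<J. (if g \<le> 2 ^ j then g else 0)\<^sup>2 / 2 ^ j)" for J
  have sS: "s (Suc J) = s J + (if g \<le> 2 ^ J then g else 0)\<^sup>2 / 2 ^ J" for J by (simp add: s_def)
  have inv: "if g \<le> 2 ^ J then s J + 2 * g\<^sup>2 / 2 ^ J \<le> 2 * g else s J = 0"
  proof (induction J)
    case 0
    then show ?case using assms mult_left_mono[of g 1 g] by (simp add: s_def power2_eq_square)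
  next
    case (Suc J)
    show ?case
    proof (cases "g \<le> 2 ^ J")
      case True
      then have "g \<le> 2 ^ Suc J" by (rule order_trans) simp
      then show ?thesis using Suc True by (simp add: sS)
    next
      case False
      have "g\<^sup>2 / 2 ^ J \<le> 2 * g" if "g \<le> 2 ^ Suc J"
      proof -
        have "g * g \<le> g * 2 ^ Suc J" using that assms by (intro mult_left_mono)
        then show ?thesis by (simp add: power2_eq_square pos_divide_le_eq)
      qed
      then show ?thesis using Suc False by (simp add: sS)
    qed
  qed
  have "s J \<le> 2 * g"
  proof (cases "g \<le> 2 ^ J")
    case True
    then have "s J + 2 * g\<^sup>2 / 2 ^ J \<le> 2 * g" using inv by simp
    moreover have "0 \<le> 2 * g\<^sup>2 / 2 ^ J" by simp
    ultimately show ?thesis by linarith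
  next
    case False
    then show ?thesis using inv assms by simp
  qed
  then show ?thesis by (simp add: s_def)
qed

text \<open>A one-sided law of large numbers, with a factor \<open>2\<close>: it suffices to bound the sums up to
  \<open>2\<^sup>j\<close>. There truncation at \<open>2\<^sup>j\<close> and Chebyshev's inequality give summable error probabilities.\<close>

lemma averages_bounded:
  fixes g :: "'a \<Rightarrow> real"
  assumes g: "g \<in> borel_measurable \<mu>" and g0: "\<And>x. 0 \<le> g x" and ig: "integrable \<mu> g" and \<delta>: "\<delta> > 0"
  shows "AE \<omega> in \<Omega>. \<forall>\<^sub>F n in sequentially. (\<Sum>i=1..n. g (Y i \<omega>)) \<le> (2 * (\<integral>x. g x \<partial>\<mu>) + \<delta>) * real n"
proof -
  interpret L: prob_space \<mu> by (rule prob_space_law)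
  define m where "m = (\<integral>x. g x \<partial>\<mu>)"
  define h where "h j x = (if g x \<le> 2 ^ j then g x else 0)" for j :: nat and x
  have hm[measurable]: "h j \<in> borel_measurable \<mu>" for j unfolding h_def using g by measurable
  have h0: "0 \<le> h j x" "h j x \<le> 2 ^ j" "h j x \<le> g x" for j x using g0[of x] by (auto simp: h_def)
  have ih: "integrable \<mu> (h j)" for j
    by (rule L.integrable_const_bound[of _ "2 ^ j"]) (use h0 in auto)
  have ih2: "integrable \<mu> (\<lambda>x. (h j x)\<^sup>2)" for j
  proof (rule L.integrable_const_bound[of _ "(2 ^ j)\<^sup>2"])
    show "AE x in \<mu>. norm ((h j x)\<^sup>2) \<le> (2 ^ j)\<^sup>2" using power_mono[OF h0(2,1), of _ _ 2] by simp
  qed measurable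
  define q where "q j = (\<integral>x. h j x \<partial>\<mu>)" for j
  have q: "0 \<le> q j" "q j \<le> m" for j
    unfolding q_def m_def using h0 by (auto intro!: integral_nonneg integral_mono ih ig)
  define k where "k j x = h j x - q j" for j x
  have km: "k j \<in> borel_measurable \<mu>" for j unfolding k_def by measurable
  have kb: "\<bar>k j x\<bar> \<le> 2 ^ j + \<bar>q j\<bar>" for j x using h0[of j x] by (simp add: k_def abs_if)
  have k0: "(\<integral>x. k j x \<partial>\<mu>) = 0" for j unfolding k_def using ih by (simp add: q_def L.prob_space)
  have k2: "(\<integral>x. (k j x)\<^sup>2 \<partial>\<mu>) \<le> (\<integral>x. (h j x)\<^sup>2 \<partial>\<mu>)" for j
    using L.variance_eq[OF ih ih2] unfolding k_def q_def by simp
  \<comment> \<open>Off \<open>A j\<close> no truncation takes place, and off \<open>B j\<close> the truncated sum is close to its mean.\<close>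
  define A where "A j = (\<Union>i\<in>{1..2 ^ j}. {\<omega>\<in>space \<Omega>. Y i \<omega> \<in> {x\<in>space \<mu>. 2 ^ j < g x}})" for j :: nat
  define B where "B j = {\<omega>\<in>space \<Omega>. 2 ^ j * (\<delta> / 2) \<le> \<bar>\<Sum>i=1..2 ^ j. k j (Y i \<omega>)\<bar>}" for j :: nat
  have tm: "{x\<in>space \<mu>. 2 ^ j < g x} \<in> sets \<mu>" for j using g by measurable
  have sA': "{\<omega>\<in>space \<Omega>. Y i \<omega> \<in> {x\<in>space \<mu>. 2 ^ j < g x}} \<in> sets \<Omega>" if "i \<ge> 1" for i j
    using measurable_sets[OF Y_measurable[OF that] tm] by (simp add: vimage_def Int_def conj_commute)
  have sA: "A j \<in> sets \<Omega>" for j unfolding A_def by (intro sets.finite_UN sA') auto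
  have sumk: "(\<lambda>\<omega>. \<Sum>i=1..2 ^ j. k j (Y i \<omega>)) \<in> borel_measurable \<Omega>" for j
    by (intro borel_measurable_sum Y_comp km) auto
  have sB: "B j \<in> sets \<Omega>" for j unfolding B_def using sumk[of j] by measurable
  define \<alpha> where "\<alpha> j = 2 ^ j * measure \<mu> {x\<in>space \<mu>. 2 ^ j < g x}" for j
  define \<beta> where "\<beta> j = (\<integral>x. (h j x)\<^sup>2 / 2 ^ j \<partial>\<mu>)" for j
  have pA: "prob (A j) \<le> \<alpha> j" for j
  proof -
    have "prob (A j) \<le> (\<Sum>i\<in>{1..2 ^ j}. prob {\<omega>\<in>space \<Omega>. Y i \<omega> \<in> {x\<in>space \<mu>. 2 ^ j < g x}})"
      unfolding A_def
    proof (rule measure_UNION_le)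
      show "{\<omega>\<in>space \<Omega>. Y i \<omega> \<in> {x\<in>space \<mu>. 2 ^ j < g x}} \<in> events" if "i \<in> {1..2 ^ j}" for i
        by (rule sA') (use that in simp)
    qed simp
    also have "\<dots> = (\<Sum>i\<in>{1..(2::nat) ^ j}. measure \<mu> {x\<in>space \<mu>. 2 ^ j < g x})"
      by (intro sum.cong refl prob_Y tm) auto
    finally show ?thesis by (simp add: \<alpha>_def)
  qed
  have pB: "prob (B j) \<le> 4 / \<delta>\<^sup>2 * \<beta> j" for j
  proof -
    note sm = second_moment_sum[OF km kb k0, of j "2 ^ j"]
    have e0: "expectation (\<lambda>\<omega>. \<Sum>i=1..2 ^ j. k j (Y i \<omega>)) = 0"
    proof -
      have "integrable \<Omega> (\<lambda>\<omega>. k j (Y i \<omega>))" if "i \<ge> 1" for i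
        using kb by (intro integrable_const_bound[of _ "2 ^ j + \<bar>q j\<bar>"] Y_comp km that) auto
      then show ?thesis by (simp add: expectation_Y[OF km] k0)
    qed
    have "0 < 2 ^ j * (\<delta> / 2)" using \<delta> by simp
    from Chebyshev_inequality[OF sumk conjunct1[OF sm] this]
    have "prob (B j) \<le> (real (2 ^ j) * (\<integral>x. (k j x)\<^sup>2 \<partial>\<mu>)) / (2 ^ j * (\<delta> / 2))\<^sup>2"
      unfolding e0 B_def using sm by simp
    also have "\<dots> \<le> (real (2 ^ j) * (\<integral>x. (h j x)\<^sup>2 \<partial>\<mu>)) / (2 ^ j * (\<delta> / 2))\<^sup>2"
      by (intro divide_right_mono mult_left_mono k2) auto
    also have "\<dots> = 4 / \<delta>\<^sup>2 * \<beta> j" using \<delta> by (simp add: \<beta>_def power2_eq_square field_simps)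
    finally show ?thesis .
  qed
  have s\<alpha>: "summable \<alpha>"
  proof (rule summableI_nonneg_bounded)
    fix J
    have i: "integrable \<mu> (\<lambda>x. if 2 ^ j < g x then 2 ^ j else 0 :: real)" for j :: nat
      by (rule L.integrable_const_bound[of _ "2 ^ j"]) (use g in auto)
    have "\<alpha> j = (\<integral>x. (if 2 ^ j < g x then 2 ^ j else 0 :: real) \<partial>\<mu>)" for j
    proof -
      have "(\<integral>x. (if 2 ^ j < g x then 2 ^ j else 0 :: real) \<partial>\<mu>) = (\<integral>x. 2 ^ j * indicator {x\<in>space \<mu>. 2 ^ j < g x} x \<partial>\<mu>)"
        by (rule Bochner_Integration.integral_cong) (auto simp: indicator_def)
      then show ?thesis using tm[of j] by (simp add: \<alpha>_def)
    qed
    then have "(\<Sum>j<J. \<alpha> j) = (\<integral>x. (\<Sum>j<J. if 2 ^ j < g x then 2 ^ j else 0) \<partial>\<mu>)"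
      using i by simp
    also have "\<dots> \<le> (\<integral>x. 2 * g x \<partial>\<mu>)"
      by (rule integral_mono) (use i ig g0 dyadic_tail_sum in auto)
    finally show "(\<Sum>j<J. \<alpha> j) \<le> (\<integral>x. 2 * g x \<partial>\<mu>)" .
  qed (simp add: \<alpha>_def)
  have s\<beta>: "summable \<beta>"
  proof (rule summableI_nonneg_bounded)
    fix J
    have "(\<Sum>j<J. \<beta> j) = (\<integral>x. (\<Sum>j<J. (h j x)\<^sup>2 / 2 ^ j) \<partial>\<mu>)"
      unfolding \<beta>_def using ih2 by (simp add: Bochner_Integration.integral_sum)
    also have "\<dots> \<le> (\<integral>x. 2 * g x \<partial>\<mu>)"
      by (rule integral_mono) (use ih2 ig g0 dyadic_truncation_sum in \<open>auto simp: h_def\<close>)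
    finally show "(\<Sum>j<J. \<beta> j) \<le> (\<integral>x. 2 * g x \<partial>\<mu>)" .
  qed (simp add: \<beta>_def)
  have "summable (\<lambda>j. prob (A j \<union> B j))"
  proof (rule summable_comparison_test'[of "\<lambda>j. \<alpha> j + 4 / \<delta>\<^sup>2 * \<beta> j" 0])
    show "summable (\<lambda>j. \<alpha> j + 4 / \<delta>\<^sup>2 * \<beta> j)" by (intro summable_add summable_mult s\<alpha> s\<beta>)
    show "norm (prob (A j \<union> B j)) \<le> \<alpha> j + 4 / \<delta>\<^sup>2 * \<beta> j" for j
      using measure_Un_le[OF sA sB, of j j] pA[of j] pB[of j] by simp
  qed
  from borel_cantelli_AE1[OF _ _ this]
  have "AE \<omega> in \<Omega>. \<forall>\<^sub>F j in sequentially. \<omega> \<in> space \<Omega> - (A j \<union> B j)"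
    using sA sB by (simp add: emeasure_eq_measure)
  then show ?thesis
  proof eventually_elim
    case (elim \<omega>)
    then obtain J where J: "\<And>j. j \<ge> J \<Longrightarrow> \<omega> \<in> space \<Omega> - (A j \<union> B j)"
      by (auto simp: eventually_sequentially)
    then have \<omega>: "\<omega> \<in> space \<Omega>" by blast
    have Ysp: "Y i \<omega> \<in> space \<mu>" if "i \<ge> 1" for i using measurable_space[OF Y_measurable[OF that] \<omega>] .
    have "(\<Sum>i=1..n. g (Y i \<omega>)) \<le> (2 * m + \<delta>) * real n" if n: "n \<ge> 2 ^ J" for n
    proof -
      have "n \<ge> 1" using n by (meson one_le_numeral one_le_power order_trans)
      then obtain j where j: "2 ^ j \<le> n" "n < 2 ^ (j + 1)" using ex_power_ivl1[of 2 n] by auto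
      define p where "p = j + 1"
      have "(2::nat) ^ J < 2 ^ p" using n j by (simp add: p_def)
      then have "p \<ge> J" by simp
      from J[OF this] have nA: "\<omega> \<notin> A p" and nB: "\<omega> \<notin> B p" by auto
      have gh: "g (Y i \<omega>) = k p (Y i \<omega>) + q p" if "i \<in> {1..2 ^ p}" for i
        using nA that \<omega> Ysp[of i] by (auto simp: A_def k_def h_def not_less)
      have "(\<Sum>i=1..n. g (Y i \<omega>)) \<le> (\<Sum>i=1..2 ^ p. g (Y i \<omega>))"
        by (rule sum_mono2) (use j g0 in \<open>auto simp: p_def\<close>)
      also have "\<dots> = (\<Sum>i=1..2 ^ p. k p (Y i \<omega>) + q p)" by (rule sum.cong) (use gh in auto)
      also have "\<dots> = (\<Sum>i=1..2 ^ p. k p (Y i \<omega>)) + 2 ^ p * q p" by (simp add: sum.distrib)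
      also have "\<dots> \<le> 2 ^ p * (\<delta> / 2) + 2 ^ p * m"
        using nB \<omega> q(2)[of p] by (intro add_mono mult_left_mono) (auto simp: B_def)
      also have "\<dots> = 2 ^ p * (\<delta> / 2 + m)" by (simp add: distrib_left)
      also have "\<dots> \<le> (2 * real n) * (\<delta> / 2 + m)"
      proof (rule mult_right_mono)
        have "real (2 ^ j) \<le> real n" using j by (simp only: of_nat_le_iff)
        then show "2 ^ p \<le> 2 * real n" by (simp add: p_def)
        show "0 \<le> \<delta> / 2 + m" using \<delta> q[of 0] by simp
      qed
      finally show ?thesis by (simp add: algebra_simps)
    qed
    then show ?case by (auto simp: eventually_sequentially m_def)
  qed
qed

text \<open>Hoeffding's inequality gives exponentially small, hence summable, error probabilities.\<close>

lemma frequencies_tendsto: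
  assumes B: "B \<in> sets \<mu>"
  shows "AE \<omega> in \<Omega>. (\<lambda>n. (\<Sum>i=1..n. indicat_real B (Y i \<omega>)) / real n) \<longlonglongrightarrow> measure \<mu> B"
proof -
  interpret L: prob_space \<mu> by (rule prob_space_law)
  have iB: "indicat_real B \<in> borel_measurable \<mu>" using B by measurable
  have eB: "(\<integral>x. indicat_real B x \<partial>\<mu>) = measure \<mu> B" using B by simp
  have "AE \<omega> in \<Omega>. \<forall>\<^sub>F n in sequentially. \<bar>(\<Sum>i=1..n. indicat_real B (Y i \<omega>)) / real n - measure \<mu> B\<bar> < e"
    if "e > 0" for e
  proof -
    define D where "D n = {\<omega>\<in>space \<Omega>. \<bar>(\<Sum>i=1..n. indicat_real B (Y i \<omega>)) / real n - measure \<mu> B\<bar> \<ge> e}" for n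
    have sm: "(\<lambda>\<omega>. \<Sum>i=1..n. indicat_real B (Y i \<omega>)) \<in> borel_measurable \<Omega>" for n
      by (intro borel_measurable_sum Y_comp iB) auto
    have sD: "D n \<in> sets \<Omega>" for n unfolding D_def using sm[of n] by measurable
    have pD: "prob (D n) \<le> 2 * exp (- 2 * e\<^sup>2) ^ n" for n
    proof (cases "n = 0")
      case False
      have dist: "distr \<Omega> borel (\<lambda>\<omega>. indicat_real B (Y i \<omega>)) = distr \<mu> borel (indicat_real B)" if "i \<ge> 1" for i
        using distr_distr[OF iB Y_measurable[OF that]] law[OF that] by (simp add: comp_def)
      interpret H: Hoeffding_ineq_iid \<Omega> "{1..n}" "\<lambda>i \<omega>. indicat_real B (Y i \<omega>)" "\<lambda>\<omega>. indicat_real B (Y 1 \<omega>)" 0 1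
        "expectation (\<lambda>\<omega>. indicat_real B (Y 1 \<omega>))"
      proof unfold_locales
        show "indep_vars (\<lambda>_. borel) (\<lambda>i \<omega>. indicat_real B (Y i \<omega>)) {1..n}"
          by (rule indep_vars_subset[OF indep_comp[OF iB]]) auto
        show "distr \<Omega> borel (\<lambda>\<omega>. indicat_real B (Y i \<omega>)) = distr \<Omega> borel (\<lambda>\<omega>. indicat_real B (Y 1 \<omega>))"
          if "i \<in> {1..n}" for i using dist[of i] dist[of 1] that by simp
        show "random_variable borel (\<lambda>\<omega>. indicat_real B (Y 1 \<omega>))" by (rule Y_comp[OF iB]) simp
        show "AE \<omega> in \<Omega>. indicat_real B (Y 1 \<omega>) \<in> {0..1}" by (rule AE_I2) (simp add: indicator_def)
      qed simp
      have EY: "expectation (\<lambda>\<omega>. indicat_real B (Y 1 \<omega>)) = measure \<mu> B"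
        using expectation_Y[OF iB, of 1] eB by simp
      have "{1..n} \<noteq> {}" using False by simp
      from H.Hoeffding_ineq_abs_ge'[OF less_imp_le[OF that] zero_less_one this]
      have "prob (D n) \<le> 2 * exp (- 2 * real n * e\<^sup>2 / (1 - 0)\<^sup>2)"
        unfolding EY by (simp add: D_def)
      also have "- 2 * real n * e\<^sup>2 / (1 - 0)\<^sup>2 = real n * (- 2 * e\<^sup>2)" by simp
      also have "exp (real n * (- 2 * e\<^sup>2)) = exp (- 2 * e\<^sup>2) ^ n" by (rule exp_of_nat_mult)
      finally show ?thesis .
    next
      case True
      then show ?thesis using order_trans[OF prob_le_1[of "D n"], of 2] by simp
    qed
    have "summable (\<lambda>n. prob (D n))"
    proof (rule summable_comparison_test'[of "\<lambda>n. 2 * exp (- 2 * e\<^sup>2) ^ n" 0])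
      show "summable (\<lambda>n. 2 * exp (- 2 * e\<^sup>2) ^ n)" using that by (intro summable_mult summable_geometric) simp
      show "norm (prob (D n)) \<le> 2 * exp (- 2 * e\<^sup>2) ^ n" for n using pD[of n] by simp
    qed
    from borel_cantelli_AE1[OF _ _ this]
    have "AE \<omega> in \<Omega>. \<forall>\<^sub>F n in sequentially. \<omega> \<in> space \<Omega> - D n"
      using sD by (simp add: emeasure_eq_measure)
    then show ?thesis
    proof eventually_elim
      case (elim \<omega>)
      then show ?case by (rule eventually_mono) (simp add: D_def not_le)
    qed
  qed
  then have "AE \<omega> in \<Omega>. \<forall>p::nat. \<forall>\<^sub>F n in sequentially.
      \<bar>(\<Sum>i=1..n. indicat_real B (Y i \<omega>)) / real n - measure \<mu> B\<bar> < 1 / (real p + 1)"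
    unfolding AE_all_countable by simp
  then show ?thesis
  proof eventually_elim
    case (elim \<omega>)
    show ?case
    proof (rule tendstoI)
      fix e :: real assume "e > 0"
      then obtain p :: nat where p: "1 / (real p + 1) < e" using ex_inverse_less by blast
      from elim[rule_format, of p] show "\<forall>\<^sub>F n in sequentially. dist ((\<Sum>i=1..n. indicat_real B (Y i \<omega>)) / real n) (measure \<mu> B) < e"
        by (rule eventually_mono) (simp only: dist_real_def less_trans[OF _ p])
    qed
  qed
qed

lemma simple_averages_tendsto:
  fixes s :: "'a \<Rightarrow> 'b::real_normed_vector"
  assumes s: "simple_function \<mu> s"
  shows "AE \<omega> in \<Omega>. (\<lambda>n. (1 / real n) *\<^sub>R (\<Sum>i=1..n. s (Y i \<omega>))) \<longlonglongrightarrow> Bochner_Integration.simple_bochner_integral \<mu> s"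
proof -
  define I where "I = s ` space \<mu>"
  have fin: "finite I" using simple_functionD(1)[OF s] by (simp add: I_def)
  define F where "F c = {x\<in>space \<mu>. s x = c}" for c
  have sF: "F c \<in> sets \<mu>" for c
    using simple_functionD(2)[OF s, of "{c}"] by (simp add: F_def vimage_def Int_def conj_commute)
  have "AE \<omega> in \<Omega>. \<forall>c\<in>I. (\<lambda>n. (\<Sum>i=1..n. indicat_real (F c) (Y i \<omega>)) / real n) \<longlonglongrightarrow> measure \<mu> (F c)"
    using fin frequencies_tendsto[OF sF] by (intro AE_finite_allI)
  then show ?thesis using AE_space
  proof eventually_elim
    case (elim \<omega>)
    have Ysp: "Y i \<omega> \<in> space \<mu>" if "i \<ge> 1" for i
      using measurable_space[OF Y_measurable[OF that] elim(2)] .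
    have dec: "s (Y i \<omega>) = (\<Sum>c\<in>I. indicat_real (F c) (Y i \<omega>) *\<^sub>R c)" if "i \<ge> 1" for i
    proof -
      have "(\<Sum>c\<in>I. indicat_real (F c) (Y i \<omega>) *\<^sub>R c) = (\<Sum>c\<in>I. if c = s (Y i \<omega>) then c else 0)"
        by (rule sum.cong) (use Ysp[OF that] in \<open>auto simp: F_def indicator_def\<close>)
      also have "\<dots> = s (Y i \<omega>)" using fin Ysp[OF that] by (simp add: I_def)
      finally show ?thesis ..
    qed
    have eq: "(1 / real n) *\<^sub>R (\<Sum>i=1..n. s (Y i \<omega>)) = (\<Sum>c\<in>I. ((\<Sum>i=1..n. indicat_real (F c) (Y i \<omega>)) / real n) *\<^sub>R c)" for n
    proof -
      have "(\<Sum>i=1..n. s (Y i \<omega>)) = (\<Sum>i=1..n. \<Sum>c\<in>I. indicat_real (F c) (Y i \<omega>) *\<^sub>R c)"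
        by (rule sum.cong) (use dec in auto)
      also have "\<dots> = (\<Sum>c\<in>I. (\<Sum>i=1..n. indicat_real (F c) (Y i \<omega>)) *\<^sub>R c)"
        by (subst sum.swap) (simp add: scaleR_sum_left)
      finally show ?thesis by (simp add: scaleR_sum_right)
    qed
    have "(\<lambda>n. \<Sum>c\<in>I. ((\<Sum>i=1..n. indicat_real (F c) (Y i \<omega>)) / real n) *\<^sub>R c) \<longlonglongrightarrow> (\<Sum>c\<in>I. measure \<mu> (F c) *\<^sub>R c)"
      using elim(1) by (intro tendsto_sum tendsto_scaleR tendsto_const) auto
    then show ?case unfolding eq by (simp add: Bochner_Integration.simple_bochner_integral_def I_def F_def)
  qed
qed

text \<open>Uniform integrability along the sequence: the integrals of the tails of \<open>g\<close> tend to \<open>0\<close>, and they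
  bound the averages of the tails up to the factor \<open>2\<close>.\<close>

lemma tails_small:
  fixes g :: "'a \<Rightarrow> real"
  assumes g: "g \<in> borel_measurable \<mu>" and g0: "\<And>x. 0 \<le> g x" and ig: "integrable \<mu> g"
  shows "AE \<omega> in \<Omega>. \<forall>e>0. \<exists>r\<ge>0. \<forall>\<^sub>F n in sequentially.
    (\<Sum>i=1..n. if g (Y i \<omega>) > r then 1 + g (Y i \<omega>) else 0) \<le> e * real n"
proof -
  interpret L: prob_space \<mu> by (rule prob_space_law)
  define h where "h r x = (if g x > real r then 1 + g x else 0)" for r :: nat and x
  have hm: "h r \<in> borel_measurable \<mu>" for r unfolding h_def using g by measurable
  have h0: "0 \<le> h r x" "h r x \<le> 1 + g x" for r x using g0[of x] by (auto simp: h_def)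
  have i1: "integrable \<mu> (\<lambda>x. 1 + g x)"
    by (intro Bochner_Integration.integrable_add ig L.integrable_const)
  have lim: "(\<lambda>r. \<integral>x. h r x \<partial>\<mu>) \<longlonglongrightarrow> (\<integral>x. 0 \<partial>\<mu>)"
  proof (rule integral_dominated_convergence[where s = h and w = "\<lambda>x. 1 + g x"])
    show "AE x in \<mu>. (\<lambda>r. h r x) \<longlonglongrightarrow> 0"
    proof (rule AE_I2)
      fix x
      obtain N :: nat where "g x < real N" using reals_Archimedean2 by blast
      then have "h r x = 0" if "r \<ge> N" for r
      proof -
        have "\<not> g x > real r" using that \<open>g x < real N\<close> by simp
        then show ?thesis by (simp add: h_def)
      qed
      then have "\<forall>\<^sub>F r in sequentially. h r x = 0" by (rule eventually_sequentiallyI)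
      then show "(\<lambda>r. h r x) \<longlonglongrightarrow> 0" by (rule tendsto_eventually)
    qed
    show "AE x in \<mu>. norm (h r x) \<le> 1 + g x" for r using h0 by simp
    show "h r \<in> borel_measurable \<mu>" for r by (rule hm)
    show "integrable \<mu> (\<lambda>x. 1 + g x)" by (rule i1)
  qed simp
  have ih: "integrable \<mu> (h r)" for r
  proof (rule Bochner_Integration.integrable_bound[OF i1 hm])
    have "norm (h r x) \<le> norm (1 + g x)" for x using h0[of r x] g0[of x] by simp
    then show "AE x in \<mu>. norm (h r x) \<le> norm (1 + g x)" by (rule AE_I2)
  qed
  have "AE \<omega> in \<Omega>. \<forall>\<^sub>F n in sequentially.
      (\<Sum>i=1..n. h r (Y i \<omega>)) \<le> (2 * (\<integral>x. h r x \<partial>\<mu>) + 1 / (real p + 1)) * real n" for r p :: nat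
    by (rule averages_bounded[where g = "h r", OF hm h0(1) ih]) simp
  then have "AE \<omega> in \<Omega>. \<forall>r p::nat. \<forall>\<^sub>F n in sequentially.
      (\<Sum>i=1..n. h r (Y i \<omega>)) \<le> (2 * (\<integral>x. h r x \<partial>\<mu>) + 1 / (real p + 1)) * real n"
    unfolding AE_all_countable by blast
  then show ?thesis
  proof eventually_elim
    case (elim \<omega>)
    show ?case
    proof (intro allI impI)
      fix e :: real assume e: "e > 0"
      have "\<forall>\<^sub>F r in sequentially. (\<integral>x. h r x \<partial>\<mu>) < e / 4"
        using order_tendstoD(2)[OF lim, of "e / 4"] e by simp
      from eventually_happens'[OF sequentially_bot this]
      obtain r where r: "(\<integral>x. h r x \<partial>\<mu>) < e / 4" by blast
      obtain p :: nat where p: "1 / (real p + 1) < e / 2" using ex_inverse_less[of "e / 2"] e by auto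
      have "\<forall>\<^sub>F n in sequentially. (\<Sum>i=1..n. h r (Y i \<omega>)) \<le> e * real n"
        using elim[rule_format, of r p]
      proof eventually_elim
        case (elim n)
        also have "(2 * (\<integral>x. h r x \<partial>\<mu>) + 1 / (real p + 1)) * real n \<le> e * real n"
          using r p by (intro mult_right_mono) auto
        finally show ?case .
      qed
      then show "\<exists>r\<ge>0. \<forall>\<^sub>F n in sequentially. (\<Sum>i=1..n. if g (Y i \<omega>) > r then 1 + g (Y i \<omega>) else 0) \<le> e * real n"
        unfolding h_def by (intro exI[of _ "real r"]) simp
    qed
  qed
qed

end

text \<open>Stated for a family \<open>h\<close>, because \<open>(x, y) \<mapsto> norm (x - y)\<close> may fail to be measurable for the product
  of the Borel algebras of a non-separable space.\<close>

lemma simple_parameter_measurable: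
  fixes h :: "'b \<Rightarrow> 'a \<Rightarrow> real"
  assumes s: "simple_function M s" and h: "\<And>c. c \<in> s ` space M \<Longrightarrow> h c \<in> borel_measurable M"
  shows "(\<lambda>x. h (s x) x) \<in> borel_measurable M"
proof -
  define I where "I = s ` space M"
  have fin: "finite I" using simple_functionD(1)[OF s] by (simp add: I_def)
  have F: "s -` {c} \<inter> space M \<in> sets M" for c by (rule simple_functionD(2)[OF s])
  have "(\<lambda>x. \<Sum>c\<in>I. indicat_real (s -` {c} \<inter> space M) x * h c x) \<in> borel_measurable M"
    by (intro borel_measurable_sum borel_measurable_times borel_measurable_indicator F h) (simp add: I_def)
  moreover have "h (s x) x = (\<Sum>c\<in>I. indicat_real (s -` {c} \<inter> space M) x * h c x)" if "x \<in> space M" for x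
  proof -
    have "(\<Sum>c\<in>I. indicat_real (s -` {c} \<inter> space M) x * h c x) = (\<Sum>c\<in>I. if c = s x then h c x else 0)"
      by (rule sum.cong) (use that in \<open>auto simp: indicator_def\<close>)
    then show ?thesis using fin that by (simp add: I_def)
  qed
  ultimately show ?thesis
    by (subst measurable_cong[where g = "\<lambda>x. \<Sum>c\<in>I. indicat_real (s -` {c} \<inter> space M) x * h c x"])
qed

lemma norm_diff_simple_measurable:
  fixes f s :: "'a \<Rightarrow> 'b::real_normed_vector"
  assumes f: "f \<in> borel_measurable M" and s: "simple_function M s"
  shows "(\<lambda>x. norm (f x - s x)) \<in> borel_measurable M"
proof (rule simple_parameter_measurable[OF s, where h = "\<lambda>c x. norm (f x - c)"])
  fix c :: 'b
  have "(\<lambda>y. norm (y - c)) \<in> borel_measurable borel"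
    by (intro borel_measurable_continuous_onI continuous_intros)
  then show "(\<lambda>x. norm (f x - c)) \<in> borel_measurable M" by (rule measurable_compose[OF f])
qed

context iid_sequence
begin

text \<open>The strong law of large numbers for Bochner integrable functions. It holds for simple functions by
  the convergence of frequencies. The averages of the approximation errors are at most about twice their
  expectations, which are arbitrarily small.\<close>

lemma bochner_averages_tendsto:
  fixes f :: "'a \<Rightarrow> 'b::real_normed_vector"
  assumes "has_bochner_integral_general \<mu> f v"
  shows "AE \<omega> in \<Omega>. (\<lambda>n. (1 / real n) *\<^sub>R (\<Sum>i=1..n. f (Y i \<omega>))) \<longlonglongrightarrow> v"
proof -
  obtain s where f: "f \<in> borel_measurable \<mu>" and s: "\<And>k. Bochner_Integration.simple_bochner_integrable \<mu> (s k)"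
    and e: "(\<lambda>k. \<integral>\<^sup>+ y. ennreal (norm (f y - s k y)) \<partial>\<mu>) \<longlonglongrightarrow> 0"
    and v: "(\<lambda>k. Bochner_Integration.simple_bochner_integral \<mu> (s k)) \<longlonglongrightarrow> v"
    using assms unfolding has_bochner_integral_general_def by blast
  have sf: "simple_function \<mu> (s k)" for k using s[of k] by (auto elim: Bochner_Integration.simple_bochner_integrable.cases)
  define g where "g k x = norm (f x - s k x)" for k x
  have gm: "g k \<in> borel_measurable \<mu>" for k unfolding g_def by (rule norm_diff_simple_measurable[OF f sf])
  have key: "\<exists>k. integrable \<mu> (g k) \<and> (\<integral>x. g k x \<partial>\<mu>) < \<epsilon> \<and> norm (Bochner_Integration.simple_bochner_integral \<mu> (s k) - v) < \<epsilon>"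
    if "\<epsilon> > 0" for \<epsilon> :: real
  proof -
    have "\<forall>\<^sub>F k in sequentially. (\<integral>\<^sup>+ y. ennreal (g k y) \<partial>\<mu>) < ennreal \<epsilon>"
      unfolding g_def by (rule order_tendstoD(2)[OF e]) (use that in simp)
    moreover have "\<forall>\<^sub>F k in sequentially. norm (Bochner_Integration.simple_bochner_integral \<mu> (s k) - v) < \<epsilon>"
      using tendstoD[OF v that] by (simp add: dist_norm)
    ultimately have "\<forall>\<^sub>F k in sequentially. (\<integral>\<^sup>+ y. ennreal (g k y) \<partial>\<mu>) < ennreal \<epsilon> \<and> norm (Bochner_Integration.simple_bochner_integral \<mu> (s k) - v) < \<epsilon>"
      by (rule eventually_conj)
    from eventually_happens'[OF sequentially_bot this]
    obtain k where k: "(\<integral>\<^sup>+ y. ennreal (g k y) \<partial>\<mu>) < ennreal \<epsilon>" "norm (Bochner_Integration.simple_bochner_integral \<mu> (s k) - v) < \<epsilon>"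
      by blast
    have i: "integrable \<mu> (g k)"
    proof (rule integrableI_bounded[OF gm])
      have "(\<integral>\<^sup>+ y. ennreal (norm (g k y)) \<partial>\<mu>) = (\<integral>\<^sup>+ y. ennreal (g k y) \<partial>\<mu>)" by (simp add: g_def)
      also have "\<dots> < \<infinity>" using less_trans[OF k(1) ennreal_less_top] by simp
      finally show "(\<integral>\<^sup>+ y. ennreal (norm (g k y)) \<partial>\<mu>) < \<infinity>" .
    qed
    have "ennreal (\<integral>x. g k x \<partial>\<mu>) = (\<integral>\<^sup>+ y. ennreal (g k y) \<partial>\<mu>)"
      by (rule nn_integral_eq_integral[OF i, symmetric]) (simp add: g_def)
    then have "ennreal (\<integral>x. g k x \<partial>\<mu>) < ennreal \<epsilon>" using k(1) by (simp only:)
    moreover have "0 \<le> (\<integral>x. g k x \<partial>\<mu>)" by (rule Bochner_Integration.integral_nonneg) (simp add: g_def)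
    ultimately have "(\<integral>x. g k x \<partial>\<mu>) < \<epsilon>" by (simp only: ennreal_less_iff)
    then show ?thesis using i k(2) by blast
  qed
  have "\<exists>k. integrable \<mu> (g k) \<and> (\<integral>x. g k x \<partial>\<mu>) < 1 / (real p + 1) \<and> norm (Bochner_Integration.simple_bochner_integral \<mu> (s k) - v) < 1 / (real p + 1)"
    for p :: nat by (rule key) simp
  then obtain \<kappa> where \<kappa>: "\<And>p::nat. integrable \<mu> (g (\<kappa> p))" "\<And>p. (\<integral>x. g (\<kappa> p) x \<partial>\<mu>) < 1 / (real p + 1)"
    "\<And>p. norm (Bochner_Integration.simple_bochner_integral \<mu> (s (\<kappa> p)) - v) < 1 / (real p + 1)" by metis
  have "AE \<omega> in \<Omega>. \<forall>\<^sub>F n in sequentially.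
      (\<Sum>i=1..n. g (\<kappa> p) (Y i \<omega>)) \<le> (2 * (\<integral>x. g (\<kappa> p) x \<partial>\<mu>) + 1 / (real p + 1)) * real n" for p :: nat
    by (rule averages_bounded[where g = "g (\<kappa> p)", OF gm _ \<kappa>(1)]) (simp_all add: g_def)
  then have "AE \<omega> in \<Omega>. \<forall>p::nat. \<forall>\<^sub>F n in sequentially.
      (\<Sum>i=1..n. g (\<kappa> p) (Y i \<omega>)) \<le> (2 * (\<integral>x. g (\<kappa> p) x \<partial>\<mu>) + 1 / (real p + 1)) * real n"
    unfolding AE_all_countable by blast
  moreover have "AE \<omega> in \<Omega>. \<forall>p::nat. (\<lambda>n. (1 / real n) *\<^sub>R (\<Sum>i=1..n. s (\<kappa> p) (Y i \<omega>))) \<longlonglongrightarrow> Bochner_Integration.simple_bochner_integral \<mu> (s (\<kappa> p))"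
    unfolding AE_all_countable using simple_averages_tendsto[OF sf] by blast
  ultimately show ?thesis
  proof eventually_elim
    case (elim \<omega>)
    show ?case
    proof (rule tendstoI)
      fix \<epsilon> :: real assume "\<epsilon> > 0"
      then obtain p :: nat where p: "1 / (real p + 1) < \<epsilon> / 5" using ex_inverse_less[of "\<epsilon> / 5"] by auto
      have "\<forall>\<^sub>F n in sequentially. dist ((1 / real n) *\<^sub>R (\<Sum>i=1..n. s (\<kappa> p) (Y i \<omega>))) (Bochner_Integration.simple_bochner_integral \<mu> (s (\<kappa> p))) < \<epsilon> / 5"
        using elim(2) \<open>\<epsilon> > 0\<close> by (intro tendstoD) auto
      with elim(1)[rule_format, of p] eventually_gt_at_top[of 0]
      show "\<forall>\<^sub>F n in sequentially. dist ((1 / real n) *\<^sub>R (\<Sum>i=1..n. f (Y i \<omega>))) v < \<epsilon>"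
      proof eventually_elim
        case (elim n)
        define a where "a = (1 / real n) *\<^sub>R (\<Sum>i=1..n. f (Y i \<omega>))"
        define b where "b = (1 / real n) *\<^sub>R (\<Sum>i=1..n. s (\<kappa> p) (Y i \<omega>))"
        define c where "c = Bochner_Integration.simple_bochner_integral \<mu> (s (\<kappa> p))"
        have "a - b = (1 / real n) *\<^sub>R (\<Sum>i=1..n. f (Y i \<omega>) - s (\<kappa> p) (Y i \<omega>))"
          by (simp add: a_def b_def sum_subtractf scaleR_diff_right)
        then have "norm (a - b) = norm (\<Sum>i=1..n. f (Y i \<omega>) - s (\<kappa> p) (Y i \<omega>)) / real n" by simp
        also have "\<dots> \<le> (\<Sum>i=1..n. g (\<kappa> p) (Y i \<omega>)) / real n"
          unfolding g_def by (intro divide_right_mono norm_sum) auto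
        also have "\<dots> \<le> 2 * (\<integral>x. g (\<kappa> p) x \<partial>\<mu>) + 1 / (real p + 1)"
          using elim by (simp add: pos_divide_le_eq)
        also have "\<dots> < 3 * (\<epsilon> / 5)" using \<kappa>(2)[of p] p by linarith
        finally have 1: "norm (a - b) < 3 * (\<epsilon> / 5)" .
        have 2: "norm (b - c) < \<epsilon> / 5" using elim by (simp add: b_def c_def dist_norm)
        have 3: "norm (c - v) < \<epsilon> / 5" using \<kappa>(3)[of p] p by (simp add: c_def)
        have "a - v = (a - b) + (b - c) + (c - v)" by simp
        moreover have "norm ((a - b) + (b - c) + (c - v)) \<le> norm (a - b) + norm (b - c) + norm (c - v)"
          using norm_triangle_ineq[of "a - b + (b - c)" "c - v"] norm_triangle_ineq[of "a - b" "b - c"] by linarith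
        ultimately have "norm (a - v) \<le> norm (a - b) + norm (b - c) + norm (c - v)" by (simp only:)
        then show ?case using 1 2 3 by (simp add: a_def dist_norm)
      qed
    qed
  qed
qed

end

section \<open>Positive cones of closed operator algebras\<close>

text \<open>The \<open>K\<close>-linear operators form a norm-closed real algebra, and the cone of the theorem is its
  positive part. Working with such algebras treats real and complex Hilbert spaces alike.\<close>

locale op_algebra =
  fixes L :: "('h::{real_inner,complete_space} \<Rightarrow>\<^sub>L 'h) set"
  assumes id_L: "id_blinfun \<in> L"
    and add_L: "A \<in> L \<Longrightarrow> B \<in> L \<Longrightarrow> A + B \<in> L"
    and scale_L: "A \<in> L \<Longrightarrow> r *\<^sub>R A \<in> L"
    and comp_L: "A \<in> L \<Longrightarrow> B \<in> L \<Longrightarrow> A \<cdot>\<^sub>L B \<in> L"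
    and closed_L: "closed L"
begin

definition Pos where "Pos = {A \<in> L. posop A}"

lemma Pos_posop: "A \<in> Pos \<Longrightarrow> posop A" by (simp add: Pos_def)

lemma zero_L: "0 \<in> L" using scale_L[OF id_L, of 0] by simp

lemma op_poly_L: "A \<in> L \<Longrightarrow> op_poly p A \<in> L"
  by (induction p) (auto intro: zero_L add_L scale_L id_L comp_L)

lemma sum_L: "(\<And>i. i \<in> I \<Longrightarrow> A i \<in> L) \<Longrightarrow> (\<Sum>i\<in>I. A i) \<in> L"
  by (induction I rule: infinite_finite_induct) (auto intro: zero_L add_L)

lemma op_powr_L:
  assumes "A \<in> Pos" shows "op_powr A t \<in> L"
proof -
  obtain R where R: "spec_in (exp (- R)) (exp R) A" using Pos_posop[OF assms] posop_bnd bnd_def by metis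
  show ?thesis unfolding op_powr_def
    by (rule cfc_closed[OF R cont_powr_exp closed_L]) (use assms in \<open>auto simp: Pos_def intro: op_poly_L\<close>)
qed

lemma geom_mean_Pos:
  assumes "A \<in> Pos" "B \<in> Pos" shows "geom_mean A t B \<in> Pos"
proof -
  have "isqr A \<cdot>\<^sub>L B \<cdot>\<^sub>L isqr A \<in> Pos"
    using assms by (auto simp: Pos_def intro!: comp_L posop_cong op_powr_L)
  then have "geom_mean A t B \<in> L"
    unfolding geom_mean_eq using assms by (intro comp_L op_powr_L)
  then show ?thesis using assms by (simp add: Pos_def posop_geom_mean)
qed

lemma ind_mean_Pos: "(\<And>i. i \<ge> 1 \<Longrightarrow> y i \<in> Pos) \<Longrightarrow> ind_mean y n \<in> Pos"
  by (induction n) (auto intro: geom_mean_Pos)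

text \<open>The distance that underlies \<open>thompson_topology\<close>.\<close>

definition dP :: "('h \<Rightarrow>\<^sub>L 'h) \<Rightarrow> ('h \<Rightarrow>\<^sub>L 'h) \<Rightarrow> real" where
  "dP A B = (if A \<in> Pos \<and> B \<in> Pos then thompson_dist A B else 0)"

sublocale T: Metric_space Pos dP
  by unfold_locales
    (auto simp: dP_def thompson_sym thompson_eq_0_iff thompson_triangle Pos_posop)

lemma Pos_complete:
  assumes X: "\<And>n. X n \<in> Pos"
    and C: "\<And>e. e > 0 \<Longrightarrow> \<exists>N. \<forall>m\<ge>N. \<forall>n\<ge>N. thompson_dist (X m) (X n) < e"
  shows "\<exists>Z\<in>Pos. (\<lambda>n. thompson_dist (X n) Z) \<longlonglongrightarrow> 0"
proof -
  note pX = Pos_posop[OF X]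
  obtain N where N: "\<And>m n. m \<ge> N \<Longrightarrow> n \<ge> N \<Longrightarrow> thompson_dist (X m) (X n) < 1" using C[of 1] by auto
  obtain R0 where R0: "R0 \<ge> 0" "bnd R0 (X N)" using pX by (rule posop_bnd)
  define R where "R = R0 + 1"
  have bR: "bnd R (X n)" if "n \<ge> N" for n
    unfolding R_def using N[of N n] that by (intro bnd_dist[OF R0(2) pX]) auto
  have "Cauchy (\<lambda>n. X (n + N))"
  proof (rule CauchyI)
    fix e :: real assume e: "e > 0"
    \<comment> \<open>Chosen such that \<open>exp R * (exp r - 1) = e\<close>.\<close>
    define r where "r = ln (1 + e * exp (- R))"
    have r: "r > 0" "exp r = 1 + e * exp (- R)" using e by (auto simp: r_def add_pos_pos)
    obtain M where M: "\<And>m n. m \<ge> M \<Longrightarrow> n \<ge> M \<Longrightarrow> thompson_dist (X m) (X n) < r" using C[OF r(1)] by blast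
    have "norm (X (m + N) - X (n + N)) < e" if "m \<ge> M" "n \<ge> M" for m n
    proof -
      have "norm (X (m + N) - X (n + N)) \<le> exp R * (exp (thompson_dist (X (n + N)) (X (m + N))) - 1)"
        by (rule norm_diff_le_thompson[OF bR pX order_refl]) simp
      also have "\<dots> < exp R * (exp r - 1)" using M[of "n + N" "m + N"] that by simp
      also have "\<dots> = e" by (simp add: r(2) mult.left_commute flip: exp_add)
      finally show ?thesis .
    qed
    then show "\<exists>M. \<forall>m\<ge>M. \<forall>n\<ge>M. norm (X (m + N) - X (n + N)) < e" by blast
  qed
  then obtain Z where Z: "(\<lambda>n. X (n + N)) \<longlonglongrightarrow> Z"
    using Cauchy_blinfun_convergent convergent_def by blast
  have "Z \<in> L" by (rule Lim_in_closed_set[OF closed_L _ _ Z]) (use X in \<open>auto simp: Pos_def\<close>)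
  moreover have bZ: "bnd R Z" unfolding bnd_def spec_in_def
  proof (intro conjI)
    have b: "bnd R (X (n + N))" for n by (rule bR) simp
    show "sadj Z" by (rule sadj_lim[OF Z]) (use b in \<open>simp add: bnd_def spec_in_def\<close>)
    show "exp (- R) *\<^sub>R id_blinfun \<preceq> Z"
      by (rule op_le_lim[OF tendsto_const Z]) (use b in \<open>simp add: bnd_def spec_in_def\<close>)
    show "Z \<preceq> exp R *\<^sub>R id_blinfun"
      by (rule op_le_lim[OF Z tendsto_const]) (use b in \<open>simp add: bnd_def spec_in_def\<close>)
  qed
  ultimately have "Z \<in> Pos" by (simp add: Pos_def bnd_posop)
  moreover have "(\<lambda>n. thompson_dist (X (n + N)) Z) \<longlonglongrightarrow> 0"
    by (rule thompson_tendsto_of_norm[OF bR bZ Z]) simp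
  then have "(\<lambda>n. thompson_dist (X n) Z) \<longlonglongrightarrow> 0" by (rule LIMSEQ_offset)
  ultimately show ?thesis by blast
qed

end

lemma bnd_iff_thompson:
  fixes A :: "'h::{real_inner,complete_space} \<Rightarrow>\<^sub>L 'h"
  assumes "posop A" "0 \<le> R"
  shows "bnd R A \<longleftrightarrow> thompson_dist id_blinfun A \<le> R"
proof -
  have "posop (id_blinfun :: 'h \<Rightarrow>\<^sub>L 'h)" unfolding posop_def by (intro conjI sadj_intros exI[of _ 1]) auto
  from thompson_le_iff[OF this assms] show ?thesis
    using posop_sadj[OF assms(1)] by (simp add: bnd_def spec_in_def)
qed

lemma bnd_id: "0 \<le> R \<Longrightarrow> bnd R (id_blinfun :: 'h::{real_inner,complete_space} \<Rightarrow>\<^sub>L 'h)"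
  using op_le_scalar[of "exp (- R)" 1] op_le_scalar[of 1 "exp R"]
  by (simp add: bnd_def spec_in_def sadj_intros)

lemma bnd_geom_mean:
  fixes A B :: "'h::{real_inner,complete_space} \<Rightarrow>\<^sub>L 'h"
  assumes A: "bnd R A" and B: "bnd R B" and R: "0 \<le> R" and t: "0 \<le> t" "t \<le> 1"
  shows "bnd R (geom_mean A t B)"
proof -
  note p = bnd_posop[OF A] bnd_posop[OF B]
  define J where "J = (id_blinfun :: 'h \<Rightarrow>\<^sub>L 'h)"
  have pJ: "posop J" unfolding J_def by (rule bnd_posop[OF bnd_id[OF R]])
  have "thompson_dist (geom_mean J t J) (geom_mean A t B) \<le> (1 - t) * thompson_dist J A + t * thompson_dist J B"
    by (rule geom_mean_contract[OF pJ pJ p t])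
  also have "\<dots> \<le> (1 - t) * R + t * R"
    using A B bnd_iff_thompson[OF p(1) R] bnd_iff_thompson[OF p(2) R] t
    by (intro add_mono mult_left_mono) (auto simp: J_def)
  also have "\<dots> = R" by (simp add: algebra_simps)
  finally show ?thesis
    using bnd_iff_thompson[OF posop_geom_mean[OF p] R] by (simp add: geom_mean_same[OF pJ] J_def[symmetric])
qed

lemma thompson_tendsto_bnd:
  fixes X :: "nat \<Rightarrow> 'h::{real_inner,complete_space} \<Rightarrow>\<^sub>L 'h"
  assumes Z: "posop Z" and X: "\<And>n. posop (X n)" and lim: "(\<lambda>n. thompson_dist (X n) Z) \<longlonglongrightarrow> 0"
  shows "\<exists>R\<ge>0. (\<forall>n. bnd R (X n)) \<and> bnd R Z"
proof -
  obtain R0 where R0: "R0 \<ge> 0" "bnd R0 Z" using Z by (rule posop_bnd)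
  have "Bseq (\<lambda>n. thompson_dist (X n) Z)" using lim by (intro convergent_imp_Bseq convergentI)
  then obtain c where c: "c > 0" "\<And>n. norm (thompson_dist (X n) Z) \<le> c" unfolding Bseq_def by blast
  have "bnd (R0 + c) (X n)" for n
    using c(2)[of n] thompson_sym[OF Z X] by (intro bnd_dist[OF R0(2) X]) simp
  moreover have "bnd (R0 + c) Z" by (rule bnd_mono[OF R0(2)]) (use c in simp)
  ultimately show ?thesis using R0(1) c(1) by (intro exI[of _ "R0 + c"]) simp
qed

lemma log_at_tendsto:
  fixes X A :: "nat \<Rightarrow> 'h::{real_inner,complete_space} \<Rightarrow>\<^sub>L 'h"
  assumes Z: "posop Z" "\<And>n. posop (X n)" "(\<lambda>n. thompson_dist (X n) Z) \<longlonglongrightarrow> 0"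
    and B: "posop B" "\<And>n. posop (A n)" "(\<lambda>n. thompson_dist (A n) B) \<longlonglongrightarrow> 0"
  shows "(\<lambda>n. log_at (X n) (A n)) \<longlonglongrightarrow> log_at Z B"
proof -
  obtain R1 where R1: "R1 \<ge> 0" "\<And>n. bnd R1 (X n)" "bnd R1 Z" using thompson_tendsto_bnd[OF Z] by blast
  obtain R2 where R2: "R2 \<ge> 0" "\<And>n. bnd R2 (A n)" "bnd R2 B" using thompson_tendsto_bnd[OF B] by blast
  define R where "R = max R1 R2"
  have b: "bnd R (X n)" "bnd R Z" "bnd R (A n)" "bnd R B" for n
    unfolding R_def using bnd_mono[OF R1(2)] bnd_mono[OF R1(3)] bnd_mono[OF R2(2)] bnd_mono[OF R2(3)] by simp_all
  have "(\<lambda>n. X n - Z) \<longlonglongrightarrow> 0" "(\<lambda>n. A n - B) \<longlonglongrightarrow> 0"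
    using thompson_tendsto_imp_norm[OF Z] thompson_tendsto_imp_norm[OF B] by (auto simp: LIM_zero)
  then have "(\<lambda>n. log_at (X n) (A n) - log_at Z B) \<longlonglongrightarrow> 0"
    using R1(1) by (intro log_at_seq[where R = R] b) (auto simp: R_def)
  then show ?thesis by (rule LIM_zero_cancel)
qed

section \<open>Karcher means of finitely supported measures\<close>

context op_algebra
begin

context
  fixes I :: "'i set" and w :: "'i \<Rightarrow> real" and a :: "'i \<Rightarrow> 'h \<Rightarrow>\<^sub>L 'h" and R :: real
  assumes w: "\<And>i. i \<in> I \<Longrightarrow> 0 \<le> w i" and w1: "(\<Sum>i\<in>I. w i) = 1"
    and a: "\<And>i. i \<in> I \<Longrightarrow> a i \<in> Pos" "\<And>i. i \<in> I \<Longrightarrow> bnd R (a i)" and R: "0 \<le> R"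
begin

text \<open>The power mean map. It is a strict contraction, and its fixed point is the power mean of
  order \<open>t\<close>; as \<open>t \<rightarrow> 0\<close> the power means converge to the Karcher mean.\<close>

definition pm where "pm t X = (\<Sum>i\<in>I. w i *\<^sub>R geom_mean X t (a i))"

definition karcher_sum where "karcher_sum X = (\<Sum>i\<in>I. w i *\<^sub>R log_at X (a i))"

lemma bnd_pm: "bnd R X \<Longrightarrow> 0 \<le> t \<Longrightarrow> t \<le> 1 \<Longrightarrow> bnd R (pm t X)"
  unfolding pm_def by (intro bnd_convex_sum w w1 bnd_geom_mean a R)

lemma pm_Pos: "X \<in> Pos \<Longrightarrow> bnd R X \<Longrightarrow> 0 \<le> t \<Longrightarrow> t \<le> 1 \<Longrightarrow> pm t X \<in> Pos"
  using bnd_posop[OF bnd_pm] geom_mean_Pos a(1) unfolding Pos_def pm_def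
  by (auto intro!: sum_L scale_L)

lemma pm_contract:
  assumes X: "bnd R X" and Z: "bnd R Z" and t: "0 \<le> t" "t \<le> 1"
  shows "thompson_dist (pm t X) (pm t Z) \<le> (1 - t) * thompson_dist X Z"
  unfolding pm_def
proof (rule thompson_convex_sum[where R = R])
  fix i assume i: "i \<in> I"
  note p = bnd_posop[OF X] bnd_posop[OF Z] bnd_posop[OF a(2)[OF i]]
  show "thompson_dist (geom_mean X t (a i)) (geom_mean Z t (a i)) \<le> (1 - t) * thompson_dist X Z"
    using geom_mean_contract[OF p(1,3,2,3) t] by (simp add: thompson_self[OF p(3)])
  show "bnd R (geom_mean X t (a i))" "bnd R (geom_mean Z t (a i))"
    by (intro bnd_geom_mean X Z a(2) i R t)+
qed (use w w1 t in auto)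

text \<open>Iterating the contraction; an approximate fixed point is all that the limit \<open>t \<rightarrow> 0\<close> requires.\<close>

lemma pm_approx_fixed:
  assumes t: "0 < t" "t \<le> 1" and e: "e > 0"
  shows "\<exists>X\<in>Pos. bnd R X \<and> thompson_dist (pm t X) X \<le> e"
proof -
  define x where "x n = (pm t ^^ n) id_blinfun" for n
  have x: "x n \<in> Pos \<and> bnd R (x n)" for n
  proof (induction n)
    case 0
    then show ?case using bnd_id[OF R] bnd_posop[OF bnd_id[OF R]] id_L by (simp add: x_def Pos_def)
  next
    case (Suc n)
    then show ?case using t by (simp add: x_def bnd_pm pm_Pos)
  qed
  have d: "thompson_dist (pm t (x n)) (x n) \<le> (1 - t) ^ n * thompson_dist (x 1) (x 0)" for n
  proof (induction n)
    case 0
    then show ?case by (simp add: x_def)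
  next
    case (Suc n)
    have s: "x (Suc n) = pm t (x n)" by (simp add: x_def)
    have "thompson_dist (pm t (x (Suc n))) (pm t (x n)) \<le> (1 - t) * thompson_dist (x (Suc n)) (x n)"
      by (rule pm_contract) (use x t in auto)
    then have "thompson_dist (pm t (x (Suc n))) (x (Suc n)) \<le> (1 - t) * thompson_dist (x (Suc n)) (x n)"
      by (simp only: s[symmetric])
    also have "\<dots> \<le> (1 - t) * ((1 - t) ^ n * thompson_dist (x 1) (x 0))"
      using Suc t unfolding s by (intro mult_left_mono) auto
    finally show ?case by (simp add: mult_ac)
  qed
  have "(\<lambda>n. (1 - t) ^ n * thompson_dist (x 1) (x 0)) \<longlonglongrightarrow> 0"
    using LIMSEQ_realpow_zero[of "1 - t"] t by (intro tendsto_mult_left_zero) auto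
  from order_tendstoD(2)[OF this e] eventually_happens'[OF sequentially_bot]
  obtain n where "(1 - t) ^ n * thompson_dist (x 1) (x 0) < e" by blast
  then show ?thesis using x[of n] d[of n] by (intro bexI[of _ "x n"]) auto
qed

lemma pm_first_order_seq:
  assumes Z: "\<And>n. bnd R (Z n)" and t: "\<And>n. 0 < t n" "\<And>n. t n \<le> 1" "t \<longlonglongrightarrow> 0"
  shows "(\<lambda>n. (1 / t n) *\<^sub>R (pm (t n) (Z n) - Z n) - karcher_sum (Z n)) \<longlonglongrightarrow> 0"
proof -
  have "(\<lambda>n. (1 / t n) *\<^sub>R (geom_mean (Z n) (t n) (a i) - Z n - t n *\<^sub>R log_at (Z n) (a i))) \<longlonglongrightarrow> 0"
    if "i \<in> I" for i
    by (rule geom_mean_first_order_seq[OF R Z Z _ _ t]) (use a that in auto)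
  then have "(\<lambda>n. \<Sum>i\<in>I. w i *\<^sub>R ((1 / t n) *\<^sub>R (geom_mean (Z n) (t n) (a i) - Z n - t n *\<^sub>R log_at (Z n) (a i))))
      \<longlonglongrightarrow> (\<Sum>i\<in>I. w i *\<^sub>R 0)"
    by (intro tendsto_sum tendsto_scaleR tendsto_const)
  moreover have "(\<Sum>i\<in>I. w i *\<^sub>R ((1 / t n) *\<^sub>R (geom_mean (Z n) (t n) (a i) - Z n - t n *\<^sub>R log_at (Z n) (a i))))
      = (1 / t n) *\<^sub>R (pm (t n) (Z n) - Z n) - karcher_sum (Z n)" for n
  proof -
    have "(\<Sum>i\<in>I. w i *\<^sub>R ((1 / t n) *\<^sub>R (geom_mean (Z n) (t n) (a i) - Z n - t n *\<^sub>R log_at (Z n) (a i))))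
      = (\<Sum>i\<in>I. (1 / t n) *\<^sub>R (w i *\<^sub>R geom_mean (Z n) (t n) (a i)) - (1 / t n) *\<^sub>R (w i *\<^sub>R Z n)
          - w i *\<^sub>R log_at (Z n) (a i))"
      using t(1)[of n] by (intro sum.cong refl) (simp add: scaleR_diff_right mult.commute)
    also have "\<dots> = (1 / t n) *\<^sub>R pm (t n) (Z n) - (1 / t n) *\<^sub>R (\<Sum>i\<in>I. w i *\<^sub>R Z n) - karcher_sum (Z n)"
      by (simp only: sum_subtractf scaleR_sum_right pm_def karcher_sum_def)
    finally show ?thesis by (simp add: sum_scaleR_const w1 scaleR_diff_right)
  qed
  ultimately show ?thesis by simp
qed

text \<open>The uniform version: a sequence of counterexamples with \<open>t \<rightarrow> 0\<close> would contradict the previous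
  lemma.\<close>

lemma pm_first_order:
  assumes e: "e > 0"
  shows "\<exists>\<theta>>0. \<forall>Z t. bnd R Z \<longrightarrow> 0 < t \<longrightarrow> t \<le> \<theta> \<longrightarrow> t \<le> 1 \<longrightarrow>
    norm ((1 / t) *\<^sub>R (pm t Z - Z) - karcher_sum Z) \<le> e"
proof (rule ccontr)
  assume neg: "\<not> ?thesis"
  have "\<exists>Z t. bnd R Z \<and> 0 < t \<and> t \<le> 1 / (real n + 1) \<and> t \<le> 1 \<and>
      \<not> norm ((1 / t) *\<^sub>R (pm t Z - Z) - karcher_sum Z) \<le> e" for n :: nat
  proof -
    have "1 / (real n + 1) > 0" by simp
    then show ?thesis using neg by blast
  qed
  then obtain Z t where Zt: "\<And>n. bnd R (Z n)" "\<And>n. 0 < t n" "\<And>n::nat. t n \<le> 1 / (real n + 1)" "\<And>n. t n \<le> 1"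
    "\<And>n. \<not> norm ((1 / t n) *\<^sub>R (pm (t n) (Z n) - Z n) - karcher_sum (Z n)) \<le> e" by metis
  have lim: "(\<lambda>n. 1 / (real n + 1)) \<longlonglongrightarrow> 0"
    using LIMSEQ_inverse_real_of_nat by (simp add: inverse_eq_divide add.commute)
  have "t \<longlonglongrightarrow> 0"
    by (rule tendsto_sandwich[OF always_eventually[OF allI] always_eventually[OF allI] tendsto_const lim])
      (use Zt in \<open>auto intro: less_imp_le\<close>)
  from tendstoD[OF pm_first_order_seq[OF Zt(1,2,4) this] e] eventually_happens'[OF sequentially_bot]
  obtain n where "norm ((1 / t n) *\<^sub>R (pm (t n) (Z n) - Z n) - karcher_sum (Z n)) < e" by fastforce
  then show False using Zt(5)[of n] by simp
qed

lemma exp_minus_one_le: "0 \<le> u \<Longrightarrow> u \<le> 1 \<Longrightarrow> exp u - 1 \<le> 2 * u" for u :: real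
  using exp_bound[of u] mult_left_mono[of u 1 u] by (simp add: power2_eq_square)

text \<open>Let \<open>X n\<close> be an approximate fixed point of the map of order \<open>t n\<close>. By the first-order
  expansion it solves the Karcher equation up to \<open>o(1)\<close>. Two approximate solutions are close to each
  other, since a step of size \<open>s\<close> moves each of them by \<open>o(s)\<close> only but contracts their distance by the
  factor \<open>1 - s\<close>. So the sequence is Cauchy, and its limit is a solution.\<close>

lemma finite_karcher_exists:
  "\<exists>X\<in>Pos. (\<Sum>i\<in>I. w i *\<^sub>R log_at X (a i)) = 0"
proof -
  define t where "t n = 1 / (real n + 1)" for n
  have t: "0 < t n" "t n \<le> 1" for n by (auto simp: t_def)
  have t0: "t \<longlonglongrightarrow> 0" unfolding t_def
    using LIMSEQ_inverse_real_of_nat by (simp add: inverse_eq_divide add.commute)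
  have "\<exists>X\<in>Pos. bnd R X \<and> thompson_dist (pm (t n) X) X \<le> (t n)\<^sup>2" for n
    by (rule pm_approx_fixed[OF t]) (use t(1)[of n] in simp)
  then obtain X where X: "\<And>n. X n \<in> Pos" "\<And>n. bnd R (X n)" "\<And>n. thompson_dist (pm (t n) (X n)) (X n) \<le> (t n)\<^sup>2"
    by metis
  have bpm: "bnd R (pm (t m) (X n))" for m n by (intro bnd_pm X t(2) less_imp_le[OF t(1)])
  have g0: "(\<lambda>n. karcher_sum (X n)) \<longlonglongrightarrow> 0"
  proof -
    have 1: "(\<lambda>n. (1 / t n) *\<^sub>R (pm (t n) (X n) - X n)) \<longlonglongrightarrow> 0"
    proof (rule tendsto_null_bound[OF _ t0, where c = "2 * exp R"])
      fix n
      have t2: "(t n)\<^sup>2 \<le> 1" using t[of n] power_mono[of "t n" 1 2] by simp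
      have "norm (pm (t n) (X n) - X n) \<le> exp R * (exp ((t n)\<^sup>2) - 1)"
        using X(3)[of n] thompson_sym[OF bnd_posop[OF X(2)] bnd_posop[OF bpm], of n n n]
        by (intro norm_diff_le_thompson X(2) bnd_posop[OF bpm]) simp
      also have "\<dots> \<le> exp R * (2 * (t n)\<^sup>2)" using t2 by (intro mult_left_mono exp_minus_one_le) auto
      finally have "norm (pm (t n) (X n) - X n) / t n \<le> exp R * (2 * (t n)\<^sup>2) / t n"
        using t(1)[of n] by (intro divide_right_mono) auto
      then show "norm ((1 / t n) *\<^sub>R (pm (t n) (X n) - X n)) \<le> 2 * exp R * norm (t n)"
        using t(1)[of n] by (simp add: power2_eq_square mult_ac)
    qed
    have "(\<lambda>n. (1 / t n) *\<^sub>R (pm (t n) (X n) - X n) - ((1 / t n) *\<^sub>R (pm (t n) (X n) - X n) - karcher_sum (X n))) \<longlonglongrightarrow> 0 - 0"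
      by (rule tendsto_diff[OF 1 pm_first_order_seq[OF X(2) t t0]])
    then show ?thesis by simp
  qed
  have close: "\<exists>N. \<forall>k\<ge>N. \<forall>l\<ge>N. thompson_dist (X k) (X l) < e" if e: "e > 0" for e
  proof -
    define \<eta> where "\<eta> = e / (4 * exp R)"
    have \<eta>: "\<eta> > 0" using e by (simp add: \<eta>_def)
    obtain \<theta> where \<theta>: "\<theta> > 0" "\<And>Z t. bnd R Z \<Longrightarrow> 0 < t \<Longrightarrow> t \<le> \<theta> \<Longrightarrow> t \<le> 1 \<Longrightarrow>
      norm ((1 / t) *\<^sub>R (pm t Z - Z) - karcher_sum Z) \<le> \<eta>" using pm_first_order[OF \<eta>] by blast
    obtain N1 where N1: "\<And>n. n \<ge> N1 \<Longrightarrow> norm (karcher_sum (X n)) < \<eta>"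
      using tendstoD[OF g0 \<eta>] by (auto simp: eventually_sequentially)
    have "min \<theta> (e / 4) > 0" using \<theta>(1) e by simp
    from tendstoD[OF t0 this] obtain N2 where N2: "\<And>n. n \<ge> N2 \<Longrightarrow> \<bar>t n\<bar> < min \<theta> (e / 4)"
      by (auto simp: eventually_sequentially)
    have "thompson_dist (X k) (X l) < e" if k: "k \<ge> max N1 N2" and l: "l \<ge> max N1 N2" for k l
    proof -
      define s where "s = t l"
      have s: "0 < s" "s \<le> 1" "s \<le> \<theta>" "s < e / 4" using t[of l] N2[of l] l by (auto simp: s_def)
      note p = bnd_posop[OF X(2)] bnd_posop[OF bpm]
      define D where "D = thompson_dist (X k) (X l)"
      have "D \<le> thompson_dist (X k) (pm s (X k)) + thompson_dist (pm s (X k)) (X l)"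
        unfolding D_def s_def by (intro thompson_triangle p)
      also have "thompson_dist (pm s (X k)) (X l) \<le> thompson_dist (pm s (X k)) (pm s (X l)) + thompson_dist (pm s (X l)) (X l)"
        unfolding s_def by (intro thompson_triangle p)
      also have "thompson_dist (pm s (X k)) (pm s (X l)) \<le> (1 - s) * D"
        unfolding D_def using s by (intro pm_contract X) auto
      also have "thompson_dist (pm s (X l)) (X l) \<le> s * (e / 4)"
        using X(3)[of l] mult_left_mono[OF less_imp_le[OF s(4)] less_imp_le[OF s(1)]]
        unfolding s_def power2_eq_square by (rule order_trans)
      also have "thompson_dist (X k) (pm s (X k)) \<le> s * (e / 2)"
      proof -
        have "norm ((1 / s) *\<^sub>R (pm s (X k) - X k)) \<le> norm ((1 / s) *\<^sub>R (pm s (X k) - X k) - karcher_sum (X k)) + norm (karcher_sum (X k))"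
          using norm_triangle_ineq[of "(1 / s) *\<^sub>R (pm s (X k) - X k) - karcher_sum (X k)" "karcher_sum (X k)"] by simp
        also have "\<dots> \<le> \<eta> + \<eta>" using \<theta>(2)[OF X(2)[of k] s(1,3,2)] N1[of k] k by (intro add_mono) auto
        finally have "norm (X k - pm s (X k)) / s \<le> \<eta> + \<eta>" using s(1) by (simp add: norm_minus_commute)
        then have "norm (X k - pm s (X k)) \<le> s * (\<eta> + \<eta>)" using s(1) by (simp add: pos_divide_le_eq mult.commute)
        then have "exp R * norm (X k - pm s (X k)) \<le> exp R * (s * (\<eta> + \<eta>))" by (intro mult_left_mono) auto
        moreover have "exp R * (s * (\<eta> + \<eta>)) = s * (e / 2)" by (simp add: \<eta>_def)
        moreover have "thompson_dist (X k) (pm s (X k)) \<le> exp R * norm (X k - pm s (X k))"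
          unfolding s_def by (intro thompson_le_norm_bnd X bpm)
        ultimately show ?thesis by linarith
      qed
      finally have "D \<le> s * (e / 2) + ((1 - s) * D + s * (e / 4))" by simp
      then have "s * D \<le> s * (e / 2 + e / 4)" by (simp add: algebra_simps)
      then have "D \<le> e / 2 + e / 4" using s(1) by (simp only: mult_le_cancel_left_pos)
      then show ?thesis using e by (simp add: D_def)
    qed
    then show ?thesis by blast
  qed
  obtain Z where Z: "Z \<in> Pos" "(\<lambda>n. thompson_dist (X n) Z) \<longlonglongrightarrow> 0"
    using Pos_complete[OF X(1) close] by blast
  have "(\<lambda>n. \<Sum>i\<in>I. w i *\<^sub>R log_at (X n) (a i)) \<longlonglongrightarrow> (\<Sum>i\<in>I. w i *\<^sub>R log_at Z (a i))"
  proof (intro tendsto_sum tendsto_scaleR tendsto_const)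
    fix i assume i: "i \<in> I"
    have pa: "posop (a i)" using a(1)[OF i] by (rule Pos_posop)
    show "(\<lambda>n. log_at (X n) (a i)) \<longlonglongrightarrow> log_at Z (a i)"
      by (rule log_at_tendsto[OF Pos_posop[OF Z(1)] Pos_posop[OF X(1)] Z(2) pa pa]) (simp add: thompson_self[OF pa])
  qed
  with g0 have "(\<Sum>i\<in>I. w i *\<^sub>R log_at Z (a i)) = 0" unfolding karcher_sum_def by (rule LIMSEQ_unique[symmetric])
  then show ?thesis using Z(1) by blast
qed

end

end

section \<open>The Karcher mean and the strong law\<close>

text \<open>A selection rule with finitely many values: the first centre in \<open>cs\<close> whose neighbourhood \<open>B\<close>
  contains the point; \<open>z\<close> is the value far from all centres.\<close>

primrec pick :: "('a \<Rightarrow> 'a set) \<Rightarrow> 'a \<Rightarrow> 'a list \<Rightarrow> 'a \<Rightarrow> 'a" where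
  "pick B z [] x = z"
| "pick B z (c # cs) x = (if x \<in> B c then c else pick B z cs x)"

lemma pick_in: "pick B z cs x \<in> insert z (set cs)"
  by (induction cs) auto

lemma pick_far_or_near: "pick B z cs x = z \<or> x \<in> B (pick B z cs x)"
  by (induction cs) auto

lemma pick_near: "c \<in> set cs \<Longrightarrow> x \<in> B c \<Longrightarrow> x \<in> B (pick B z cs x)"
  by (induction cs) auto

lemma simple_function_pick:
  assumes "\<And>c. B c \<in> sets M"
  shows "simple_function M (pick B z cs)"
proof (induction cs)
  case Nil
  then show ?case by (simp add: simple_function_const)
next
  case (Cons c cs)
  have "simple_function M (\<lambda>x. if x \<in> B c then c else pick B z cs x)"
    by (rule simple_function_If_set[OF simple_function_const Cons]) (use assms in \<open>simp add: sets.Int\<close>)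
  then show ?case by (simp add: fun_eq_iff cong: simple_function_cong)
qed

locale karcher_setting = op_algebra L + iid_sequence \<Omega> \<mu> Y
  for L :: "('h::{real_inner,complete_space} \<Rightarrow>\<^sub>L 'h) set" and \<Omega> :: "'w measure" and \<mu> and Y +
  assumes mu: "\<mu> \<in> prob_measures_L1 Pos"
begin

lemma thompson_topology_eq: "thompson_topology Pos = T.mtopology"
proof -
  have "dP = (\<lambda>A B. if A \<in> Pos \<and> B \<in> Pos then thompson_dist A B else 0)"
    by (simp add: dP_def fun_eq_iff)
  then show ?thesis by (simp add: thompson_topology_def)
qed

lemma space_mu: "space \<mu> = Pos"
  using mu by (simp add: prob_measures_L1_def)

lemma open_sets: "openin T.mtopology U \<Longrightarrow> U \<in> sets \<mu>"
  using mu by (simp add: prob_measures_L1_def thompson_topology_eq sigma_sets.Basic)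

lemma Y_Pos: "\<omega> \<in> space \<Omega> \<Longrightarrow> i \<ge> 1 \<Longrightarrow> Y i \<omega> \<in> Pos"
  using measurable_space[OF Y_measurable] space_mu by blast

text \<open>The \<open>\<sigma>\<close>-algebra of \<open>\<mu>\<close> is generated by the Thompson topology, and in a metric space
  sequential continuity suffices.\<close>

lemma seq_continuous_measurable:
  fixes f :: "('h \<Rightarrow>\<^sub>L 'h) \<Rightarrow> 'b::topological_space"
  assumes c: "\<And>A a. A \<in> Pos \<Longrightarrow> (\<And>n::nat. a n \<in> Pos) \<Longrightarrow> (\<lambda>n. thompson_dist (a n) A) \<longlonglongrightarrow> 0 \<Longrightarrow> (\<lambda>n. f (a n)) \<longlonglongrightarrow> f A"
  shows "f \<in> borel_measurable \<mu>"
proof (rule borel_measurableI)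
  fix U :: "'b set" assume U: "open U"
  have "\<exists>r>0. T.mball A r \<subseteq> f -` U \<inter> Pos" if A: "A \<in> Pos" "f A \<in> U" for A
  proof (rule ccontr)
    assume neg: "\<not> ?thesis"
    have "\<exists>a. a \<in> Pos \<and> thompson_dist a A < 1 / (real n + 1) \<and> f a \<notin> U" for n :: nat
    proof -
      have "1 / (real n + 1) > 0" by simp
      then obtain a where "a \<in> T.mball A (1 / (real n + 1))" "a \<notin> f -` U \<inter> Pos" using neg by blast
      then show ?thesis by (auto simp: dP_def thompson_sym Pos_posop)
    qed
    then obtain a where a: "\<And>n::nat. a n \<in> Pos" "\<And>n. thompson_dist (a n) A < 1 / (real n + 1)" "\<And>n. f (a n) \<notin> U"
      by metis
    have lim: "(\<lambda>n. 1 / (real n + 1)) \<longlonglongrightarrow> 0"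
      using LIMSEQ_inverse_real_of_nat by (simp add: inverse_eq_divide add.commute)
    have "(\<lambda>n. thompson_dist (a n) A) \<longlonglongrightarrow> 0"
    proof (rule Lim_null_comparison[OF always_eventually lim], rule allI)
      show "norm (thompson_dist (a n) A) \<le> 1 / (real n + 1)" for n using a(2)[of n] by simp
    qed
    from topological_tendstoD[OF c[OF A(1) a(1) this] U A(2)] have "\<forall>\<^sub>F n in sequentially. False"
      by eventually_elim (use a(3) in blast)
    then show False by simp
  qed
  then have "openin T.mtopology (f -` U \<inter> Pos)" by (auto simp: T.openin_mtopology)
  then show "f -` U \<inter> space \<mu> \<in> sets \<mu>" unfolding space_mu by (rule open_sets)
qed

lemma thompson_tendsto_thompson:
  assumes "X \<in> Pos" "A \<in> Pos" "\<And>n::nat. a n \<in> Pos" "(\<lambda>n. thompson_dist (a n) A) \<longlonglongrightarrow> 0"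
  shows "(\<lambda>n. thompson_dist X (a n)) \<longlonglongrightarrow> thompson_dist X A"
proof -
  note p = assms(1-3)[THEN Pos_posop]
  have "norm (thompson_dist X (a n) - thompson_dist X A) \<le> thompson_dist (a n) A" for n
    using thompson_triangle[OF p(1,2,3), of n] thompson_triangle[OF p(1,3,2), of n] thompson_sym[OF p(2,3), of n]
    by (simp add: abs_le_iff)
  then have ev: "\<forall>\<^sub>F n in sequentially. norm (thompson_dist X (a n) - thompson_dist X A) \<le> thompson_dist (a n) A"
    by (intro always_eventually allI)
  show ?thesis by (rule LIM_zero_cancel[OF Lim_null_comparison[OF ev assms(4)]])
qed

lemma thompson_measurable: "X \<in> Pos \<Longrightarrow> thompson_dist X \<in> borel_measurable \<mu>"
  by (rule seq_continuous_measurable) (rule thompson_tendsto_thompson)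

lemma log_at_measurable: "X \<in> Pos \<Longrightarrow> log_at X \<in> borel_measurable \<mu>"
proof (rule seq_continuous_measurable)
  fix A a assume X: "X \<in> Pos" and A: "A \<in> Pos" "\<And>n::nat. a n \<in> Pos" "(\<lambda>n. thompson_dist (a n) A) \<longlonglongrightarrow> 0"
  note p = X[THEN Pos_posop] A(1,2)[THEN Pos_posop]
  show "(\<lambda>n. log_at X (a n)) \<longlonglongrightarrow> log_at X A"
    by (rule log_at_tendsto[OF p(1,1) _ p(2,3) A(3)]) (simp add: thompson_self p)
qed

lemma thompson_integrable:
  assumes "X \<in> Pos" shows "integrable \<mu> (thompson_dist X)"
proof (rule integrableI_bounded[OF thompson_measurable[OF assms]])
  have "(\<integral>\<^sup>+ A. ennreal (thompson_dist X A) \<partial>\<mu>) < \<infinity>"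
    using mu assms by (simp add: prob_measures_L1_def)
  then show "(\<integral>\<^sup>+ A. ennreal (norm (thompson_dist X A)) \<partial>\<mu>) < \<infinity>" by simp
qed

text \<open>Any solution of the Karcher equation is the almost sure limit of the inductive means. This gives
  the strong law and, limits being unique, the uniqueness of the solution.\<close>

lemma solution_is_limit:
  assumes X: "X \<in> Pos" and K: "has_bochner_integral_general \<mu> (log_at X) 0"
  shows "AE \<omega> in \<Omega>. (\<lambda>n. thompson_dist (ind_mean (\<lambda>i. Y i \<omega>) n) X) \<longlonglongrightarrow> 0"
  using bochner_averages_tendsto[OF K]
    tails_small[where g = "thompson_dist X", OF thompson_measurable[OF X] thompson_nonneg thompson_integrable[OF X]]
    AE_space
proof eventually_elim
  case (elim \<omega>)
  show ?case
  proof (rule ind_mean_tendsto[OF _ Pos_posop[OF X] elim(1)])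
    show "posop (Y i \<omega>)" if "i \<ge> 1" for i using Y_Pos[OF elim(3) that] by (rule Pos_posop)
  qed (use elim(2) in blast)
qed

lemma solution_unique:
  assumes "X \<in> Pos" "has_bochner_integral_general \<mu> (log_at X) 0"
    and "X' \<in> Pos" "has_bochner_integral_general \<mu> (log_at X') 0"
  shows "X = X'"
proof -
  have "AE \<omega> in \<Omega>. X = X'"
    using solution_is_limit[OF assms(1,2)] solution_is_limit[OF assms(3,4)] AE_space
  proof eventually_elim
    case (elim \<omega>)
    define S where "S n = ind_mean (\<lambda>i. Y i \<omega>) n" for n
    have pS: "posop (S n)" for n
      unfolding S_def using Y_Pos[OF elim(3)] by (intro posop_ind_mean Pos_posop) auto
    note p = Pos_posop[OF assms(1)] Pos_posop[OF assms(3)]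
    have "(\<lambda>n. thompson_dist (S n) X + thompson_dist (S n) X') \<longlonglongrightarrow> 0 + 0"
      unfolding S_def by (rule tendsto_add[OF elim(1,2)])
    moreover have "thompson_dist X X' \<le> thompson_dist (S n) X + thompson_dist (S n) X'" for n
      using thompson_triangle[OF p(1) pS p(2), of n] thompson_sym[OF p(1) pS, of n] by simp
    ultimately have "thompson_dist X X' \<le> 0" by (intro LIMSEQ_le_const) auto
    then show ?case using thompson_eq_0_iff[OF p] by (simp add: antisym)
  qed
  then show ?thesis by (simp add: AE_const)
qed

text \<open>Approximation by finitely many values: by \<open>\<tau>\<close>-additivity, finitely many balls of any given
  radius carry almost all of the mass.\<close>

lemma finite_cover:
  assumes r: "r > 0" and e: "e > 0"
  shows "\<exists>cs. set cs \<subseteq> Pos \<and> measure \<mu> (Pos - (\<Union>c\<in>set cs. T.mball c r)) < e"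
proof -
  interpret L: prob_space \<mu> by (rule prob_space_law)
  define U where "U F = (\<Union>c\<in>F. T.mball c r)" for F
  define \<U> where "\<U> = {V. \<exists>F. finite F \<and> F \<subseteq> Pos \<and> V = U F}"
  have UU: "V \<in> \<U> \<longleftrightarrow> (\<exists>F. finite F \<and> F \<subseteq> Pos \<and> V = U F)" for V by (simp add: \<U>_def)
  have oU: "openin T.mtopology (U F)" for F unfolding U_def by (intro openin_Union) auto
  have dir: "\<exists>W\<in>\<U>. V \<union> V' \<subseteq> W" if V: "V \<in> \<U>" "V' \<in> \<U>" for V V'
  proof -
    obtain F where F: "finite F" "F \<subseteq> Pos" "V = U F" using V(1) unfolding UU by blast
    obtain F' where F': "finite F'" "F' \<subseteq> Pos" "V' = U F'" using V(2) unfolding UU by blast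
    show ?thesis
    proof
      show "U (F \<union> F') \<in> \<U>" unfolding UU using F F' by (intro exI[of _ "F \<union> F'"]) simp
      show "V \<union> V' \<subseteq> U (F \<union> F')" by (simp add: F(3) F'(3) U_def UN_Un)
    qed
  qed
  have "U {} \<in> \<U>" unfolding UU by (intro exI[of _ "{}"]) simp
  then have ne: "\<U> \<noteq> {}" by blast
  have un: "\<Union>\<U> = Pos"
  proof
    have "U F \<subseteq> Pos" for F unfolding U_def using T.mball_subset_mspace by blast
    then have "V \<subseteq> Pos" if "V \<in> \<U>" for V using that unfolding UU by blast
    then show "\<Union>\<U> \<subseteq> Pos" by (rule Union_least)
    show "Pos \<subseteq> \<Union>\<U>"
    proof
      fix A assume A: "A \<in> Pos"
      then have "A \<in> U {A}" using r by (simp add: U_def T.centre_in_mball_iff)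
      moreover have "U {A} \<in> \<U>" unfolding UU using A by (intro exI[of _ "{A}"]) simp
      ultimately show "A \<in> \<Union>\<U>" by (intro UnionI)
    qed
  qed
  have tau: "tau_additive T.mtopology \<mu>"
    using mu by (simp add: prob_measures_L1_def thompson_topology_eq)
  have "\<U> \<noteq> {} \<and> (\<forall>V\<in>\<U>. openin T.mtopology V) \<and> (\<forall>V\<in>\<U>. \<forall>V'\<in>\<U>. \<exists>W\<in>\<U>. V \<union> V' \<subseteq> W)"
  proof (intro conjI ballI)
    show "openin T.mtopology V" if "V \<in> \<U>" for V using that oU by (auto simp only: UU)
  qed (rule ne, rule dir)
  then have "emeasure \<mu> (\<Union>\<U>) = (SUP V\<in>\<U>. emeasure \<mu> V)"
    by (rule mp[OF spec[OF tau[unfolded tau_additive_def]]])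
  then have S: "(SUP V\<in>\<U>. emeasure \<mu> V) = 1"
    unfolding un using L.emeasure_space_1[unfolded space_mu] by (rule trans[OF sym])
  have "ennreal (1 - e) < (SUP V\<in>\<U>. emeasure \<mu> V)"
    unfolding S using e by (simp add: ennreal_less_one_iff)
  then obtain V where V: "V \<in> \<U>" "ennreal (1 - e) < emeasure \<mu> V" unfolding less_SUP_iff by blast
  obtain F where F: "finite F" "F \<subseteq> Pos" "V = U F" using V(1) unfolding UU by blast
  obtain cs where cs: "set cs = F" using finite_list[OF F(1)] by blast
  have sV: "V \<in> sets \<mu>" unfolding F(3) by (rule open_sets[OF oU])
  have "1 - e < measure \<mu> V"
  proof (rule ccontr)
    assume "\<not> 1 - e < measure \<mu> V"
    then have "ennreal (measure \<mu> V) \<le> ennreal (1 - e)" by (intro ennreal_leI) simp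
    then show False using V(2) unfolding L.emeasure_eq_measure by (rule leD[THEN notE])
  qed
  then have "measure \<mu> (Pos - V) < e" using L.prob_compl[OF sV] by (simp add: space_mu)
  moreover have "V = (\<Union>c\<in>set cs. T.mball c r)" unfolding F(3) U_def cs ..
  ultimately show ?thesis using F(2) cs by (intro exI[of _ cs]) simp
qed

lemma simple_approximation:
  assumes Z: "Z \<in> Pos"
  shows "\<exists>f. (\<forall>k::nat. simple_function \<mu> (f k)) \<and>
    (\<forall>k. \<forall>A\<in>Pos. f k A \<in> Pos \<and> thompson_dist (f k A) A \<le> 1 + thompson_dist Z A) \<and>
    (AE A in \<mu>. (\<lambda>k. thompson_dist (f k A) A) \<longlonglongrightarrow> 0)"
proof -
  interpret L: prob_space \<mu> by (rule prob_space_law)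
  define r where "r k = 1 / (real k + 1)" for k :: nat
  have r: "0 < r k" "r k \<le> 1" for k by (auto simp: r_def)
  have "\<exists>cs. set cs \<subseteq> Pos \<and> measure \<mu> (Pos - (\<Union>c\<in>set cs. T.mball c (r k))) < (1 / 2) ^ k" for k
    by (rule finite_cover) (use r in auto)
  then obtain cs where cs: "\<And>k. set (cs k) \<subseteq> Pos"
    "\<And>k. measure \<mu> (Pos - (\<Union>c\<in>set (cs k). T.mball c (r k))) < (1 / 2) ^ k" by metis
  define B where "B k c = T.mball c (r k)" for k c
  define f where "f k = pick (B k) Z (cs k)" for k
  have sB: "B k c \<in> sets \<mu>" for k c unfolding B_def by (rule open_sets) simp
  have near: "thompson_dist c A < r k" if "A \<in> B k c" for A k c
    using that by (auto simp: B_def dP_def)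
  have fP: "f k A \<in> Pos" for k A using pick_in[of "B k" Z "cs k" A] Z cs(1)[of k] by (auto simp: f_def)
  have fd: "thompson_dist (f k A) A \<le> 1 + thompson_dist Z A" if "A \<in> Pos" for k A
    using pick_far_or_near[of "B k" Z "cs k" A]
  proof
    assume "pick (B k) Z (cs k) A = Z"
    then show ?thesis by (simp add: f_def)
  next
    assume "A \<in> B k (pick (B k) Z (cs k) A)"
    then have "thompson_dist (f k A) A < r k" using near by (simp add: f_def)
    then show ?thesis using r(2)[of k] thompson_nonneg[of Z A] by linarith
  qed
  define D where "D k = Pos - (\<Union>c\<in>set (cs k). B k c)" for k
  have sD: "D k \<in> sets \<mu>" for k
    unfolding D_def space_mu[symmetric] by (intro sets.Diff sets.top sets.finite_UN sB) auto
  have "summable (\<lambda>k. measure \<mu> (D k))"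
  proof (rule summable_comparison_test'[of "\<lambda>k. (1 / 2) ^ k" 0])
    show "summable (\<lambda>k. (1 / 2 :: real) ^ k)" by (intro summable_geometric) simp
    show "norm (measure \<mu> (D k)) \<le> (1 / 2) ^ k" for k using cs(2)[of k] by (simp add: D_def B_def)
  qed
  from borel_cantelli_AE1[OF _ _ this]
  have "AE A in \<mu>. \<forall>\<^sub>F k in sequentially. A \<in> space \<mu> - D k"
    using sD by (simp add: L.emeasure_eq_measure)
  then have "AE A in \<mu>. (\<lambda>k. thompson_dist (f k A) A) \<longlonglongrightarrow> 0"
  proof eventually_elim
    case (elim A)
    have lim: "r \<longlonglongrightarrow> 0" unfolding r_def
      using LIMSEQ_inverse_real_of_nat by (simp add: inverse_eq_divide add.commute)
    from elim have "\<forall>\<^sub>F k in sequentially. norm (thompson_dist (f k A) A) \<le> r k"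
    proof eventually_elim
      case (elim k)
      then obtain c where "c \<in> set (cs k)" "A \<in> B k c" by (auto simp: D_def space_mu)
      then have "A \<in> B k (f k A)" unfolding f_def by (rule pick_near)
      then show ?case using near[of A k "f k A"] by simp
    qed
    then show ?case using lim by (rule Lim_null_comparison)
  qed
  moreover have "simple_function \<mu> (f k)" for k unfolding f_def by (rule simple_function_pick[OF sB])
  ultimately show ?thesis using fP fd by blast
qed

text \<open>For a simple function \<open>f\<close>, the Karcher equation of the image of \<open>\<mu>\<close> under \<open>f\<close>.\<close>

lemma simple_karcher_exists:
  assumes f: "simple_function \<mu> f" and fP: "\<And>A. A \<in> Pos \<Longrightarrow> f A \<in> Pos"
  shows "\<exists>X\<in>Pos. Bochner_Integration.simple_bochner_integrable \<mu> (\<lambda>A. log_at X (f A)) \<and>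
    Bochner_Integration.simple_bochner_integral \<mu> (\<lambda>A. log_at X (f A)) = 0"
proof -
  interpret L: prob_space \<mu> by (rule prob_space_law)
  define I where "I = f ` Pos"
  have fin: "finite I" using simple_functionD(1)[OF f] by (simp add: I_def space_mu)
  have IP: "c \<in> I \<Longrightarrow> c \<in> Pos" for c using fP by (auto simp: I_def)
  define w where "w c = measure \<mu> {A\<in>space \<mu>. f A = c}" for c
  have "\<forall>c\<in>I. \<exists>R\<ge>0. bnd R c" using IP Pos_posop posop_bnd by metis
  then obtain \<rho> where \<rho>: "\<And>c. c \<in> I \<Longrightarrow> 0 \<le> \<rho> c \<and> bnd (\<rho> c) c" by metis
  define R where "R = (\<Sum>c\<in>I. \<rho> c)"
  have R: "0 \<le> R" unfolding R_def using \<rho> by (intro sum_nonneg) auto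
  have bR: "bnd R c" if "c \<in> I" for c
    by (rule bnd_mono[of "\<rho> c"]) (use \<rho> that member_le_sum[of c I \<rho>] fin in \<open>auto simp: R_def\<close>)
  have w1: "(\<Sum>c\<in>I. w c) = 1"
  proof -
    have "(\<Sum>c\<in>I. w c) = measure \<mu> (\<Union>c\<in>I. {A\<in>space \<mu>. f A = c})"
      unfolding w_def
    proof (rule L.finite_measure_finite_Union[symmetric, OF fin])
      have "{A\<in>space \<mu>. f A = c} = f -` {c} \<inter> space \<mu>" for c by auto
      then show "(\<lambda>c. {A\<in>space \<mu>. f A = c}) ` I \<subseteq> sets \<mu>"
        using simple_functionD(2)[OF f] by auto
    qed (auto simp: disjoint_family_on_def)
    also have "(\<Union>c\<in>I. {A\<in>space \<mu>. f A = c}) = space \<mu>" by (auto simp: I_def space_mu)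
    finally show ?thesis by (simp add: L.prob_space)
  qed
  obtain X where X: "X \<in> Pos" "(\<Sum>c\<in>I. w c *\<^sub>R log_at X c) = 0"
    using finite_karcher_exists[of I w "\<lambda>c. c" R] w1 IP bR R by (auto simp: w_def)
  have sf: "simple_function \<mu> (\<lambda>A. log_at X (f A))" by (rule simple_function_compose1[OF f])
  have i: "Bochner_Integration.simple_bochner_integrable \<mu> (\<lambda>A. log_at X (f A))"
    by (rule Bochner_Integration.simple_bochner_integrable.intros[OF sf]) (simp add: L.emeasure_eq_measure)
  have "Bochner_Integration.simple_bochner_integral \<mu> (\<lambda>A. log_at X (f A))
      = (\<Sum>c\<in>f ` space \<mu>. measure \<mu> {A\<in>space \<mu>. f A = c} *\<^sub>R log_at X c)"
    by (rule simple_bochner_integral_partition[OF i f]) auto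
  then show ?thesis using X i by (auto simp: I_def w_def space_mu)
qed

text \<open>The strong law for the image of \<open>\<mu>\<close> under \<open>f\<close>. There are no tails, as \<open>f\<close> is bounded.\<close>

lemma simple_means_tendsto:
  assumes f: "simple_function \<mu> f" and fP: "\<And>A. A \<in> Pos \<Longrightarrow> f A \<in> Pos" and X: "X \<in> Pos"
    and eq: "Bochner_Integration.simple_bochner_integral \<mu> (\<lambda>A. log_at X (f A)) = 0"
  shows "AE \<omega> in \<Omega>. (\<lambda>n. thompson_dist (ind_mean (\<lambda>i. f (Y i \<omega>)) n) X) \<longlonglongrightarrow> 0"
  using simple_averages_tendsto[OF simple_function_compose1[OF f, of "log_at X"]] AE_space
proof eventually_elim
  case (elim \<omega>)
  have YP: "f (Y i \<omega>) \<in> Pos" if "i \<ge> 1" for i by (rule fP[OF Y_Pos[OF elim(2) that]])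
  have fin: "finite (f ` Pos)" using simple_functionD(1)[OF f] by (simp add: space_mu)
  define r where "r = (\<Sum>c\<in>f ` Pos. thompson_dist X c)"
  have r: "thompson_dist X (f (Y i \<omega>)) \<le> r" if "i \<ge> 1" for i
    unfolding r_def using Y_Pos[OF elim(2) that] fin by (intro member_le_sum) auto
  show ?case
  proof (rule ind_mean_tendsto[OF _ Pos_posop[OF X]])
    show "posop (f (Y i \<omega>))" if "i \<ge> 1" for i using YP[OF that] by (rule Pos_posop)
    show "(\<lambda>n. (1 / real n) *\<^sub>R (\<Sum>i=1..n. log_at X (f (Y i \<omega>)))) \<longlonglongrightarrow> 0"
      using elim(1) by (simp only: eq)
    fix e :: real assume "e > 0"
    have "(\<Sum>i=1..n. if thompson_dist X (f (Y i \<omega>)) > r then 1 + thompson_dist X (f (Y i \<omega>)) else 0) \<le> e * real n" for n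
    proof -
      have "(\<Sum>i=1..n. if thompson_dist X (f (Y i \<omega>)) > r then 1 + thompson_dist X (f (Y i \<omega>)) else 0) = (\<Sum>i=1..n. 0)"
      proof (rule sum.cong)
        fix i assume "i \<in> {1..n}"
        then have "\<not> thompson_dist X (f (Y i \<omega>)) > r" using r[of i] by simp
        then show "(if thompson_dist X (f (Y i \<omega>)) > r then 1 + thompson_dist X (f (Y i \<omega>)) else 0) = 0" by simp
      qed simp
      then show ?thesis using \<open>e > 0\<close> by simp
    qed
    moreover have "0 \<le> r" unfolding r_def by (intro sum_nonneg) simp
    ultimately show "\<exists>r\<ge>0. \<forall>\<^sub>F n in sequentially. (\<Sum>i=1..n. if thompson_dist X (f (Y i \<omega>)) > r
        then 1 + thompson_dist X (f (Y i \<omega>)) else 0) \<le> e * real n"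
      by (intro exI[of _ r] conjI always_eventually allI)
  qed
qed

text \<open>The solutions \<open>X\<^sub>k\<close> for finitely valued approximations \<open>f\<^sub>k\<close> form a Cauchy sequence, because the
  inductive means of the \<open>f\<^sub>k(Y\<^sub>i)\<close> tend to \<open>X\<^sub>k\<close> and stay close to those of the \<open>Y\<^sub>i\<close>.
  The limit solves the Karcher equation by dominated convergence.\<close>

lemma solution_exists: "\<exists>X\<in>Pos. has_bochner_integral_general \<mu> (log_at X) 0"
proof -
  interpret L: prob_space \<mu> by (rule prob_space_law)
  obtain Z where Z: "Z \<in> Pos" using L.not_empty space_mu by blast
  obtain f where F: "(\<forall>k::nat. simple_function \<mu> (f k)) \<and>
    (\<forall>k. \<forall>A\<in>Pos. f k A \<in> Pos \<and> thompson_dist (f k A) A \<le> 1 + thompson_dist Z A) \<and>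
    (AE A in \<mu>. (\<lambda>k. thompson_dist (f k A) A) \<longlonglongrightarrow> 0)"
    using simple_approximation[OF Z] by (rule exE)
  have f: "simple_function \<mu> (f k)" "A \<in> Pos \<Longrightarrow> f k A \<in> Pos"
    "A \<in> Pos \<Longrightarrow> thompson_dist (f k A) A \<le> 1 + thompson_dist Z A"
    "AE A in \<mu>. (\<lambda>k. thompson_dist (f k A) A) \<longlonglongrightarrow> 0" for k A
    using F by simp_all
  have ex: "\<exists>X. X \<in> Pos \<and> Bochner_Integration.simple_bochner_integrable \<mu> (\<lambda>A. log_at X (f k A)) \<and>
      Bochner_Integration.simple_bochner_integral \<mu> (\<lambda>A. log_at X (f k A)) = 0" for k
    using simple_karcher_exists[OF f(1)[of k] f(2)] unfolding Bex_def .
  define X where "X k = (SOME X. X \<in> Pos \<and> Bochner_Integration.simple_bochner_integrable \<mu> (\<lambda>A. log_at X (f k A)) \<and>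
      Bochner_Integration.simple_bochner_integral \<mu> (\<lambda>A. log_at X (f k A)) = 0)" for k
  have X: "X k \<in> Pos" "Bochner_Integration.simple_bochner_integrable \<mu> (\<lambda>A. log_at (X k) (f k A))"
    "Bochner_Integration.simple_bochner_integral \<mu> (\<lambda>A. log_at (X k) (f k A)) = 0" for k
    using someI_ex[OF ex[of k], folded X_def] by simp_all
  define g where "g k A = thompson_dist (f k A) A" for k A
  have gm: "g k \<in> borel_measurable \<mu>" for k
    unfolding g_def
    by (rule simple_parameter_measurable[OF f(1), where h = thompson_dist])
      (use f(2) space_mu in \<open>auto intro: thompson_measurable\<close>)
  have g0: "0 \<le> g k A" for k A by (simp add: g_def)
  have iw: "integrable \<mu> (\<lambda>A. 1 + thompson_dist Z A)"
    by (intro Bochner_Integration.integrable_add thompson_integrable Z L.integrable_const)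
  have gb: "AE A in \<mu>. norm (g k A) \<le> 1 + thompson_dist Z A" for k
    using f(3) by (intro AE_I2) (simp add: g_def space_mu)
  have ig: "integrable \<mu> (g k)" for k
  proof (rule Bochner_Integration.integrable_bound[OF iw gm])
    show "AE A in \<mu>. norm (g k A) \<le> norm (1 + thompson_dist Z A)" using gb[of k]
      by eventually_elim simp
  qed
  have eg: "(\<lambda>k. \<integral>A. g k A \<partial>\<mu>) \<longlonglongrightarrow> (\<integral>A. 0 \<partial>\<mu>)"
  proof (rule integral_dominated_convergence[where s = g and w = "\<lambda>A. 1 + thompson_dist Z A"])
    show "AE A in \<mu>. (\<lambda>k. g k A) \<longlonglongrightarrow> 0" using f(4) by (simp add: g_def)
  qed (use gm iw gb in auto)
  define b where "b k = 2 * (\<integral>A. g k A \<partial>\<mu>) + 1 / (real k + 1)" for k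
  have lim1: "(\<lambda>k. 1 / (real k + 1)) \<longlonglongrightarrow> 0"
    using LIMSEQ_inverse_real_of_nat by (simp add: inverse_eq_divide add.commute)
  have "b \<longlonglongrightarrow> 2 * (\<integral>A. 0 \<partial>\<mu>) + 0" unfolding b_def
    by (rule tendsto_add[OF tendsto_mult[OF tendsto_const eg] lim1])
  then have b0: "b \<longlonglongrightarrow> 0" by simp
  have "AE \<omega> in \<Omega>. \<forall>\<^sub>F n in sequentially. (\<Sum>i=1..n. g k (Y i \<omega>)) \<le> b k * real n" for k
    unfolding b_def by (rule averages_bounded[where g = "g k", OF gm g0 ig]) simp
  then have "AE \<omega> in \<Omega>. \<forall>k. \<forall>\<^sub>F n in sequentially. (\<Sum>i=1..n. g k (Y i \<omega>)) \<le> b k * real n"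
    unfolding AE_all_countable by blast
  moreover have "AE \<omega> in \<Omega>. \<forall>k. (\<lambda>n. thompson_dist (ind_mean (\<lambda>i. f k (Y i \<omega>)) n) (X k)) \<longlonglongrightarrow> 0"
    unfolding AE_all_countable by (intro allI simple_means_tendsto f X)
  ultimately have "AE \<omega> in \<Omega>. \<forall>k l. thompson_dist (X k) (X l) \<le> b k + b l"
    using AE_space
  proof eventually_elim
    case (elim \<omega>)
    define S where "S n = ind_mean (\<lambda>i. Y i \<omega>) n" for n
    define M where "M k n = ind_mean (\<lambda>i. f k (Y i \<omega>)) n" for k n
    have pY: "posop (Y i \<omega>)" "posop (f k (Y i \<omega>))" if "i \<ge> 1" for i k
      using Y_Pos[OF elim(3) that] f(2)[OF Y_Pos[OF elim(3) that]] by (auto intro: Pos_posop)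
    have pS: "posop (S n)" "posop (M k n)" for n k
      unfolding S_def M_def by (intro posop_ind_mean pY; assumption)+
    have near: "\<forall>\<^sub>F n in sequentially. thompson_dist (M k n) (S n) \<le> b k" for k
      using elim(1)[rule_format, of k] eventually_gt_at_top[of 0]
    proof eventually_elim
      case (elim n)
      have "real n * thompson_dist (M k n) (S n) \<le> (\<Sum>i=1..n. thompson_dist (f k (Y i \<omega>)) (Y i \<omega>))"
        unfolding M_def S_def by (rule ind_mean_contract) (use pY in auto)
      also have "\<dots> \<le> real n * b k" using elim(1) by (simp add: g_def mult.commute)
      finally show ?case using elim(2) by simp
    qed
    show ?case
    proof (intro allI)
      fix k l
      have "\<forall>\<^sub>F n in sequentially. thompson_dist (X k) (X l) \<le>
          (thompson_dist (M k n) (X k) + thompson_dist (M l n) (X l)) + (b k + b l)"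
        using near[of k] near[of l]
      proof eventually_elim
        case (elim n)
        have p: "posop (X k)" "posop (X l)" "posop (M k n)" "posop (M l n)" "posop (S n)"
          by (rule Pos_posop[OF X(1)] pS)+
        show ?case
          using elim thompson_triangle[OF p(1,3,2)] thompson_triangle[OF p(3,5,2)]
            thompson_triangle[OF p(5,4,2)] thompson_sym[OF p(1,3)] thompson_sym[OF p(5,4)] by linarith
      qed
      moreover have "(\<lambda>n. (thompson_dist (M k n) (X k) + thompson_dist (M l n) (X l)) + (b k + b l)) \<longlonglongrightarrow> (0 + 0) + (b k + b l)"
        unfolding M_def using elim(2) by (intro tendsto_add tendsto_const) auto
      ultimately show "thompson_dist (X k) (X l) \<le> b k + b l"
        using tendsto_lowerbound[OF _ _ sequentially_bot] by fastforce
    qed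
  qed
  then have Xb: "thompson_dist (X k) (X l) \<le> b k + b l" for k l by (simp add: AE_const)
  have cauchy: "\<exists>N. \<forall>m\<ge>N. \<forall>n\<ge>N. thompson_dist (X m) (X n) < e" if "e > 0" for e
  proof -
    have "e / 2 > 0" using that by simp
    from order_tendstoD(2)[OF b0 this] obtain N where N: "\<And>n. n \<ge> N \<Longrightarrow> b n < e / 2"
      by (auto simp: eventually_sequentially)
    have "thompson_dist (X m) (X n) < e" if "m \<ge> N" "n \<ge> N" for m n
      using Xb[of m n] N[OF that(1)] N[OF that(2)] by linarith
    then show ?thesis by blast
  qed
  obtain W where W: "W \<in> Pos" "(\<lambda>k. thompson_dist (X k) W) \<longlonglongrightarrow> 0"
    using Pos_complete[OF X(1) cauchy] by blast
  note pW = Pos_posop[OF W(1)] and pX = Pos_posop[OF X(1)] and pZ = Pos_posop[OF Z]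
  obtain R where R: "R \<ge> 0" "\<And>k. bnd R (X k)" "bnd R W"
    using thompson_tendsto_bnd[OF pW pX W(2)] by blast
  obtain c where c: "\<And>k. thompson_dist (X k) W \<le> c"
  proof -
    have "Bseq (\<lambda>k. thompson_dist (X k) W)" using W(2) by (intro convergent_imp_Bseq convergentI)
    then obtain C where "\<And>k. norm (thompson_dist (X k) W) \<le> C" unfolding Bseq_def by blast
    then show ?thesis by (intro that[of C]) simp
  qed
  define u where "u k A = norm (log_at W A - log_at (X k) (f k A))" for k A
  define v where "v A = exp R * (1 + c + 2 * thompson_dist W A + thompson_dist Z A)" for A
  have um: "u k \<in> borel_measurable \<mu>" for k
    unfolding u_def using simple_function_compose1[OF f(1), of "log_at (X k)"]
    by (intro norm_diff_simple_measurable log_at_measurable W) auto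
  have uv: "u k A \<le> v A" if A: "A \<in> Pos" for k A
  proof -
    note pA = Pos_posop[OF A] Pos_posop[OF f(2)[OF A]]
    have "u k A \<le> norm (log_at W A) + norm (log_at (X k) (f k A))" unfolding u_def by (rule norm_triangle_ineq4)
    also have "norm (log_at W A) \<le> exp R * thompson_dist W A"
      using norm_log_at_le[OF pW] mult_right_mono[OF bnd_norm[OF R(3,1)] thompson_nonneg] by (rule order_trans)
    also have "norm (log_at (X k) (f k A)) \<le> exp R * thompson_dist (X k) (f k A)"
      using norm_log_at_le[OF pX] mult_right_mono[OF bnd_norm[OF R(2,1)] thompson_nonneg] by (rule order_trans)
    also have "thompson_dist (X k) (f k A) \<le> c + thompson_dist W A + (1 + thompson_dist Z A)"
      using thompson_triangle[OF pX pW pA(2), of k k] thompson_triangle[OF pW pA(1) pA(2), of k]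
        thompson_sym[OF pA, of k] c[of k] f(3)[OF A, of k] by linarith
    finally show ?thesis by (simp add: v_def algebra_simps)
  qed
  have iv: "integrable \<mu> v"
    unfolding v_def by (intro integrable_mult_right Bochner_Integration.integrable_add L.integrable_const thompson_integrable W Z)
  have v0: "0 \<le> v A" for A
  proof -
    have "0 \<le> c" using order_trans[OF thompson_nonneg c] .
    then show ?thesis by (simp add: v_def)
  qed
  have "(\<lambda>k. \<integral>\<^sup>+ A. ennreal (u k A) \<partial>\<mu>) \<longlonglongrightarrow> (\<integral>\<^sup>+ A. 0 \<partial>\<mu>)"
  proof (rule nn_integral_dominated_convergence[where w = "\<lambda>A. ennreal (v A)"])
    show "(\<lambda>A. ennreal (u k A)) \<in> borel_measurable \<mu>" for k using um[of k] by measurable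
    show "(\<lambda>A. ennreal (v A)) \<in> borel_measurable \<mu>" using borel_measurable_integrable[OF iv] by measurable
    show "AE A in \<mu>. ennreal (u k A) \<le> ennreal (v A)" for k
      by (rule AE_I2) (use uv in \<open>simp add: space_mu ennreal_leI\<close>)
    show "(\<integral>\<^sup>+ A. ennreal (v A) \<partial>\<mu>) < \<infinity>"
      using nn_integral_eq_integral[OF iv] v0 by simp
    show "AE A in \<mu>. (\<lambda>k. ennreal (u k A)) \<longlonglongrightarrow> 0"
      using f(4) AE_space
    proof eventually_elim
      case (elim A)
      then have A: "A \<in> Pos" by (simp add: space_mu)
      have "(\<lambda>k. log_at (X k) (f k A)) \<longlonglongrightarrow> log_at W A"
        by (rule log_at_tendsto[OF pW pX W(2) Pos_posop[OF A] Pos_posop[OF f(2)[OF A]] elim(1)])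
      then have "(\<lambda>k. norm (log_at W A - log_at (X k) (f k A))) \<longlonglongrightarrow> norm (log_at W A - log_at W A)"
        by (intro tendsto_norm tendsto_diff tendsto_const)
      then have "(\<lambda>k. u k A) \<longlonglongrightarrow> 0" by (simp add: u_def)
      then have "(\<lambda>k. ennreal (u k A)) \<longlonglongrightarrow> ennreal 0" by (rule tendsto_ennrealI)
      then show ?case by simp
    qed
  qed simp
  then have "(\<lambda>k. \<integral>\<^sup>+ A. ennreal (norm (log_at W A - log_at (X k) (f k A))) \<partial>\<mu>) \<longlonglongrightarrow> 0"
    by (simp add: u_def)
  then have "has_bochner_integral_general \<mu> (log_at W) 0"
    unfolding has_bochner_integral_general_def
    by (intro conjI exI[of _ "\<lambda>k A. log_at (X k) (f k A)"] log_at_measurable[OF W(1)] allI X(2))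
      (simp_all add: X(3))
  then show ?thesis using W(1) by blast
qed

theorem karcher_strong_law:
  "AE \<omega> in \<Omega>. limitin (thompson_topology Pos) (ind_mean (\<lambda>i. Y i \<omega>)) (karcher_mean Pos \<mu>) sequentially"
proof -
  obtain X where X: "X \<in> Pos" "has_bochner_integral_general \<mu> (log_at X) 0"
    using solution_exists by blast
  have K: "karcher_mean Pos \<mu> = X"
    unfolding karcher_mean_def by (rule the_equality) (use X solution_unique in auto)
  show ?thesis using solution_is_limit[OF X] AE_space
  proof eventually_elim
    case (elim \<omega>)
    have P: "ind_mean (\<lambda>i. Y i \<omega>) n \<in> Pos" for n
      by (rule ind_mean_Pos) (rule Y_Pos[OF elim(2)])
    show ?case unfolding K thompson_topology_eq T.limitin_metric
    proof (intro conjI allI impI X(1))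
      fix e :: real assume "e > 0"
      from order_tendstoD(2)[OF elim(1) this]
      show "\<forall>\<^sub>F n in sequentially. ind_mean (\<lambda>i. Y i \<omega>) n \<in> Pos \<and> dP (ind_mean (\<lambda>i. Y i \<omega>) n) X < e"
        by eventually_elim (use P X(1) in \<open>simp add: dP_def\<close>)
    qed
  qed
qed

end

section \<open>The strong law on the cone of a real or complex Hilbert space\<close>

lemma (in hilbert_space) norm_scal:
  assumes "a \<in> K"
  shows "norm (scal a x) = cmod a * norm x"
proof -
  have "ip (scal a x) (scal a x) = a * cnj (ip (scal a x) x)"
    using ip_scale[OF assms, of x "scal a x"] ip_commute[of x "scal a x"] by simp
  also have "\<dots> = a * cnj a * cnj (ip x x)" using ip_scale[OF assms, of x x] by simp
  also have "a * cnj a = complex_of_real ((cmod a)\<^sup>2)" by (rule complex_norm_square[symmetric])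
  finally have "scal a x \<bullet> scal a x = (cmod a)\<^sup>2 * (x \<bullet> x)"
    by (simp flip: Re_ip)
  then have "(norm (scal a x))\<^sup>2 = (cmod a * norm x)\<^sup>2"
    by (simp add: power2_norm_eq_inner power_mult_distrib)
  then show ?thesis by (simp add: power2_eq_iff_nonneg)
qed

lemma (in hilbert_space) op_algebra_linear:
  "op_algebra {A. \<forall>a\<in>K. \<forall>x. blinfun_apply A (scal a x) = scal a (blinfun_apply A x)}"
proof -
  have real: "complex_of_real r \<in> K" for r using scalars by auto
  have comm: "scal a (r *\<^sub>R x) = r *\<^sub>R scal a x" if "a \<in> K" for a r x
    using scale_scale[OF that real, of r x] scale_scale[OF real that, of r x]
    by (simp add: scale_of_real mult.commute)
  have diff: "scal a (x - y) = scal a x - scal a y" if "a \<in> K" for a x y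
    using scale_add_right[OF that, of x "(-1) *\<^sub>R y"] comm[OF that, of "-1" y] by simp
  show ?thesis
  proof
    show "closed {A. \<forall>a\<in>K. \<forall>x. blinfun_apply A (scal a x) = scal a (blinfun_apply A x)}"
      unfolding closed_sequential_limits
    proof (intro allI impI CollectI ballI, elim conjE)
      fix f l a x
      assume f: "\<forall>n. f n \<in> {A. \<forall>a\<in>K. \<forall>x. blinfun_apply A (scal a x) = scal a (blinfun_apply A x)}"
        and l: "f \<longlonglongrightarrow> l" and a: "a \<in> K"
      have 1: "(\<lambda>n. f n (scal a x)) \<longlonglongrightarrow> l (scal a x)" by (intro tendsto_intros l)
      have "(\<lambda>n. f n x - l x) \<longlonglongrightarrow> 0" by (rule LIM_zero) (intro tendsto_intros l)
      then have "(\<lambda>n. scal a (f n x - l x)) \<longlonglongrightarrow> 0"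
        by (rule tendsto_null_bound[rotated, where c = "cmod a"]) (simp add: norm_scal[OF a])
      then have "(\<lambda>n. f n (scal a x) - scal a (l x)) \<longlonglongrightarrow> 0" using f a by (simp add: diff)
      then have "(\<lambda>n. f n (scal a x)) \<longlonglongrightarrow> scal a (l x)" by (rule LIM_zero_cancel)
      with 1 show "l (scal a x) = scal a (l x)" by (rule LIMSEQ_unique)
    qed
  qed (auto simp: ap_simps comm scale_add_right)
qed

text \<open>Self-adjointness for \<open>ip\<close> and for its real part agree on \<open>K\<close>-linear operators.\<close>

lemma (in hilbert_space) sadj_iff:
  assumes A: "\<forall>a\<in>K. \<forall>x. blinfun_apply A (scal a x) = scal a (blinfun_apply A x)"
  shows "(\<forall>x y. ip (blinfun_apply A x) y = ip x (blinfun_apply A y)) \<longleftrightarrow> sadj A"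
proof
  assume "\<forall>x y. ip (blinfun_apply A x) y = ip x (blinfun_apply A y)"
  then show "sadj A" by (simp add: sadj_def flip: Re_ip)
next
  assume s: "sadj A"
  then have re: "Re (ip (A x) y) = Re (ip x (A y))" for x y by (simp add: Re_ip sadj_def)
  show "\<forall>x y. ip (blinfun_apply A x) y = ip x (blinfun_apply A y)"
  proof (intro allI)
    fix x y
    from scalars show "ip (A x) y = ip x (A y)"
    proof
      assume "K = \<real>"
      then show ?thesis using re[of x y] ip_scalar[of "A x" y] ip_scalar[of x "A y"]
        by (auto simp: complex_is_Real_iff complex_eq_iff)
    next
      \<comment> \<open>The imaginary part of \<open>ip x y\<close> is \<open>- Re (ip (\<i> x) y)\<close>.\<close>
      assume K: "K = UNIV"
      have "ip (A (scal \<i> x)) y = \<i> * ip (A x) y" "ip (scal \<i> x) (A y) = \<i> * ip x (A y)"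
        using A K by (simp_all add: ip_scale)
      then show ?thesis using re[of x y] re[of "scal \<i> x" y] by (simp add: complex_eq_iff)
    qed
  qed
qed

lemma (in hilbert_space) pos_cone_eq:
  "pos_cone K scal ip = {A \<in> {A. \<forall>a\<in>K. \<forall>x. blinfun_apply A (scal a x) = scal a (blinfun_apply A x)}. posop A}"
proof -
  have E: "sadj A \<Longrightarrow> ((\<forall>x. x \<noteq> 0 \<longrightarrow> 0 < A x \<bullet> x) \<and> op_invertible A) \<longleftrightarrow> posop A" for A :: "'h \<Rightarrow>\<^sub>L 'h"
  proof
    assume s: "sadj A" and h: "(\<forall>x. x \<noteq> 0 \<longrightarrow> 0 < A x \<bullet> x) \<and> op_invertible A"
    have "0 \<le> A x \<bullet> x" for x using h by (cases "x = 0") (auto intro: less_imp_le)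
    then obtain m where "m > 0" "\<And>x. m * (norm x)\<^sup>2 \<le> A x \<bullet> x"
      using coercive_of_invertible[OF s] h by blast
    then show "posop A" using s by (auto simp: posop_def op_le_def ap_simps power2_norm_eq_inner intro!: exI[of _ m])
  next
    assume "posop A"
    then obtain m where m: "m > 0" "\<And>x. m * (norm x)\<^sup>2 \<le> A x \<bullet> x"
      by (auto simp: posop_def op_le_def ap_simps power2_norm_eq_inner)
    have "0 < A x \<bullet> x" if "x \<noteq> 0" for x
    proof -
      have "0 < m * (norm x)\<^sup>2" using m(1) that by simp
      then show ?thesis using m(2)[of x] by linarith
    qed
    then show "(\<forall>x. x \<noteq> 0 \<longrightarrow> 0 < A x \<bullet> x) \<and> op_invertible A"
      using op_invertible_coercive[OF m] by blast
  qed
  have "(\<forall>a\<in>K. \<forall>x. A (scal a x) = scal a (A x)) \<and> (\<forall>x y. ip (A x) y = ip x (A y)) \<and>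
      (\<forall>x. x \<noteq> 0 \<longrightarrow> 0 < A x \<bullet> x) \<and> op_invertible A
    \<longleftrightarrow> (\<forall>a\<in>K. \<forall>x. A (scal a x) = scal a (A x)) \<and> posop A" for A :: "'h \<Rightarrow>\<^sub>L 'h"
  proof (cases "\<forall>a\<in>K. \<forall>x. A (scal a x) = scal a (A x)")
    case lin: True
    show ?thesis
    proof (cases "sadj A")
      case True
      then show ?thesis unfolding sadj_iff[OF lin] E[OF True, symmetric] by simp
    next
      case False
      then show ?thesis unfolding sadj_iff[OF lin] using posop_sadj by blast
    qed
  qed blast
  then show ?thesis unfolding pos_cone_def Re_ip by (simp only: mem_Collect_eq)
qed

theorem theorem6p1:
  fixes K :: "complex set"
    and scal :: "complex \<Rightarrow> 'h \<Rightarrow> 'h :: {real_inner, complete_space}"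
    and ip :: "'h \<Rightarrow> 'h \<Rightarrow> complex"
    and P :: "('h \<Rightarrow>\<^sub>L 'h) set"
    and \<mu> :: "('h \<Rightarrow>\<^sub>L 'h) measure"
    and \<Omega> :: "'w measure"
    and Y S :: "nat \<Rightarrow> 'w \<Rightarrow> ('h \<Rightarrow>\<^sub>L 'h)"
  assumes "hilbert_space K scal ip"
    and "P = pos_cone K scal ip"
    and "\<mu> \<in> prob_measures_L1 P"
    and "prob_space \<Omega>"
    and indep: "prob_space.indep_vars \<Omega> (\<lambda>_. \<mu>) Y {1..}"
    and law: "\<And>i. i \<ge> 1 \<Longrightarrow> distr \<Omega> \<mu> (Y i) = \<mu>"
    and "\<And>\<omega>. \<omega> \<in> space \<Omega> \<Longrightarrow> S 1 \<omega> = Y 1 \<omega>"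
    and "\<And>n \<omega>. n \<ge> 1 \<Longrightarrow> \<omega> \<in> space \<Omega> \<Longrightarrow>
           S (n + 1) \<omega> = geom_mean (S n \<omega>) (1 / (real n + 1)) (Y (n + 1) \<omega>)"
  shows "AE \<omega> in \<Omega>.
           limitin (thompson_topology P) (\<lambda>n. S n \<omega>) (karcher_mean P \<mu>) sequentially"
proof -
  define L where "L = {A :: 'h \<Rightarrow>\<^sub>L 'h. \<forall>a\<in>K. \<forall>x. blinfun_apply A (scal a x) = scal a (blinfun_apply A x)}"
  interpret A: op_algebra L unfolding L_def by (rule hilbert_space.op_algebra_linear[OF assms(1)])
  have P: "P = A.Pos"
    unfolding assms(2) hilbert_space.pos_cone_eq[OF assms(1)] A.Pos_def by (simp add: L_def)
  interpret prob_space \<Omega> by (rule assms(4))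
  interpret karcher_setting L \<Omega> \<mu> Y
    by unfold_locales (use indep law assms(3) P in auto)
  show ?thesis using karcher_strong_law AE_space
  proof eventually_elim
    case (elim \<omega>)
    have Yp: "posop (Y 1 \<omega>)" using A.Pos_posop[OF Y_Pos[OF elim(2)]] by simp
    have "S n \<omega> = ind_mean (\<lambda>i. Y i \<omega>) n" if "n \<ge> 1" for n
      using that
    proof (induction n rule: dec_induct)
      case base
      then show ?case using assms(7)[OF elim(2)] Yp by (simp add: geom_mean_same)
    next
      case (step n)
      then show ?case using assms(8)[of n \<omega>] elim(2) by simp
    qed
    then have ev: "\<forall>\<^sub>F n in sequentially. ind_mean (\<lambda>i. Y i \<omega>) n = S n \<omega>"
      by (auto simp: eventually_sequentially intro!: exI[of _ 1])
    from elim(1) show ?case unfolding P by (rule limitin_transform_eventually[OF ev])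
  qed
qed

end
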